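(* Let $\Gamma=(V,E,s,r)$ be a finite graph and $F$ a field. Let $W_1,\dots,W_k$ be all distinct minimal hereditary subsets of $V$, let $[1,k]=I_1\,\dot\cup\cdots\dot\cup\, I_m$ be the decomposition of $\{1,\dots,k\}$ into classes of the equivalence relation $\sim$ defined in the context, and put $U_i=\Big(\big(\bigcup_{j\in I_i}W_j\big)^{\perp}\Big)^{\perp}$ for $1\le i\le m$ (these are finitary hereditary subsets). Then: (a) $Z(L(\Gamma))=\bigoplus_{i=1}^{m}\varphi_{U_i}\big(Z(L(U_i))\big)$, where $Z(\cdot)$ denotes the center; (b) if $U_i=((W_j)^{\perp})^{\perp}$ where $W_j=V(C)$ and $C$ is a finitary NE-cycle, then $Z(L(U_i))\cong F[t^{-1},t]$; otherwise $Z(L(U_i))\cong F$.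
   Context: A (directed) graph $\Gamma=(V,E,s,r)$ consists of a set $V$ of vertices, a set $E$ of edges and maps $s,r:E\to V$ (source and range); it is finite if $V$ and $E$ are finite. A sink is a vertex $v$ with $s^{-1}(v)=\emptyset$. A path of length $n\ge 1$ is a sequence $p=e_1\cdots e_n$ of edges with $r(e_i)=s(e_{i+1})$ for $1\le i<n$; $s(p)=s(e_1)$, $r(p)=r(e_n)$. Each vertex $v$ is a path of length $0$ with source and range $v$. $E(X,Y)$ and $Path(X,Y)$ are the sets of edges, respectively paths, with source in $X$ and range in $Y$. A vertex $w$ is a descendant of $v$ if there is a path from $v$ to $w$. A subset $W\subseteq V$ is hereditary if all descendants of vertices of $W$ lie in $W$. A minimal hereditary subset is one that is minimal among nonempty hereditary subsets. For nonempty $W\subseteq V$, $W^{\perp}=\{v\in V\mid Path(\{v\},W)=\emptyset\}$, and $\emptyset^{\perp}=V$. A cycle is a path $C=e_1\cdots e_n$, $n\ge1$, with $s(C)=r(C)$ and $s(e_1),\dots,s(e_n)$ distinct; $V(C)=\{s(e_1),\dots,s(e_n)\}$, $E(C)=\{e_1,\dots,e_n\}$. An exit of $C$ is an edge $e\notin E(C)$ with $s(e)\in V(C)$; an NE-cycle is a cycle without exits. For a cycle $C$ and hereditary $W$, write $C\Rightarrow W$ if $V(C)\cap W=\emptyset$ and all vertices of $V(C)$ have descendants in $W$. For nonempty $W$, an arrival path in $W$ is a path $p=e_1\cdots e_n$ with $r(p)\in W$ and $s(e_1),\dots,s(e_n)\notin W$; each $w\in W$ is an arrival path of length $0$. $Arr(W)$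 is the set of arrival paths in $W$. A hereditary subset $W$ is finitary if $|Arr(W)|<\infty$. An NE-cycle $C$ is finitary if the hereditary set $V(C)$ is finitary. The relation $\sim$ on $\{1,\dots,k\}$: it is the equivalence relation generated by declaring $i\sim j$ whenever there is a cycle $C$ in $\Gamma$ with $C\Rightarrow W_i$ and $C\Rightarrow W_j$. The Leavitt path algebra $L(\Gamma)$ over $F$ is the $F$-algebra presented by generators $v$ ($v\in V$), $e,e^{*}$ ($e\in E$) and relations: (1) $vw=\delta_{v,w}v$; (2) $s(e)e=er(e)=e$, $r(e)e^{*}=e^{*}s(e)=e^{*}$; (3) $e^{*}f=\delta_{e,f}r(e)$; (4) $v=\sum_{s(e)=v}ee^{*}$ for every $v$ that is not a sink. For a path $p=e_1\cdots e_n$, $p^{*}=e_n^{*}\cdots e_1^{*}$; $v^*=v$ for $v\in V$. For a nonempty hereditary $W$, $L(W)$ is the subalgebra of $L(\Gamma)$ generated by $W$, $E(W,W)$, $E(W,W)^{*}$ (isomorphic to the Leavitt path algebra of the graph $(W,E(W,W))$). Put $diag\,L(\Gamma)=\sum_{v\in V}vL(\Gamma)v$, and similarly $diag\,L(W)=\sum_{w\in W}wL(W)w$ (which contains $Z(L(W))$). For $W$ nonempty, hereditary and finitary, the diagonal embedding is $\varphi_W:diag\,L(W)\to diag\,L(\Gamma)$, $\varphi_W(a)=\sum_{p\in Arr(W)}pap^{*}$. *)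

theory Defs
  imports
    "HOL-Library.Poly_Mapping"
    "HOL-Algebra.QuotRing"
    "HOL-Algebra.Module"
    "Graph_Theory.Arc_Walk"
begin

section \<open>Directed graphs\<close>

text \<open>
  Graphs are those of \<^theory>\<open>Graph_Theory.Digraph\<close>, with source \<^const>\<open>tail\<close> and range
  \<^const>\<open>head\<close>; parallel arcs and loops are allowed.  A path is represented by its source
  together with its list of arcs, so that the vertex \<open>v\<close>, as a path of length 0, is \<open>(v, [])\<close>.
\<close>

definition hereditary :: "('v, 'e) pre_digraph \<Rightarrow> 'v set \<Rightarrow> bool" where
  "hereditary G W \<longleftrightarrow> W \<subseteq> verts G \<and> (\<forall>w\<in>W. \<forall>p x. pre_digraph.awalk G w p x \<longrightarrow> x \<in> W)"

definition minimal_hereditary :: "('v, 'e) pre_digraph \<Rightarrow> 'v set \<Rightarrow> bool" where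
  "minimal_hereditary G W \<longleftrightarrow> hereditary G W \<and> W \<noteq> {} \<and>
     (\<forall>X. hereditary G X \<and> X \<noteq> {} \<and> X \<subseteq> W \<longrightarrow> X = W)"

definition perp :: "('v, 'e) pre_digraph \<Rightarrow> 'v set \<Rightarrow> 'v set" where
  "perp G W = {v \<in> verts G. \<not> (\<exists>p. \<exists>w\<in>W. pre_digraph.awalk G v p w)}"

definition arcs_between :: "('v, 'e) pre_digraph \<Rightarrow> 'v set \<Rightarrow> 'v set \<Rightarrow> 'e set" where
  "arcs_between G X Y = {e \<in> arcs G. tail G e \<in> X \<and> head G e \<in> Y}"

definition cycle_verts :: "('v, 'e) pre_digraph \<Rightarrow> 'e list \<Rightarrow> 'v set" where
  "cycle_verts G C = tail G ` set C"

text \<open>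
  \<^const>\<open>pre_digraph.cycle\<close> asks for distinct ranges of the arcs; in a closed path these are
  the sources, cyclically shifted.
\<close>

definition ne_cycle :: "('v, 'e) pre_digraph \<Rightarrow> 'e list \<Rightarrow> bool" where
  "ne_cycle G C \<longleftrightarrow> pre_digraph.cycle G C \<and>
     \<not> (\<exists>e \<in> arcs G. e \<notin> set C \<and> tail G e \<in> cycle_verts G C)"

definition cycle_leads_to :: "('v, 'e) pre_digraph \<Rightarrow> 'e list \<Rightarrow> 'v set \<Rightarrow> bool" where
  "cycle_leads_to G C W \<longleftrightarrow> cycle_verts G C \<inter> W = {} \<and>
     (\<forall>v \<in> cycle_verts G C. \<exists>p. \<exists>w\<in>W. pre_digraph.awalk G v p w)"

definition arrival_paths :: "('v, 'e) pre_digraph \<Rightarrow> 'v set \<Rightarrow> ('v \<times> 'e list) set" where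
  "arrival_paths G W = {(u, p). (\<exists>w\<in>W. pre_digraph.awalk G u p w) \<and> (\<forall>e \<in> set p. tail G e \<notin> W)}"

definition finitary :: "('v, 'e) pre_digraph \<Rightarrow> 'v set \<Rightarrow> bool" where
  "finitary G W \<longleftrightarrow> hereditary G W \<and> finite (arrival_paths G W)"

definition finitary_ne_cycle :: "('v, 'e) pre_digraph \<Rightarrow> 'e list \<Rightarrow> bool" where
  "finitary_ne_cycle G C \<longleftrightarrow> ne_cycle G C \<and> finitary G (cycle_verts G C)"

definition generated_equiv :: "'a set \<Rightarrow> ('a \<times> 'a) set \<Rightarrow> ('a \<times> 'a) set" where
  "generated_equiv A r = \<Inter> {s. equiv A s \<and> r \<subseteq> s}"

definition cycle_equiv :: "('v, 'e) pre_digraph \<Rightarrow> nat \<Rightarrow> (nat \<Rightarrow> 'v set) \<Rightarrow> (nat \<times> nat) set" where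
  "cycle_equiv G k W = generated_equiv {1..k}
     {(i, j). i \<in> {1..k} \<and> j \<in> {1..k} \<and>
        (\<exists>C. pre_digraph.cycle G C \<and> cycle_leads_to G C (W i) \<and> cycle_leads_to G C (W j))}"


section \<open>Algebras over a field\<close>

text \<open>
  An algebra over the field \<open>'f\<close> is a record of type \<^typ>\<open>('f, 'a) module\<close>.  Subalgebras are not
  required to contain the unit.
\<close>

definition is_subalgebra :: "('f, 'a) module \<Rightarrow> 'a set \<Rightarrow> bool" where
  "is_subalgebra A S \<longleftrightarrow> S \<subseteq> carrier A \<and> \<zero>\<^bsub>A\<^esub> \<in> S \<and>
     (\<forall>x\<in>S. \<forall>y\<in>S. x \<oplus>\<^bsub>A\<^esub> y \<in> S \<and> x \<otimes>\<^bsub>A\<^esub> y \<in> S) \<and> (\<forall>c. \<forall>x\<in>S. c \<odot>\<^bsub>A\<^esub> x \<in> S)"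

definition generated_subalgebra :: "('f, 'a) module \<Rightarrow> 'a set \<Rightarrow> 'a set" where
  "generated_subalgebra A X = \<Inter> {S. is_subalgebra A S \<and> X \<subseteq> S}"

definition center :: "('f, 'a) module \<Rightarrow> ('f, 'a) module" where
  "center A = A\<lparr>carrier := {z \<in> carrier A. \<forall>a \<in> carrier A. a \<otimes>\<^bsub>A\<^esub> z = z \<otimes>\<^bsub>A\<^esub> a}\<rparr>"

definition isomorphic_algebras :: "('f, 'a) module \<Rightarrow> ('f, 'b) module \<Rightarrow> bool" where
  "isomorphic_algebras A B \<longleftrightarrow>
     (\<exists>h \<in> ring_iso A B. \<forall>c. \<forall>x \<in> carrier A. h (c \<odot>\<^bsub>A\<^esub> x) = c \<odot>\<^bsub>B\<^esub> h x)"

text \<open>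
  \<open>B\<close> is the internal direct sum, as an algebra, of the subsets \<open>S i\<close> of \<open>A\<close>: these are
  subalgebras annihilating each other, and every element of \<open>B\<close> is a sum of elements of the
  \<open>S i\<close> in exactly one way.
\<close>

definition internal_direct_sum ::
    "('f, 'a) module \<Rightarrow> 'i set \<Rightarrow> ('i \<Rightarrow> 'a set) \<Rightarrow> 'a set \<Rightarrow> bool" where
  "internal_direct_sum A I S B \<longleftrightarrow>
     (\<forall>i\<in>I. is_subalgebra A (S i)) \<and>
     (\<forall>i\<in>I. \<forall>j\<in>I. i \<noteq> j \<longrightarrow> (\<forall>x \<in> S i. \<forall>y \<in> S j. x \<otimes>\<^bsub>A\<^esub> y = \<zero>\<^bsub>A\<^esub>)) \<and>
     bij_betw (\<lambda>x. \<Oplus>\<^bsub>A\<^esub>i\<in>I. x i) (\<Pi>\<^sub>E i\<in>I. S i) B"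

definition base_algebra :: "('f::field, 'f) module" where
  "base_algebra = \<lparr>carrier = UNIV, mult = (*), one = 1, zero = 0, add = (+), smult = (*)\<rparr>"

text \<open>
  The Laurent polynomials in \<open>t\<close>: \<^term>\<open>Poly_Mapping.single n c\<close> is \<open>c t\<^sup>n\<close>, for \<open>n\<close> an integer.
\<close>

definition laurent_algebra :: "('f::field, int \<Rightarrow>\<^sub>0 'f) module" where
  "laurent_algebra =
     \<lparr>carrier = UNIV, mult = (*), one = 1, zero = 0, add = (+),
      smult = (\<lambda>c. Poly_Mapping.map ((*) c))\<rparr>"


section \<open>Free associative algebras\<close>

datatype 'a free_word = Word (letters: "'a list")

instantiation free_word :: (type) monoid_add
begin

definition zero_free_word :: "'a free_word" where
  "0 = Word []"

definition plus_free_word :: "'a free_word \<Rightarrow> 'a free_word \<Rightarrow> 'a free_word" where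
  "v + w = Word (letters v @ letters w)"

instance
  by standard (simp_all add: zero_free_word_def plus_free_word_def)

end

text \<open>
  Since the sum of words is concatenation, the product of \<^typ>\<open>'a free_word \<Rightarrow>\<^sub>0 'f\<close> is that of
  noncommutative polynomials.
\<close>

definition free_algebra :: "'a set \<Rightarrow> ('f::field, 'a free_word \<Rightarrow>\<^sub>0 'f) module" where
  "free_algebra X =
     \<lparr>carrier = {p. \<forall>w \<in> Poly_Mapping.keys p. set (letters w) \<subseteq> X},
      mult = (*), one = 1, zero = 0, add = (+),
      smult = (\<lambda>c. Poly_Mapping.map ((*) c))\<rparr>"

definition monomial :: "'a list \<Rightarrow> 'a free_word \<Rightarrow>\<^sub>0 'f::field" where
  "monomial xs = Poly_Mapping.single (Word xs) 1"


section \<open>Leavitt path algebras\<close>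

datatype ('v, 'e) leavitt_gen = Vert 'v | Edge 'e | Ghost 'e

type_synonym ('v, 'e, 'f) leavitt_poly = "('v, 'e) leavitt_gen free_word \<Rightarrow>\<^sub>0 'f"

definition leavitt_gens :: "('v, 'e) pre_digraph \<Rightarrow> ('v, 'e) leavitt_gen set" where
  "leavitt_gens G = Vert ` verts G \<union> Edge ` arcs G \<union> Ghost ` arcs G"

definition leavitt_relations :: "('v, 'e) pre_digraph \<Rightarrow> ('v, 'e, 'f::field) leavitt_poly set" where
  "leavitt_relations G =
     {monomial [Vert v, Vert w] - (if v = w then monomial [Vert v] else 0)
        | v w. v \<in> verts G \<and> w \<in> verts G} \<union>
     {monomial [Vert (tail G e), Edge e] - monomial [Edge e] | e. e \<in> arcs G} \<union>
     {monomial [Edge e, Vert (head G e)] - monomial [Edge e] | e. e \<in> arcs G} \<union>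
     {monomial [Vert (head G e), Ghost e] - monomial [Ghost e] | e. e \<in> arcs G} \<union>
     {monomial [Ghost e, Vert (tail G e)] - monomial [Ghost e] | e. e \<in> arcs G} \<union>
     {monomial [Ghost e, Edge f] - (if e = f then monomial [Vert (head G e)] else 0)
        | e f. e \<in> arcs G \<and> f \<in> arcs G} \<union>
     {monomial [Vert v] - (\<Sum>e \<in> out_arcs G v. monomial [Edge e, Ghost e])
        | v. v \<in> verts G \<and> out_arcs G v \<noteq> {}}"

definition leavitt_ideal :: "('v, 'e) pre_digraph \<Rightarrow> ('v, 'e, 'f::field) leavitt_poly set" where
  "leavitt_ideal G = Idl\<^bsub>free_algebra (leavitt_gens G)\<^esub> (leavitt_relations G)"

definition leavitt_class ::
    "('v, 'e) pre_digraph \<Rightarrow> ('v, 'e, 'f::field) leavitt_poly \<Rightarrow> ('v, 'e, 'f) leavitt_poly set" where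
  "leavitt_class G p = leavitt_ideal G +>\<^bsub>free_algebra (leavitt_gens G)\<^esub> p"

text \<open>
  The presentation is one of algebras without a designated unit, so \<open>L(G)\<close> consists of the classes
  of the polynomials without constant term.  The ideal that the relations generate in those
  polynomials equals the one generated in the whole free algebra, as the relations have no constant
  term and the constants act by scalar multiplication.  For a finite graph the sum of the vertices
  is the unit, and it is recorded as such; the constant polynomial 1 does not belong to \<open>L(G)\<close>.
\<close>

definition leavitt :: "('v, 'e) pre_digraph \<Rightarrow> ('f::field, ('v, 'e, 'f) leavitt_poly set) module" where
  "leavitt G = (let R = free_algebra (leavitt_gens G); J = leavitt_ideal G in
     \<lparr>carrier = leavitt_class G ` {p \<in> carrier R. Poly_Mapping.lookup p 0 = 0},
      mult = rcoset_mult R J,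
      one = leavitt_class G (\<Sum>v \<in> verts G. monomial [Vert v]),
      zero = J,
      add = set_add R,
      smult = (\<lambda>c X. \<Union>p\<in>X. leavitt_class G (c \<odot>\<^bsub>R\<^esub> p))\<rparr>)"

text \<open>
  \<open>L(W)\<close> as a subalgebra of \<open>L(G)\<close>; its unit is the sum of the vertices in \<open>W\<close>.
\<close>

definition leavitt_sub ::
    "('v, 'e) pre_digraph \<Rightarrow> 'v set \<Rightarrow> ('f::field, ('v, 'e, 'f) leavitt_poly set) module" where
  "leavitt_sub G W = (leavitt G)
     \<lparr>carrier := generated_subalgebra (leavitt G)
        ((\<lambda>w. leavitt_class G (monomial [Vert w])) ` W \<union>
         (\<lambda>e. leavitt_class G (monomial [Edge e])) ` arcs_between G W W \<union>
         (\<lambda>e. leavitt_class G (monomial [Ghost e])) ` arcs_between G W W),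
      one := leavitt_class G (\<Sum>w\<in>W. monomial [Vert w])\<rparr>"

definition leavitt_diag ::
    "('v, 'e) pre_digraph \<Rightarrow> 'v set \<Rightarrow> ('v, 'e, 'f::field) leavitt_poly set set" where
  "leavitt_diag G W =
     {\<Oplus>\<^bsub>leavitt G\<^esub>w\<in>W. leavitt_class G (monomial [Vert w]) \<otimes>\<^bsub>leavitt G\<^esub> a w
                          \<otimes>\<^bsub>leavitt G\<^esub> leavitt_class G (monomial [Vert w])
        | a. a \<in> W \<rightarrow> carrier (leavitt_sub G W)}"

fun path_elem :: "('v, 'e) pre_digraph \<Rightarrow> 'v \<times> 'e list \<Rightarrow> ('v, 'e, 'f::field) leavitt_poly set" where
  "path_elem G (u, p) = leavitt_class G (monomial (if p = [] then [Vert u] else map Edge p))"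

fun path_star :: "('v, 'e) pre_digraph \<Rightarrow> 'v \<times> 'e list \<Rightarrow> ('v, 'e, 'f::field) leavitt_poly set" where
  "path_star G (u, p) = leavitt_class G (monomial (if p = [] then [Vert u] else map Ghost (rev p)))"

definition diagonal_embedding ::
    "('v, 'e) pre_digraph \<Rightarrow> 'v set \<Rightarrow>
     ('v, 'e, 'f::field) leavitt_poly set \<Rightarrow> ('v, 'e, 'f) leavitt_poly set" where
  "diagonal_embedding G W = (\<lambda>a \<in> leavitt_diag G W.
     \<Oplus>\<^bsub>leavitt G\<^esub>q \<in> arrival_paths G W.
       path_elem G q \<otimes>\<^bsub>leavitt G\<^esub> a \<otimes>\<^bsub>leavitt G\<^esub> path_star G q)"

end

theory Submission
  imports Defs
begin

text \<open>
  Multiplying an element of \<open>L(G)\<close> on the right by a sufficiently long path removes all ghost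
  arcs from it: what remains is a linear combination of real paths, and real paths are linearly
  independent.  The whole proof rests on this.  Independence comes from an action of \<open>L(G)\<close> on
  functions of boundary paths, graded by an integer.  The action is faithful (\<open>ev_inj\<close>), and so all
  computations are made with operators, in a ring whose equality is actual equality; the map
  \<open>Phi\<close> carries the quotient of the free algebra there.

  Let \<open>z\<close> be central.  If \<open>z v = c v\<close> for a scalar \<open>c\<close>, then the same holds at all descendants of
  \<open>v\<close> (\<open>scalar_propagates\<close>).  If every descendant of \<open>u\<close> reaches a vertex at which \<open>z\<close> vanishes,
  then \<open>z\<close> vanishes at \<open>u\<close> (\<open>central_vanishes_at\<close>): otherwise \<open>z q\<close> is a nonzero combination of
  real paths for some long path \<open>q\<close> from \<open>u\<close>, and stays nonzero after multiplication by a path \<open>s\<close>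
  to a vertex \<open>w\<close> with \<open>z w = 0\<close>, whereas \<open>z q s = q s (z w)\<close>.  For a cycle \<open>C\<close> at \<open>v\<close>, the
  combination \<open>z C\<^sup>N\<close> commutes with the powers of \<open>C\<close>, which makes it a polynomial in \<open>C\<close>
  (\<open>central_on_cycle\<close>); if moreover \<open>C\<close> has an exit at \<open>v\<close>, then following the exit shows that only
  the term \<open>C\<^sup>N\<close> occurs, so that \<open>z v\<close> is a scalar multiple of \<open>v\<close> (\<open>scalar_at_exit\<close>).

  Every vertex reaches a minimal hereditary subset.  A cycle that leads to \<open>W j\<close> and to \<open>W l\<close> has an
  exit; the scalar there is inherited by both, so that \<open>z\<close> is the same scalar on all minimal
  hereditary subsets of a class with more than one member.  A class with one member carries a scalar,
  too, unless that member is a cycle without exits to which no other cycle leads, that is, a finitary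
  one.  There \<open>z C\<^sup>N\<close> can be any polynomial in \<open>C\<close>: the Laurent polynomials appear, and \<open>t\<close> is the
  element that turns once around the cycle, spread by the diagonal embedding (\<open>laurent_value_bij\<close>).

  The sets \<open>U i\<close> are finitary because infinitely many arrival paths would produce a cycle that leads
  to two different classes.  For finitary hereditary \<open>H\<close> with unit \<open>1\<^sub>H\<close>, the diagonal embedding maps
  \<open>Z(L(H))\<close> to \<open>Z(L(G))\<close> and \<open>1\<^sub>H \<phi>\<^sub>H(a) = a\<close>; hence \<open>Z(L(H)) = 1\<^sub>H Z(L(G))\<close>, and only central
  elements of \<open>L(G)\<close> have to be understood.  No path leads from one \<open>U i\<close> to another, and every vertex
  reaches one of them.  So \<open>z\<close> minus the sum of the elements obtained by embedding its restrictions to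
  the \<open>U i\<close> is central and vanishes on all of them, and is therefore 0 (\<open>center_direct_sum\<close>).
\<close>

section \<open>Linear operators on spaces of functions\<close>

text \<open>
  The space acted on consists of all functions, without any finiteness condition, so that every
  partial map of the points acts by pulling functions back.
\<close>

typedef (overloaded) ('x, 'f::field) linop =
  "{T :: ('x \<Rightarrow> 'f) \<Rightarrow> 'x \<Rightarrow> 'f. (\<forall>\<xi> \<eta>. T (\<lambda>x. \<xi> x + \<eta> x) = (\<lambda>x. T \<xi> x + T \<eta> x)) \<and>
     (\<forall>c \<xi>. T (\<lambda>x. c * \<xi> x) = (\<lambda>x. c * T \<xi> x))}"
  by (rule exI[of _ "\<lambda>\<xi>. \<xi>"]) simp

setup_lifting type_definition_linop

instantiation linop :: (type, field) ring_1
begin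

lift_definition zero_linop :: "('a, 'b) linop" is "\<lambda>\<xi> x. 0" by simp
lift_definition one_linop :: "('a, 'b) linop" is "\<lambda>\<xi>. \<xi>" by simp
lift_definition plus_linop :: "('a, 'b) linop \<Rightarrow> ('a, 'b) linop \<Rightarrow> ('a, 'b) linop"
  is "\<lambda>S T \<xi> x. S \<xi> x + T \<xi> x" by (auto simp: algebra_simps)
lift_definition uminus_linop :: "('a, 'b) linop \<Rightarrow> ('a, 'b) linop"
  is "\<lambda>T \<xi> x. - T \<xi> x" by (auto simp: algebra_simps)
lift_definition minus_linop :: "('a, 'b) linop \<Rightarrow> ('a, 'b) linop \<Rightarrow> ('a, 'b) linop"
  is "\<lambda>S T \<xi> x. S \<xi> x - T \<xi> x" by (auto simp: algebra_simps)
lift_definition times_linop :: "('a, 'b) linop \<Rightarrow> ('a, 'b) linop \<Rightarrow> ('a, 'b) linop"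
  is "\<lambda>S T \<xi>. S (T \<xi>)" by simp

instance
proof
  show "(0 :: ('a, 'b) linop) \<noteq> 1"
  proof
    assume "(0 :: ('a, 'b) linop) = 1"
    then have "Rep_linop (0 :: ('a, 'b) linop) (\<lambda>_. 1) undefined = Rep_linop (1 :: ('a, 'b) linop) (\<lambda>_. 1) undefined"
      by simp
    then show False by (simp add: zero_linop.rep_eq one_linop.rep_eq)
  qed
qed (transfer; auto simp: algebra_simps)+

end

lift_definition scal :: "'f::field \<Rightarrow> ('x, 'f) linop" is "\<lambda>c \<xi> x. c * \<xi> x"
  by (auto simp: algebra_simps)

lemma scal_add: "scal (a + b) = scal a + scal b" by transfer (auto simp: algebra_simps)
lemma scal_diff: "scal (a - b) = scal a - scal b" by transfer (auto simp: algebra_simps)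
lemma scal_mult: "scal (a * b) = scal a * scal b" by transfer (auto simp: algebra_simps)
lemma scal_0 [simp]: "scal 0 = 0" by transfer (auto simp: algebra_simps)
lemma scal_1 [simp]: "scal 1 = 1" by transfer (auto simp: algebra_simps)
lemma scal_comm: "T * scal c = scal c * T" by transfer auto
lemma scal_commL: "T * (scal c * S) = scal c * (T * S)"
  by (metis mult.assoc scal_comm)

lift_definition entry :: "('x, 'f::field) linop \<Rightarrow> ('x \<Rightarrow> 'f) \<Rightarrow> 'x \<Rightarrow> 'f" is "\<lambda>T \<xi> x. T \<xi> x" .

lemma entry_simps:
  "entry 0 \<xi> x = 0" "entry 1 \<xi> x = \<xi> x" "entry (S + T) \<xi> x = entry S \<xi> x + entry T \<xi> x"
  "entry (S - T) \<xi> x = entry S \<xi> x - entry T \<xi> x"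
  "entry (S * T) \<xi> x = entry S (entry T \<xi>) x" "entry (scal c) \<xi> x = c * \<xi> x"
  by (transfer, simp)+

lemma entry_sum: "entry (sum f A) \<xi> x = (\<Sum>a\<in>A. entry (f a) \<xi> x)"
  by (induction A rule: infinite_finite_induct) (simp_all add: entry_simps)

lemma entry_eqI: "(\<And>\<xi> x. entry S \<xi> x = entry T \<xi> x) \<Longrightarrow> S = T"
  by transfer auto

lift_definition pullback :: "('x \<Rightarrow> 'x option) \<Rightarrow> ('x, 'f::field) linop"
  is "\<lambda>g \<xi> x. case g x of None \<Rightarrow> 0 | Some y \<Rightarrow> \<xi> y"
  by (auto simp: fun_eq_iff split: option.split)

lemma entry_pullback: "entry (pullback g) \<xi> x = (case g x of None \<Rightarrow> 0 | Some y \<Rightarrow> \<xi> y)"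
  by transfer simp

section \<open>The action on boundary paths\<close>

text \<open>
  A boundary path is an infinite path or a path that ends in a sink.  It is encoded as an infinite
  sequence of vertices, each with the arc that is taken from it; at a sink no arc is taken and the
  vertex is repeated for ever.  The integer is a degree, which drops by one when an arc is removed
  from the front.  Without it, a cycle without exits would act as the identity on its own infinite
  power, and the powers of the cycle would not be independent.
\<close>

type_synonym ('v, 'e) boundary_point = "(nat \<Rightarrow> 'v \<times> 'e option) \<times> int"

type_synonym ('v, 'e, 'f) operator = "(('v, 'e) boundary_point, 'f) linop"

text \<open>
  The field is a parameter in order that all operators below have their coefficients in the same
  field.
\<close>

locale leavitt_digraph = fin_digraph G for G :: "('a, 'b) pre_digraph" +
  fixes base_field :: "'f::field itself"
begin

fun next_vertex :: "'a \<times> 'b option \<Rightarrow> 'a" where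
  "next_vertex (v, None) = v"
| "next_vertex (v, Some e) = head G e"

fun valid_step :: "'a \<times> 'b option \<Rightarrow> bool" where
  "valid_step (v, None) \<longleftrightarrow> v \<in> verts G \<and> out_arcs G v = {}"
| "valid_step (v, Some e) \<longleftrightarrow> e \<in> out_arcs G v"

definition boundary :: "(nat \<Rightarrow> 'a \<times> 'b option) \<Rightarrow> bool" where
  "boundary g \<longleftrightarrow> (\<forall>i. valid_step (g i) \<and> fst (g (Suc i)) = next_vertex (g i))"

definition boundary_cons :: "'b \<Rightarrow> (nat \<Rightarrow> 'a \<times> 'b option) \<Rightarrow> nat \<Rightarrow> 'a \<times> 'b option" where
  "boundary_cons e g = case_nat (tail G e, Some e) g"

lemma boundary_cons_simps [simp]: "boundary_cons e g 0 = (tail G e, Some e)" "boundary_cons e g (Suc i) = g i"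
  "boundary_cons e g \<circ> Suc = g"
  by (auto simp: boundary_cons_def)

lemma boundary_boundary_cons:
  "boundary (boundary_cons e g) \<longleftrightarrow> e \<in> arcs G \<and> boundary g \<and> fst (g 0) = head G e"
  unfolding boundary_def
proof (intro iffI allI)
  assume *: "\<forall>i. valid_step (boundary_cons e g i) \<and> fst (boundary_cons e g (Suc i)) = next_vertex (boundary_cons e g i)"
  show "e \<in> arcs G \<and> (\<forall>i. valid_step (g i) \<and> fst (g (Suc i)) = next_vertex (g i)) \<and> fst (g 0) = head G e"
    using *[rule_format, of 0] *[rule_format, of "Suc i" for i] by auto
next
  fix i
  assume "e \<in> arcs G \<and> (\<forall>i. valid_step (g i) \<and> fst (g (Suc i)) = next_vertex (g i)) \<and> fst (g 0) = head G e"
  then show "valid_step (boundary_cons e g i) \<and> fst (boundary_cons e g (Suc i)) = next_vertex (boundary_cons e g i)"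
    by (cases i) auto
qed

lemma boundary_Suc: "boundary g \<Longrightarrow> boundary (g \<circ> Suc)"
  by (simp add: boundary_def)

lemma boundary_start: "boundary g \<Longrightarrow> fst (g 0) \<in> verts G"
  unfolding boundary_def by (cases "g 0"; cases "snd (g 0)") (auto dest!: spec[of _ 0])

lemma boundary_arc:
  assumes "boundary g" "snd (g 0) = Some e"
  shows "e \<in> arcs G" "tail G e = fst (g 0)" "fst (g (Suc 0)) = head G e"
proof -
  from assms have *: "valid_step (g 0)" "fst (g (Suc 0)) = next_vertex (g 0)"
    unfolding boundary_def by blast+
  moreover obtain v where "g 0 = (v, Some e)" using assms(2) by (cases "g 0") auto
  ultimately show "e \<in> arcs G" "tail G e = fst (g 0)" "fst (g (Suc 0)) = head G e"
    by simp_all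
qed

lemma boundary_cons_uncons:
  assumes "boundary g" "snd (g 0) = Some e"
  shows "boundary_cons e (g \<circ> Suc) = g"
proof
  have "g 0 = (tail G e, Some e)" using boundary_arc(2)[OF assms] assms(2) by (cases "g 0") auto
  then show "boundary_cons e (g \<circ> Suc) i = g i" for i by (cases i) auto
qed

lemma boundary_exists: assumes "v \<in> verts G" shows "\<exists>g. boundary g \<and> fst (g 0) = v"
proof -
  define out where "out w = (if out_arcs G w = {} then None else Some (SOME e. e \<in> out_arcs G w))" for w
  have out: "valid_step (w, out w)" if "w \<in> verts G" for w
    using that some_in_eq[of "out_arcs G w"] by (auto simp: out_def simp del: in_out_arcs_conv)
  \<comment> \<open>follow the chosen arcs from \<open>v\<close>, and stay at a sink once it is reached\<close>
  define h where "h = rec_nat v (\<lambda>_ w. next_vertex (w, out w))"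
  have h: "h i \<in> verts G" for i
  proof (induction i)
    case (Suc i)
    have "next_vertex (h i, out (h i)) \<in> verts G"
      using out[OF Suc] Suc by (cases "out (h i)") auto
    then show ?case by (simp add: h_def)
  qed (use assms in \<open>simp add: h_def\<close>)
  have "boundary (\<lambda>i. (h i, out (h i)))"
    using out[OF h] unfolding boundary_def by (auto simp: h_def)
  then show ?thesis by (intro exI[of _ "\<lambda>i. (h i, out (h i))"]) (simp add: h_def)
qed

definition vertex_op :: "'a \<Rightarrow> ('a, 'b, 'f) operator" where
  "vertex_op v = pullback (\<lambda>(g, n). if boundary g \<and> fst (g 0) = v then Some (g, n) else None)"

text \<open>
  Functions are pulled back, so that products of operators are read in the order of the arcs: the
  value of \<open>e f \<xi>\<close> at a boundary path is that of \<open>\<xi>\<close> after its first arc \<open>e\<close> and then \<open>f\<close> have been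
  removed.
\<close>

definition edge_op :: "'b \<Rightarrow> ('a, 'b, 'f) operator" where
  "edge_op e = pullback (\<lambda>(g, n). if boundary g \<and> snd (g 0) = Some e then Some (g \<circ> Suc, n - 1) else None)"

definition ghost_op :: "'b \<Rightarrow> ('a, 'b, 'f) operator" where
  "ghost_op e = pullback (\<lambda>(g, n). if boundary g \<and> e \<in> arcs G \<and> fst (g 0) = head G e then Some (boundary_cons e g, n + 1) else None)"

lemma entry_ops:
  "entry (vertex_op v) \<xi> (g, n) = (if boundary g \<and> fst (g 0) = v then \<xi> (g, n) else 0)"
  "entry (edge_op e) \<xi> (g, n) = (if boundary g \<and> snd (g 0) = Some e then \<xi> (g \<circ> Suc, n - 1) else 0)"
  "entry (ghost_op e) \<xi> (g, n) = (if boundary g \<and> e \<in> arcs G \<and> fst (g 0) = head G e then \<xi> (boundary_cons e g, n + 1) else 0)"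
  by (auto simp: vertex_op_def edge_op_def ghost_op_def entry_pullback)

lemma linop_eq_on_pointsI:
  fixes S T :: "('a, 'b, 'f) operator"
  assumes "\<And>\<xi> g n. entry S \<xi> (g, n) = entry T \<xi> (g, n)"
  shows "S = T"
  using assms by (intro entry_eqI) auto

lemma vertex_vertex: "vertex_op v * vertex_op w = (if v = w then vertex_op v else 0)"
  by (rule linop_eq_on_pointsI) (auto simp: entry_simps entry_ops)

lemma vertex_op_outside: "v \<notin> verts G \<Longrightarrow> vertex_op v = 0"
  by (rule linop_eq_on_pointsI) (auto simp: entry_simps entry_ops dest: boundary_start)

lemma vertex_edge: "vertex_op v * edge_op e = (if v = tail G e then edge_op e else 0)"
  by (rule linop_eq_on_pointsI) (auto simp: entry_simps entry_ops boundary_arc)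

lemma edge_vertex: "edge_op e * vertex_op v = (if v = head G e then edge_op e else 0)"
  by (rule linop_eq_on_pointsI) (auto simp: entry_simps entry_ops boundary_Suc boundary_arc)

lemma vertex_ghost: "vertex_op v * ghost_op e = (if v = head G e then ghost_op e else 0)"
  by (rule linop_eq_on_pointsI) (auto simp: entry_simps entry_ops)

lemma ghost_vertex: "ghost_op e * vertex_op v = (if v = tail G e then ghost_op e else 0)"
  by (rule linop_eq_on_pointsI) (auto simp: entry_simps entry_ops boundary_boundary_cons)

lemma ghost_edge: "e \<in> arcs G \<Longrightarrow> ghost_op e * edge_op f = (if e = f then vertex_op (head G e) else 0)"
  by (rule linop_eq_on_pointsI) (auto simp: entry_simps entry_ops boundary_boundary_cons)

lemma entry_edge_ghost: "entry (edge_op e * ghost_op e) \<xi> (g, n) = (if boundary g \<and> snd (g 0) = Some e then \<xi> (g, n) else 0)"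
  by (auto simp: entry_simps entry_ops boundary_boundary_cons boundary_Suc boundary_cons_uncons boundary_arc)

text \<open>
  A boundary path whose source is not a sink begins with exactly one arc.
\<close>

lemma CK2:
  assumes "out_arcs G v \<noteq> {}"
  shows "vertex_op v = (\<Sum>e\<in>out_arcs G v. edge_op e * ghost_op e)"
proof (rule linop_eq_on_pointsI)
  fix \<xi> :: "('a, 'b) boundary_point \<Rightarrow> 'f" and g n
  show "entry (vertex_op v) \<xi> (g, n) = entry (\<Sum>e\<in>out_arcs G v. edge_op e * ghost_op e) \<xi> (g, n)"
  proof (cases "boundary g \<and> fst (g 0) = v")
    case True
    then have "valid_step (g 0)" unfolding boundary_def by blast
    then have "snd (g 0) \<noteq> None"
      using assms True by (cases "g 0") (auto simp del: in_out_arcs_conv)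
    then obtain e where e: "snd (g 0) = Some e" by auto
    with True have "e \<in> out_arcs G v" by (auto simp: boundary_arc)
    with True e show ?thesis
      by (simp add: entry_sum entry_edge_ghost entry_ops finite_out_arcs)
  next
    case False
    then have "entry (edge_op e * ghost_op e) \<xi> (g, n) = 0" if "e \<in> out_arcs G v" for e
      using that by (auto simp: entry_edge_ghost boundary_arc)
    with False show ?thesis by (auto simp: entry_sum entry_ops)
  qed
qed

section \<open>Paths and their coefficients\<close>

text \<open>
  The factor for the source covers paths of length 0, and it makes the operator vanish if the
  arcs do not form a walk from that source.
\<close>

definition path_op :: "'a \<Rightarrow> 'b list \<Rightarrow> ('a, 'b, 'f) operator" where
  "path_op u p = vertex_op u * prod_list (map edge_op p)"

definition gpath_op :: "'a \<Rightarrow> 'b list \<Rightarrow> ('a, 'b, 'f) operator" where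
  "gpath_op u p = prod_list (map ghost_op (rev p)) * vertex_op u"

lemma edge_ends [simp]: "vertex_op (tail G e) * edge_op e = edge_op e" "edge_op e * vertex_op (head G e) = edge_op e"
  "vertex_op (head G e) * ghost_op e = ghost_op e" "ghost_op e * vertex_op (tail G e) = ghost_op e"
  by (simp_all add: vertex_edge edge_vertex vertex_ghost ghost_vertex)

lemma path_op_Nil [simp]: "path_op u [] = vertex_op u" and gpath_op_Nil [simp]: "gpath_op u [] = vertex_op u"
  by (simp_all add: path_op_def gpath_op_def)

lemma path_op_Cons: "path_op (tail G e) (e # p) = edge_op e * path_op (head G e) p"
  by (simp add: path_op_def flip: mult.assoc)

lemma gpath_op_Cons: "gpath_op (tail G e) (e # p) = gpath_op (head G e) p * ghost_op e"
  by (simp add: gpath_op_def mult.assoc)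

lemma vertex_path: "vertex_op w * path_op u p = (if w = u then path_op u p else 0)"
  by (auto simp: path_op_def vertex_vertex simp flip: mult.assoc)

lemma ghost_path_vertex: "gpath_op u p * vertex_op w = (if w = u then gpath_op u p else 0)"
  by (auto simp: gpath_op_def vertex_vertex mult.assoc)

lemma path_vertex: "awalk u p v \<Longrightarrow> path_op u p * vertex_op w = (if w = v then path_op u p else 0)"
proof (induction p arbitrary: u)
  case Nil then show ?case by (auto simp: awalk_Nil_iff vertex_vertex)
next
  case (Cons e p)
  then show ?case by (auto simp: awalk_Cons_iff path_op_Cons mult.assoc)
qed

lemma vertex_ghost_path: "awalk u p v \<Longrightarrow> vertex_op w * gpath_op u p = (if w = v then gpath_op u p else 0)"
proof (induction p arbitrary: u)
  case Nil then show ?case by (auto simp: awalk_Nil_iff vertex_vertex)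
next
  case (Cons e p)
  then show ?case by (auto simp: awalk_Cons_iff gpath_op_Cons simp flip: mult.assoc)
qed

lemma path_op_append: "awalk u p v \<Longrightarrow> path_op u (p @ q) = path_op u p * path_op v q"
proof (induction p arbitrary: u)
  case Nil then show ?case by (auto simp: awalk_Nil_iff vertex_path)
next
  case (Cons e p)
  then show ?case by (auto simp: awalk_Cons_iff path_op_Cons mult.assoc)
qed

lemma path_op_snoc: "e \<in> arcs G \<Longrightarrow> awalk u p (tail G e) \<Longrightarrow> path_op u (p @ [e]) = path_op u p * edge_op e"
  by (simp add: path_op_append path_op_Cons)

lemma ghost_path_path: "awalk u p v \<Longrightarrow> gpath_op u p * path_op u p = vertex_op v"
proof (induction p arbitrary: u)
  case Nil then show ?case by (auto simp: awalk_Nil_iff vertex_vertex)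
next
  case (Cons e p)
  then have u: "u = tail G e" "e \<in> arcs G" "awalk (head G e) p v"
    by (auto simp: awalk_Cons_iff)
  show ?case
    unfolding u(1) path_op_Cons gpath_op_Cons
    by (metis Cons.IH[OF u(3)] ghost_edge[OF u(2)] vertex_path mult.assoc)
qed

definition boundary_append :: "'b list \<Rightarrow> (nat \<Rightarrow> 'a \<times> 'b option) \<Rightarrow> nat \<Rightarrow> 'a \<times> 'b option" where
  "boundary_append p g = foldr boundary_cons p g"

lemma boundary_append_simps [simp]: "boundary_append [] g = g" "boundary_append (e # p) g = boundary_cons e (boundary_append p g)"
  by (simp_all add: boundary_append_def)

lemma snd_boundary_append: "i < length p \<Longrightarrow> snd (boundary_append p g i) = Some (p ! i)"
proof (induction p arbitrary: i)
  case (Cons e p) then show ?case by (cases i) auto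
qed simp

lemma boundary_append_shift: "boundary_append p g (length p + i) = g i"
  by (induction p) auto

lemma boundary_boundary_append:
  "awalk u p v \<Longrightarrow> boundary g \<Longrightarrow> fst (g 0) = v \<Longrightarrow> boundary (boundary_append p g) \<and> fst (boundary_append p g 0) = u"
  by (induction p arbitrary: u) (auto simp: awalk_Cons_iff awalk_Nil_iff boundary_boundary_cons)

lemma entry_path_op:
  assumes "awalk u p v"
  shows "entry (path_op u p) \<xi> (h, n) =
    (if boundary h \<and> fst (h 0) = u \<and> (\<forall>i<length p. snd (h i) = Some (p ! i))
     then \<xi> (\<lambda>i. h (length p + i), n - int (length p)) else 0)"
  using assms
proof (induction p arbitrary: u h n)
  case Nil then show ?case by (simp add: entry_ops)
next
  case (Cons e p)
  then have u: "u = tail G e" "e \<in> arcs G" "awalk (head G e) p v" by (auto simp: awalk_Cons_iff)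
  have "(\<forall>i<length (e # p). snd (h i) = Some ((e # p) ! i)) \<longleftrightarrow>
      snd (h 0) = Some e \<and> (\<forall>i<length p. snd (h (Suc i)) = Some (p ! i))"
    by (auto simp: less_Suc_eq_0_disj)
  then show ?case
    using boundary_arc[of h e] boundary_Suc[of h]
    by (auto simp: u path_op_Cons entry_simps entry_ops Cons.IH[OF u(3)] o_def algebra_simps)
qed

text \<open>
  The coefficient of a path \<open>p\<close> in a combination of paths.  For a boundary path \<open>g\<close> from the range of
  \<open>p\<close>, the operator is applied to the function that is 1 at \<open>g\<close> in degree 0 and 0 elsewhere, and the
  result is evaluated at \<open>p g\<close> in degree \<open>|p|\<close>.
\<close>

definition coef :: "'a \<Rightarrow> 'b list \<Rightarrow> ('a, 'b, 'f) operator \<Rightarrow> 'f" where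
  "coef u p T = (let g = SOME g. boundary g \<and> fst (g 0) = awlast u p in
     entry T (\<lambda>x. if x = (g, 0) then 1 else 0) (boundary_append p g, int (length p)))"

lemma coef_simps [simp]: "coef u p 0 = 0" "coef u p (S + T) = coef u p S + coef u p T"
  "coef u p (S - T) = coef u p S - coef u p T" "coef u p (scal c * T) = c * coef u p T"
  by (simp_all add: coef_def Let_def entry_simps)

lemma coef_sum: "coef u p (sum f A) = (\<Sum>a\<in>A. coef u p (f a))"
  by (induction A rule: infinite_finite_induct) simp_all

text \<open>
  The degree forces a path with nonzero value to have the length of \<open>p\<close>; being an initial segment of
  \<open>p g\<close>, it is then \<open>p\<close>.
\<close>

lemma coef_path_op:
  assumes "awalk u p v" "awalk u' q v'"
  shows "coef u p (path_op u' q) = (if u' = u \<and> q = p then 1 else 0)"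
proof -
  have v: "awlast u p = v" "v \<in> verts G" using assms(1) by auto
  define g where "g = (SOME g. boundary g \<and> fst (g 0) = awlast u p)"
  have g: "boundary g" "fst (g 0) = v"
    using someI_ex[OF boundary_exists[OF v(2)]] by (auto simp: g_def v)
  have "entry (path_op u' q) (\<lambda>x. if x = (g, 0) then 1 else 0) (boundary_append p g, int (length p)) =
     (if u' = u \<and> q = p then 1 else 0)"
    using boundary_boundary_append[OF assms(1) g] boundary_append_shift[of p g] snd_boundary_append[of _ p g]
    by (auto simp: entry_path_op[OF assms(2)] intro!: nth_equalityI)
  then show ?thesis by (simp add: coef_def g_def Let_def)
qed

end

section \<open>Free algebras and linear extensions\<close>

lemma poly_mapping_decompose: "p = (\<Sum>k\<in>Poly_Mapping.keys p. Poly_Mapping.single k (Poly_Mapping.lookup p k))"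
  by (rule poly_mapping_eqI) (simp add: lookup_sum lookup_single when_def in_keys_iff)

lemma free_algebra_simps [simp]:
  "mult (free_algebra X) = (*)" "one (free_algebra X) = 1" "zero (free_algebra X) = 0"
  "add (free_algebra X) = (+)" "smult (free_algebra X) c p = Poly_Mapping.single 0 c * p"
  by (simp_all add: free_algebra_def mult_map_scale_conv_mult)

lemma in_free_algebra: "p \<in> carrier (free_algebra X) \<longleftrightarrow> (\<forall>w \<in> Poly_Mapping.keys p. set (letters w) \<subseteq> X)"
  by (simp add: free_algebra_def)

lemma letters_plus: "letters (v + w) = letters v @ letters w"
  and letters_zero: "letters 0 = []"
  by (simp_all add: plus_free_word_def zero_free_word_def)

lemma free_algebra_closed:
  "0 \<in> carrier (free_algebra X)" "1 \<in> carrier (free_algebra X)"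
  "p \<in> carrier (free_algebra X) \<Longrightarrow> q \<in> carrier (free_algebra X) \<Longrightarrow> p + q \<in> carrier (free_algebra X)"
  "p \<in> carrier (free_algebra X) \<Longrightarrow> q \<in> carrier (free_algebra X) \<Longrightarrow> p - q \<in> carrier (free_algebra X)"
  "p \<in> carrier (free_algebra X) \<Longrightarrow> - p \<in> carrier (free_algebra X)"
  "p \<in> carrier (free_algebra X) \<Longrightarrow> q \<in> carrier (free_algebra X) \<Longrightarrow> p * q \<in> carrier (free_algebra X)"
  "set xs \<subseteq> X \<Longrightarrow> Poly_Mapping.single (Word xs) c \<in> carrier (free_algebra X)"
  "Poly_Mapping.single 0 c \<in> carrier (free_algebra X)"
  "set xs \<subseteq> X \<Longrightarrow> monomial xs \<in> carrier (free_algebra X)"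
proof -
  show "p * q \<in> carrier (free_algebra X)" if "p \<in> carrier (free_algebra X)" "q \<in> carrier (free_algebra X)"
    unfolding in_free_algebra
  proof
    fix w assume "w \<in> Poly_Mapping.keys (p * q)"
    then obtain a b where "w = a + b" "a \<in> Poly_Mapping.keys p" "b \<in> Poly_Mapping.keys q"
      using keys_mult[of p q] by blast
    then show "set (letters w) \<subseteq> X" using that by (simp add: in_free_algebra letters_plus)
  qed
  show "p + q \<in> carrier (free_algebra X)" if "p \<in> carrier (free_algebra X)" "q \<in> carrier (free_algebra X)"
    using that Poly_Mapping.keys_add[of p q] unfolding in_free_algebra by blast
  show "- p \<in> carrier (free_algebra X)" if "p \<in> carrier (free_algebra X)"
    using that unfolding in_free_algebra by (simp add: in_keys_iff)
  show "p - q \<in> carrier (free_algebra X)" if "p \<in> carrier (free_algebra X)" "q \<in> carrier (free_algebra X)"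
    using that unfolding in_free_algebra
    by (metis (no_types, lifting) diff_zero in_keys_iff lookup_minus)
qed (auto simp: in_free_algebra monomial_def letters_zero)

lemma free_algebra_sum_closed:
  "(\<And>a. a \<in> A \<Longrightarrow> f a \<in> carrier (free_algebra X)) \<Longrightarrow> sum f A \<in> carrier (free_algebra X)"
  by (induction A rule: infinite_finite_induct) (simp_all add: free_algebra_closed)

lemma ring_free_algebra: "ring (free_algebra X)"
proof (rule ringI)
  show "abelian_group (free_algebra X)"
  proof (rule abelian_groupI)
    fix x assume "x \<in> carrier (free_algebra X)"
    then show "\<exists>y\<in>carrier (free_algebra X). y \<oplus>\<^bsub>free_algebra X\<^esub> x = \<zero>\<^bsub>free_algebra X\<^esub>"
      by (intro bexI[of _ "- x"]) (simp_all add: free_algebra_closed)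
  qed (simp_all add: free_algebra_closed algebra_simps)
  show "monoid (free_algebra X)"
    by (rule monoidI) (simp_all add: free_algebra_closed mult.assoc)
qed (simp_all add: algebra_simps)

lemma monomial_append: "monomial (xs @ ys) = monomial xs * monomial ys"
  by (simp add: monomial_def mult_single plus_free_word_def)

lemma monomial_Nil: "monomial [] = 1"
  by (simp add: monomial_def flip: zero_free_word_def)

lemma monomial_Cons: "monomial (x # xs) = monomial [x] * monomial xs"
  using monomial_append[of "[x]" xs] by simp

lemma single_conv_monomial: "Poly_Mapping.single (Word xs) c = Poly_Mapping.single 0 c * monomial xs"
  by (simp add: monomial_def mult_single)

lemma const_comm: "p * Poly_Mapping.single 0 c = Poly_Mapping.single 0 (c::'f::field) * (p :: 'a free_word \<Rightarrow>\<^sub>0 'f)"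
proof -
  have "p * Poly_Mapping.single 0 c = (\<Sum>k\<in>Poly_Mapping.keys p. Poly_Mapping.single k (Poly_Mapping.lookup p k) * Poly_Mapping.single 0 c)"
    by (subst (1) poly_mapping_decompose[of p]) (simp add: sum_distrib_right)
  also have "\<dots> = (\<Sum>k\<in>Poly_Mapping.keys p. Poly_Mapping.single 0 c * Poly_Mapping.single k (Poly_Mapping.lookup p k))"
    by (simp add: mult_single mult.commute)
  also have "\<dots> = Poly_Mapping.single 0 c * p"
    by (subst (3) poly_mapping_decompose[of p]) (simp add: sum_distrib_left)
  finally show ?thesis .
qed

lemma const_commL: "p * (Poly_Mapping.single 0 c * q) = Poly_Mapping.single 0 (c::'f::field) * (p * (q :: 'a free_word \<Rightarrow>\<^sub>0 'f))"
  by (metis const_comm mult.assoc)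

lemma free_algebra_induct [consumes 1, case_names zero word add]:
  assumes "p \<in> carrier (free_algebra X)"
    and "Q 0"
    and "\<And>xs c. Word xs \<in> Poly_Mapping.keys p \<Longrightarrow> set xs \<subseteq> X \<Longrightarrow> Q (Poly_Mapping.single 0 c * monomial xs)"
    and "\<And>a b. Q a \<Longrightarrow> Q b \<Longrightarrow> Q (a + b)"
  shows "Q p"
proof -
  have "Q (\<Sum>k\<in>A. Poly_Mapping.single k (Poly_Mapping.lookup p k))" if "finite A" "A \<subseteq> Poly_Mapping.keys p"
    for A
    using that
  proof (induction A)
    case (insert k A)
    obtain xs where k: "k = Word xs" by (cases k)
    have "set xs \<subseteq> X" using assms(1)[unfolded in_free_algebra, rule_format, of k] insert.prems k by simp
    then show ?case
      using insert k assms(3)[of xs "Poly_Mapping.lookup p k"] assms(4) by (simp add: single_conv_monomial)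
  qed (simp add: assms(2))
  from this[of "Poly_Mapping.keys p"] show ?thesis by (simp flip: poly_mapping_decompose)
qed

text \<open>
  Applied to the words, which are a basis of the free algebra, and to the integers, which index the
  monomials among the Laurent polynomials.
\<close>

definition lin_ext :: "('k \<Rightarrow> ('x, 'f::field) linop) \<Rightarrow> ('k \<Rightarrow>\<^sub>0 'f) \<Rightarrow> ('x, 'f) linop" where
  "lin_ext h p = (\<Sum>w\<in>Poly_Mapping.keys p. scal (Poly_Mapping.lookup p w) * h w)"

lemma lin_ext_superset:
  assumes "finite A" "Poly_Mapping.keys p \<subseteq> A"
  shows "lin_ext h p = (\<Sum>w\<in>A. scal (Poly_Mapping.lookup p w) * h w)"
  unfolding lin_ext_def by (rule sum.mono_neutral_left) (use assms in \<open>auto simp: in_keys_iff\<close>)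

lemma lin_ext_0 [simp]: "lin_ext h 0 = 0" by (simp add: lin_ext_def)

lemma lin_ext_add: "lin_ext h (p + q) = lin_ext h p + lin_ext h q"
proof -
  let ?A = "Poly_Mapping.keys p \<union> Poly_Mapping.keys q"
  show ?thesis
    using Poly_Mapping.keys_add[of p q]
    by (simp add: lin_ext_superset[of ?A p] lin_ext_superset[of ?A q] lin_ext_superset[of ?A "p + q"]
        lookup_add scal_add distrib_right sum.distrib)
qed

lemma lin_ext_sum: "lin_ext h (sum f A) = (\<Sum>a\<in>A. lin_ext h (f a))"
  by (induction A rule: infinite_finite_induct) (simp_all add: lin_ext_add)

lemma lin_ext_single: "lin_ext h (Poly_Mapping.single w c) = scal c * h w"
  by (cases "c = 0") (simp_all add: lin_ext_def)

lemma lin_ext_mult: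
  assumes h: "\<And>v w. h (v + w) = h v * h w"
  shows "lin_ext h (p * q) = lin_ext h p * lin_ext h (q :: 'k::monoid_add \<Rightarrow>\<^sub>0 'f::field)"
proof -
  have single: "lin_ext h (Poly_Mapping.single v a * Poly_Mapping.single w b) =
      lin_ext h (Poly_Mapping.single v a) * lin_ext h (Poly_Mapping.single w b)" for v w a b
  proof -
    have "scal a * h v * (scal b * h w) = scal a * (h v * scal b) * h w" by (simp only: mult.assoc)
    also have "\<dots> = scal (a * b) * (h v * h w)" by (simp only: scal_comm[of "h v"] scal_mult mult.assoc)
    finally show ?thesis by (simp add: mult_single lin_ext_single h)
  qed
  have decompose: "lin_ext h r = (\<Sum>v\<in>Poly_Mapping.keys r. lin_ext h (Poly_Mapping.single v (Poly_Mapping.lookup r v)))"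
    for r :: "'k \<Rightarrow>\<^sub>0 'f"
    by (subst poly_mapping_decompose[of r]) (rule lin_ext_sum)
  have "lin_ext h (p * q) = (\<Sum>v\<in>Poly_Mapping.keys p. \<Sum>w\<in>Poly_Mapping.keys q.
      lin_ext h (Poly_Mapping.single v (Poly_Mapping.lookup p v) * Poly_Mapping.single w (Poly_Mapping.lookup q w)))"
    by (subst (1) poly_mapping_decompose[of p], subst (1) poly_mapping_decompose[of q])
      (simp only: sum_product lin_ext_sum)
  also have "\<dots> = lin_ext h p * lin_ext h q"
    by (simp only: single decompose[of p] decompose[of q] sum_product)
  finally show ?thesis .
qed

section \<open>Evaluation of polynomials\<close>

context leavitt_digraph
begin

abbreviation R :: "('f, ('a, 'b, 'f) leavitt_poly) module" where "R \<equiv> free_algebra (leavitt_gens G)"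
abbreviation J :: "('a, 'b, 'f) leavitt_poly set" where "J \<equiv> leavitt_ideal G"
abbreviation con :: "'f \<Rightarrow> ('a, 'b, 'f) leavitt_poly" where "con c \<equiv> Poly_Mapping.single 0 c"
abbreviation mon :: "('a, 'b) leavitt_gen list \<Rightarrow> ('a, 'b, 'f) leavitt_poly" where "mon \<equiv> monomial"

lemma relations_in_carrier: "leavitt_relations G \<subseteq> carrier R"
  unfolding leavitt_relations_def
  by (auto intro!: free_algebra_closed free_algebra_sum_closed simp: leavitt_gens_def dest: head_in_verts tail_in_verts)

lemma ideal_J: "ideal J R"
  unfolding leavitt_ideal_def by (rule ring.genideal_ideal[OF ring_free_algebra relations_in_carrier])

lemma relations_in_J: "leavitt_relations G \<subseteq> J"
  unfolding leavitt_ideal_def by (rule ring.genideal_self[OF ring_free_algebra relations_in_carrier])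

lemma J_closed:
  "x \<in> J \<Longrightarrow> x \<in> carrier R" "0 \<in> J" "x \<in> J \<Longrightarrow> y \<in> J \<Longrightarrow> x + y \<in> J"
  "x \<in> J \<Longrightarrow> y \<in> J \<Longrightarrow> x - y \<in> J" "x \<in> J \<Longrightarrow> y \<in> carrier R \<Longrightarrow> x * y \<in> J"
  "x \<in> J \<Longrightarrow> y \<in> carrier R \<Longrightarrow> y * x \<in> J"
proof -
  interpret ideal J R by (rule ideal_J)
  show c: "x \<in> J \<Longrightarrow> x \<in> carrier R" for x by (rule Icarr)
  show "0 \<in> J" using additive_subgroup.zero_closed[OF is_additive_subgroup] by simp
  show a: "x \<in> J \<Longrightarrow> y \<in> J \<Longrightarrow> x + y \<in> J" for x y
    using additive_subgroup.a_closed[OF is_additive_subgroup] by simp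
  show l: "x \<in> J \<Longrightarrow> y \<in> carrier R \<Longrightarrow> y * x \<in> J" for x y using I_l_closed by simp
  show "x \<in> J \<Longrightarrow> y \<in> carrier R \<Longrightarrow> x * y \<in> J" using I_r_closed by simp
  show "x \<in> J \<Longrightarrow> y \<in> J \<Longrightarrow> x - y \<in> J"
    using a[of x "- y"] l[of y "-1"] by (simp add: free_algebra_closed)
qed

lemma J_sum: "(\<And>a. a \<in> A \<Longrightarrow> f a \<in> J) \<Longrightarrow> sum f A \<in> J"
  by (induction A rule: infinite_finite_induct) (simp_all add: J_closed)

fun gen :: "('a, 'b) leavitt_gen \<Rightarrow> ('a, 'b, 'f) operator" where
  "gen (Vert v) = vertex_op v" | "gen (Edge e) = edge_op e" | "gen (Ghost e) = ghost_op e"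

definition ev :: "('a, 'b, 'f) leavitt_poly \<Rightarrow> ('a, 'b, 'f) operator" where
  "ev = lin_ext (\<lambda>w. prod_list (map gen (letters w)))"

lemma ev_0 [simp]: "ev 0 = 0" by (simp add: ev_def)

lemma ev_add [simp]: "ev (p + q) = ev p + ev q" by (simp add: ev_def lin_ext_add)

lemma ev_sum: "ev (sum f A) = (\<Sum>a\<in>A. ev (f a))" by (simp add: ev_def lin_ext_sum)

lemma ev_single: "ev (Poly_Mapping.single w c) = scal c * prod_list (map gen (letters w))"
  by (simp add: ev_def lin_ext_single)

lemma ev_mult [simp]: "ev (p * q) = ev p * ev q"
  unfolding ev_def by (rule lin_ext_mult) (simp add: letters_plus)

lemma ev_con [simp]: "ev (con c) = scal c" by (simp add: ev_single letters_zero)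

lemma ev_diff [simp]: "ev (p - q) = ev p - ev q"
proof -
  have "ev (p - q) + ev q = ev p" by (simp flip: ev_add)
  then show ?thesis by (simp add: algebra_simps)
qed

lemma ev_mon: "ev (mon xs) = prod_list (map gen xs)"
  by (simp add: monomial_def ev_single)

lemma ev_CK2:
  "out_arcs G v \<noteq> {} \<Longrightarrow> ev (mon [Vert v] - (\<Sum>e\<in>out_arcs G v. mon [Edge e, Ghost e])) = 0"
  using CK2[of v] by (simp add: ev_mon ev_sum)

lemma ev_relations: "r \<in> leavitt_relations G \<Longrightarrow> ev r = 0"
  unfolding leavitt_relations_def
  by (elim UnE CollectE exE conjE; hypsubst; (erule ev_CK2 | simp add: ev_mon vertex_vertex ghost_edge))

text \<open>
  The elements that evaluate to 0 form an ideal, and it contains the relations.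
\<close>

lemma ev_J: "x \<in> J \<Longrightarrow> ev x = 0"
proof -
  let ?K = "{p \<in> carrier R. ev p = 0}"
  have "ideal ?K R"
  proof (rule idealI[OF ring_free_algebra])
    show "subgroup ?K (add_monoid R)"
    proof (rule group.subgroupI)
      show *: "group (add_monoid R)"
        by (rule abelian_group.a_group[OF ring.is_abelian_group[OF ring_free_algebra]])
      fix a assume a: "a \<in> ?K"
      have "inv\<^bsub>add_monoid R\<^esub> a = - a"
        by (rule group.inv_equality[OF *]) (use a in \<open>auto simp: free_algebra_closed\<close>)
      moreover have "ev (- a) = 0 - ev a" using ev_diff[of 0 a] by simp
      ultimately show "inv\<^bsub>add_monoid R\<^esub> a \<in> ?K" using a by (simp add: free_algebra_closed)
    qed (auto simp: free_algebra_closed intro: exI[of _ 0])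
  qed (auto simp: free_algebra_closed)
  then have "J \<subseteq> ?K" unfolding leavitt_ideal_def
    by (rule ring.genideal_minimal[OF ring_free_algebra]) (use relations_in_carrier ev_relations in blast)
  then show "x \<in> J \<Longrightarrow> ev x = 0" by blast
qed

section \<open>Real paths modulo the relations\<close>

lemma gens [simp]: "v \<in> verts G \<Longrightarrow> Vert v \<in> leavitt_gens G" "e \<in> arcs G \<Longrightarrow> Edge e \<in> leavitt_gens G"
  "e \<in> arcs G \<Longrightarrow> Ghost e \<in> leavitt_gens G"
  by (auto simp: leavitt_gens_def)

lemma Edge_gens: "set p \<subseteq> arcs G \<Longrightarrow> Edge ` set p \<subseteq> leavitt_gens G"
  by (auto simp: leavitt_gens_def)

definition congruent_mod_J :: "('a, 'b, 'f) leavitt_poly \<Rightarrow> ('a, 'b, 'f) leavitt_poly \<Rightarrow> bool"  (infix "\<approx>" 50) where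
  "x \<approx> y \<longleftrightarrow> x - y \<in> J"

lemma cong_refl [simp]: "x \<approx> x" by (simp add: congruent_mod_J_def J_closed)
lemma cong_sym: "x \<approx> y \<Longrightarrow> y \<approx> x" unfolding congruent_mod_J_def using J_closed(4)[OF J_closed(2), of "x - y"]
  by simp
lemma cong_trans [trans]: "x \<approx> y \<Longrightarrow> y \<approx> z \<Longrightarrow> x \<approx> z"
  unfolding congruent_mod_J_def using J_closed(3)[of "x - y" "y - z"] by simp
lemma cong_multL: "x \<approx> y \<Longrightarrow> a \<in> carrier R \<Longrightarrow> a * x \<approx> a * y"
  unfolding congruent_mod_J_def using J_closed(6)[of "x - y" a] by (simp add: algebra_simps)
lemma cong_multR: "x \<approx> y \<Longrightarrow> a \<in> carrier R \<Longrightarrow> x * a \<approx> y * a"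
  unfolding congruent_mod_J_def using J_closed(5)[of "x - y" a] by (simp add: algebra_simps)
lemma cong_add: "x \<approx> y \<Longrightarrow> x' \<approx> y' \<Longrightarrow> x + x' \<approx> y + y'"
  unfolding congruent_mod_J_def using J_closed(3)[of "x - y" "x' - y'"] by (simp add: algebra_simps)
lemma cong_sum: "(\<And>a. a \<in> A \<Longrightarrow> f a \<approx> g a) \<Longrightarrow> sum f A \<approx> sum g A"
  by (induction A rule: infinite_finite_induct) (auto intro: cong_add)
lemma cong_in_J: "x \<approx> y \<Longrightarrow> y \<in> J \<Longrightarrow> x \<in> J"
  unfolding congruent_mod_J_def using J_closed(3)[of "x - y" y] by simp
lemma cong_0_iff: "x \<approx> 0 \<longleftrightarrow> x \<in> J" by (simp add: congruent_mod_J_def)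

abbreviation "vpoly v \<equiv> mon [Vert v]"
abbreviation "epoly e \<equiv> mon [Edge e]"
abbreviation "gpoly e \<equiv> mon [Ghost e]"

lemma gen_carrier: "v \<in> verts G \<Longrightarrow> vpoly v \<in> carrier R" "e \<in> arcs G \<Longrightarrow> epoly e \<in> carrier R"
  "e \<in> arcs G \<Longrightarrow> gpoly e \<in> carrier R" "set p \<subseteq> arcs G \<Longrightarrow> mon (map Edge p) \<in> carrier R"
  by (simp_all add: free_algebra_closed Edge_gens)

lemma relations_mod_J:
  "v \<in> verts G \<Longrightarrow> w \<in> verts G \<Longrightarrow> vpoly v * vpoly w \<approx> (if v = w then vpoly v else 0)"
  "e \<in> arcs G \<Longrightarrow> vpoly (tail G e) * epoly e \<approx> epoly e" "e \<in> arcs G \<Longrightarrow> epoly e * vpoly (head G e) \<approx> epoly e"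
  "e \<in> arcs G \<Longrightarrow> vpoly (head G e) * gpoly e \<approx> gpoly e" "e \<in> arcs G \<Longrightarrow> gpoly e * vpoly (tail G e) \<approx> gpoly e"
  "e \<in> arcs G \<Longrightarrow> f \<in> arcs G \<Longrightarrow> gpoly e * epoly f \<approx> (if e = f then vpoly (head G e) else 0)"
  "v \<in> verts G \<Longrightarrow> out_arcs G v \<noteq> {} \<Longrightarrow> vpoly v \<approx> (\<Sum>e\<in>out_arcs G v. epoly e * gpoly e)"
  unfolding congruent_mod_J_def
  by (rule subsetD[OF relations_in_J]; unfold leavitt_relations_def monomial_append[symmetric] append.simps; blast)+

text \<open>
  In contrast to \<open>path_elem\<close>, the source is written also in front of paths with arcs.  Modulo the
  relations this changes nothing, and it saves a case distinction.
\<close>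

definition path_poly :: "'a \<Rightarrow> 'b list \<Rightarrow> ('a, 'b, 'f) leavitt_poly" where
  "path_poly u p = vpoly u * mon (map Edge p)"

lemma path_poly_carrier: "u \<in> verts G \<Longrightarrow> set p \<subseteq> arcs G \<Longrightarrow> path_poly u p \<in> carrier R"
  by (simp add: path_poly_def gen_carrier free_algebra_closed(6))

lemma path_poly_append: "path_poly u (p @ q) = path_poly u p * mon (map Edge q)"
  by (simp add: path_poly_def monomial_append mult.assoc)

lemma awalk_carrier: "awalk u p v \<Longrightarrow> u \<in> verts G \<and> v \<in> verts G \<and> set p \<subseteq> arcs G \<and> path_poly u p \<in> carrier R"
  using awalk_last_in_verts[of u p v] by (auto intro!: path_poly_carrier simp: awalk_def)

lemma vertex_path_poly:
  assumes "w \<in> verts G" "u \<in> verts G" "set p \<subseteq> arcs G"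
  shows "vpoly w * path_poly u p \<approx> (if w = u then path_poly u p else 0)"
  using cong_multR[OF relations_mod_J(1)[OF assms(1,2)] gen_carrier(4)[OF assms(3)]] assms
  by (auto simp: path_poly_def mult.assoc)

lemma path_poly_Cons:
  assumes "e \<in> arcs G" "set p \<subseteq> arcs G"
  shows "path_poly (tail G e) (e # p) \<approx> epoly e * mon (map Edge p)"
  using cong_multR[OF relations_mod_J(2)[OF assms(1)] gen_carrier(4)[OF assms(2)]]
  by (simp add: path_poly_def mult.assoc monomial_Cons[of "Edge e" "map Edge p"])

lemma edge_path_poly:
  assumes "e \<in> arcs G" "u \<in> verts G" "set p \<subseteq> arcs G"
  shows "epoly e * path_poly u p \<approx> (if u = head G e then path_poly (tail G e) (e # p) else 0)"
proof (cases "u = head G e")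
  case True
  have "epoly e * path_poly u p \<approx> epoly e * mon (map Edge p)"
    using cong_multR[OF relations_mod_J(3)[OF assms(1)] gen_carrier(4)[OF assms(3)]]
    by (simp add: True path_poly_def mult.assoc)
  also have "\<dots> \<approx> path_poly (tail G e) (e # p)" by (rule cong_sym[OF path_poly_Cons[OF assms(1,3)]])
  finally show ?thesis using True by simp
next
  case False
  have "epoly e * path_poly u p \<approx> epoly e * (vpoly (head G e) * path_poly u p)"
    using cong_multR[OF cong_sym[OF relations_mod_J(3)[OF assms(1)]] path_poly_carrier[OF assms(2,3)]]
    by (simp add: mult.assoc)
  also have "\<dots> \<approx> epoly e * 0"
    using cong_multL[OF vertex_path_poly[OF head_in_verts[OF assms(1)] assms(2,3)] gen_carrier(2)[OF assms(1)]] False by auto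
  finally show ?thesis using False by simp
qed

lemma ghost_path_poly_Cons:
  assumes "e \<in> arcs G" "f \<in> arcs G" "set p \<subseteq> arcs G"
  shows "gpoly e * path_poly (tail G f) (f # p) \<approx> (if e = f then path_poly (head G e) p else 0)"
proof -
  have "gpoly e * path_poly (tail G f) (f # p) \<approx> gpoly e * epoly f * mon (map Edge p)"
    using cong_multL[OF path_poly_Cons[OF assms(2,3)] gen_carrier(3)[OF assms(1)]] by (simp add: mult.assoc)
  also have "\<dots> \<approx> (if e = f then path_poly (head G e) p else 0)"
    using cong_multR[OF relations_mod_J(6)[OF assms(1,2)] gen_carrier(4)[OF assms(3)]]
      by (auto simp: path_poly_def)
  finally show ?thesis .
qed

lemma ghost_vertex_poly:
  assumes "e \<in> arcs G" "u \<in> verts G" "u \<noteq> tail G e"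
  shows "gpoly e * vpoly u \<approx> 0"
proof -
  have "gpoly e * vpoly u \<approx> gpoly e * (vpoly (tail G e) * vpoly u)"
    using cong_multR[OF cong_sym[OF relations_mod_J(5)[OF assms(1)]] gen_carrier(1)[OF assms(2)]]
      by (simp add: mult.assoc)
  also have "\<dots> \<approx> gpoly e * 0"
    using cong_multL[OF relations_mod_J(1)[OF tail_in_verts[OF assms(1)] assms(2)] gen_carrier(3)[OF assms(1)]] assms(3) by auto
  finally show ?thesis by simp
qed

lemma path_poly_vertex:
  assumes "awalk u p y"
  shows "path_poly u p * vpoly y \<approx> path_poly u p"
proof (cases p rule: rev_cases)
  case Nil
  then have "u = y" "u \<in> verts G" using assms by (auto simp: awalk_Nil_iff)
  then show ?thesis using Nil relations_mod_J(1)[of u u] by (simp add: path_poly_def monomial_Nil)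
next
  case (snoc q e)
  then have *: "awalk u q (tail G e)" "y = head G e" "e \<in> arcs G" using assms
    by (auto simp: awalk_Cons_iff awalk_Nil_iff)
  show ?thesis
    using cong_multL[OF relations_mod_J(3)[OF *(3)], of "path_poly u q"] awalk_carrier[OF *(1)]
    by (simp add: snoc *(2) path_poly_append mult.assoc)
qed

text \<open>
  The relation \<open>v = \<Sum> e e\<^sup>*\<close> at the end of a path: longer paths, followed by ghosts.
\<close>

lemma path_poly_expand:
  assumes "awalk u p y" "out_arcs G y \<noteq> {}"
  shows "path_poly u p \<approx> (\<Sum>e\<in>out_arcs G y. path_poly u (p @ [e]) * gpoly e)"
proof -
  have "path_poly u p \<approx> path_poly u p * vpoly y" by (rule cong_sym[OF path_poly_vertex[OF assms(1)]])
  also have "\<dots> \<approx> path_poly u p * (\<Sum>e\<in>out_arcs G y. epoly e * gpoly e)"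
    using awalk_carrier[OF assms(1)] by (intro cong_multL relations_mod_J assms) auto
  also have "\<dots> = (\<Sum>e\<in>out_arcs G y. path_poly u (p @ [e]) * gpoly e)"
    by (simp add: sum_distrib_left path_poly_append mult.assoc)
  finally show ?thesis .
qed

text \<open>
  Polynomials that are, modulo the relations, combinations of real paths (paths without ghosts)
  with a given range.
\<close>

inductive_set real_polys :: "'a \<Rightarrow> ('a, 'b, 'f) leavitt_poly set" for y where
  real_polys_J: "x \<in> J \<Longrightarrow> x \<in> real_polys y"
| real_polys_path: "awalk u p y \<Longrightarrow> con c * path_poly u p \<in> real_polys y"
| real_polys_add: "a \<in> real_polys y \<Longrightarrow> b \<in> real_polys y \<Longrightarrow> a + b \<in> real_polys y"

lemma real_polys_cong: "x \<approx> y \<Longrightarrow> y \<in> real_polys v \<Longrightarrow> x \<in> real_polys v"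
  using real_polys_add[OF real_polys_J[of "x - y"]] by (force simp: congruent_mod_J_def)

lemma real_polys_mult_induct:
  assumes "x \<in> real_polys y" "a \<in> carrier R" "b \<in> carrier R"
    and "\<And>u p. awalk u p y \<Longrightarrow> a * path_poly u p * b \<in> real_polys z"
    and con: "\<And>c x. x \<in> real_polys z \<Longrightarrow> con c * x \<in> real_polys z"
  shows "a * x * b \<in> real_polys z"
  using assms(1)
proof induction
  case (real_polys_J x) then show ?case by (intro real_polys.real_polys_J J_closed assms)
next
  case (real_polys_path u p c)
  have "a * (con c * path_poly u p) * b = con c * (a * path_poly u p * b)"
    by (simp add: const_commL mult.assoc)
  then show ?case using con[OF assms(4)[OF real_polys_path]] by simp
next
  case (real_polys_add a b) then show ?case by (simp add: algebra_simps real_polys.real_polys_add)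
qed

lemma real_polys_scale: "x \<in> real_polys y \<Longrightarrow> con c * x \<in> real_polys y"
proof (induction rule: real_polys.induct)
  case (real_polys_J x) then show ?case by (intro real_polys.real_polys_J J_closed free_algebra_closed)
next
  case (real_polys_path u p d)
  have "con c * (con d * path_poly u p) = con (c * d) * path_poly u p"
    by (simp add: mult_single flip: mult.assoc)
  then show ?case using real_polys.real_polys_path[OF real_polys_path] by metis
next
  case (real_polys_add a b) then show ?case by (simp add: algebra_simps real_polys.real_polys_add)
qed

lemmas real_polys_multI = real_polys_mult_induct[OF _ _ _ _ real_polys_scale]

lemma path_poly_real: "awalk u p y \<Longrightarrow> path_poly u p \<in> real_polys y" using real_polys_path[of u p y 1] by simp

lemma real_polys_0: "0 \<in> real_polys y" by (simp add: real_polys_J J_closed)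

lemma vertex_times_real: "x \<in> real_polys y \<Longrightarrow> w \<in> verts G \<Longrightarrow> vpoly w * x \<in> real_polys y"
proof -
  assume x: "x \<in> real_polys y" and w: "w \<in> verts G"
  have "vpoly w * path_poly u p \<in> real_polys y" if "awalk u p y" for u p
    using awalk_carrier[OF that] w
      by (intro real_polys_cong[OF vertex_path_poly]) (simp_all add: real_polys_0 path_poly_real[OF that])
  then show ?thesis using real_polys_multI[of x y "vpoly w" 1 y] x w by (simp add: free_algebra_closed)
qed

lemma edge_times_real: "x \<in> real_polys y \<Longrightarrow> e \<in> arcs G \<Longrightarrow> epoly e * x \<in> real_polys y"
proof -
  assume x: "x \<in> real_polys y" and e: "e \<in> arcs G"
  have "epoly e * path_poly u p \<in> real_polys y" if "awalk u p y" for u p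
    using that e awalk_carrier[OF that]
      by (intro real_polys_cong[OF edge_path_poly]) (auto simp: real_polys_0 awalk_Cons_iff intro!: path_poly_real)
  then show ?thesis using real_polys_multI[of x y "epoly e" 1 y] x e by (simp add: free_algebra_closed)
qed

lemma ghost_times_path: "e \<in> arcs G \<Longrightarrow> awalk u (f # p) y \<Longrightarrow> gpoly e * path_poly u (f # p) \<in> real_polys y"
  using awalk_carrier[of "head G f" p y]
  by (auto simp: awalk_Cons_iff intro!: real_polys_cong[OF ghost_path_poly_Cons] real_polys_0 path_poly_real)

text \<open>
  A ghost shortens a real path unless the path is a vertex, and a vertex that is a sink is not the
  source of the ghost's arc, which therefore annihilates it.
\<close>

lemma ghost_times_real_at_sink:
  assumes "x \<in> real_polys y" "e \<in> arcs G" "out_arcs G y = {}"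
  shows "gpoly e * x \<in> real_polys y"
proof -
  have "gpoly e * path_poly u p \<in> real_polys y" if "awalk u p y" for u p
  proof (cases p)
    case Nil
    then have "u = y" "y \<in> verts G" "y \<noteq> tail G e" using that assms by (auto simp: awalk_Nil_iff)
    then show ?thesis using ghost_vertex_poly[OF assms(2), of y]
      by (simp add: Nil path_poly_def monomial_Nil cong_0_iff real_polys_J)
  next
    case (Cons f q) then show ?thesis using that ghost_times_path assms by auto
  qed
  then show ?thesis using real_polys_multI[of x y "gpoly e" 1 y] assms by (simp add: free_algebra_closed)
qed

text \<open>
  The arc \<open>f\<close> guarantees that each of the paths has a first arc for the ghost to cancel.
\<close>

lemma ghost_times_real_edge:
  assumes "x \<in> real_polys (tail G f)" "e \<in> arcs G" "f \<in> arcs G"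
  shows "gpoly e * (x * epoly f) \<in> real_polys (head G f)"
proof -
  have "gpoly e * path_poly u p * epoly f \<in> real_polys (head G f)" if "awalk u p (tail G f)" for u p
  proof -
    have w: "awalk u (p @ [f]) (head G f)" using that assms by (auto simp: awalk_Cons_iff awalk_Nil_iff)
    then have "gpoly e * path_poly u (p @ [f]) \<in> real_polys (head G f)" using ghost_times_path[OF assms(2)]
      by (cases p) auto
    then show ?thesis by (simp add: path_poly_append mult.assoc)
  qed
  then show ?thesis using real_polys_multI[of x "tail G f" "gpoly e" "epoly f" "head G f"] assms
    by (simp add: free_algebra_closed mult.assoc)
qed

text \<open>
  A walk into a sink cannot be continued, and counts as long.
\<close>

definition long :: "nat \<Rightarrow> 'b list \<Rightarrow> 'a \<Rightarrow> bool" where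
  "long N q y \<longleftrightarrow> N \<le> length q \<or> out_arcs G y = {}"

definition eventually_real :: "('a, 'b, 'f) leavitt_poly \<Rightarrow> nat \<Rightarrow> bool" where
  "eventually_real x N \<longleftrightarrow> (\<forall>u q y. awalk u q y \<longrightarrow> long N q y \<longrightarrow> x * path_poly u q \<in> real_polys y)"

lemma eventually_real_mono: "eventually_real x N \<Longrightarrow> N \<le> M \<Longrightarrow> eventually_real x M"
  by (auto simp: eventually_real_def long_def)

text \<open>
  Each further ghost on the left needs one more arc on the right.
\<close>

lemma eventually_real_gen:
  assumes "eventually_real x N" "a \<in> leavitt_gens G"
  shows "eventually_real (mon [a] * x) (Suc N)"
  unfolding eventually_real_def
proof (intro allI impI)
  fix u q y assume q: "awalk u q y" "long (Suc N) q y"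
  then have x: "x * path_poly u q \<in> real_polys y" using eventually_real_mono[OF assms(1), of "Suc N"]
    by (auto simp: eventually_real_def)
  show "mon [a] * x * path_poly u q \<in> real_polys y"
  proof (cases a)
    case (Vert v) then show ?thesis using vertex_times_real[OF x] assms(2)
      by (auto simp: leavitt_gens_def mult.assoc)
  next
    case (Edge e) then show ?thesis using edge_times_real[OF x] assms(2)
      by (auto simp: leavitt_gens_def mult.assoc)
  next
    case (Ghost e)
    then have e: "e \<in> arcs G" using assms(2) by (auto simp: leavitt_gens_def)
    show ?thesis
    proof (cases "out_arcs G y = {}")
      case True then show ?thesis using ghost_times_real_at_sink[OF x e] by (simp add: Ghost mult.assoc)
    next
      case False
      then obtain p f where p: "q = p @ [f]" "N \<le> length p" using q(2)
        by (cases q rule: rev_cases) (auto simp: long_def)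
      then have f: "awalk u p (tail G f)" "f \<in> arcs G" "y = head G f" using q(1)
        by (auto simp: awalk_Cons_iff awalk_Nil_iff)
      have "x * path_poly u p \<in> real_polys (tail G f)" using assms(1) f(1) p(2)
        by (auto simp: eventually_real_def long_def)
      from ghost_times_real_edge[OF this e f(2)] show ?thesis
        by (simp add: Ghost p(1) path_poly_append f(3) mult.assoc)
    qed
  qed
qed

lemma eventually_real_monomial: "set xs \<subseteq> leavitt_gens G \<Longrightarrow> \<exists>N. eventually_real (mon xs) N"
proof (induction xs)
  case Nil show ?case by (auto simp: eventually_real_def monomial_Nil path_poly_real)
next
  case (Cons a xs) then show ?case using eventually_real_gen[of "mon xs" _ a]
    by (auto simp: monomial_Cons[of a xs])
qed

lemma eventually_real_exists: "x \<in> carrier R \<Longrightarrow> \<exists>N. eventually_real x N"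
proof (induction rule: free_algebra_induct)
  case zero show ?case by (auto simp: eventually_real_def real_polys_0)
next
  case (word xs c)
  then obtain N where "eventually_real (mon xs) N" using eventually_real_monomial by blast
  then have "eventually_real (con c * mon xs) N"
    by (auto simp: eventually_real_def mult.assoc intro!: real_polys_scale)
  then show ?case ..
next
  case (add a b)
  then obtain N M where "eventually_real a N" "eventually_real b M" by blast
  then have "eventually_real a (max N M)" "eventually_real b (max N M)"
    by (auto intro: eventually_real_mono)
  then have "eventually_real (a + b) (max N M)"
    by (auto simp: eventually_real_def distrib_right intro!: real_polys_add)
  then show ?case ..
qed

lemma real_polys_explicit:
  "x \<in> real_polys y \<Longrightarrow> \<exists>A c. finite A \<and> (\<forall>(u, p)\<in>A. awalk u p y) \<and> x \<approx> (\<Sum>(u, p)\<in>A. con (c (u, p)) * path_poly u p)"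
proof (induction rule: real_polys.induct)
  case (real_polys_J x) then show ?case by (intro exI[of _ "{}"]) (simp add: cong_0_iff)
next
  case (real_polys_path u p c)
  then show ?case by (intro exI[of _ "{(u, p)}"] exI[of _ "\<lambda>_. c"]) simp
next
  case (real_polys_add a b)
  then obtain A c B d where A: "finite A" "\<forall>(u, p)\<in>A. awalk u p y" "a \<approx> (\<Sum>(u, p)\<in>A. con (c (u, p)) * path_poly u p)"
    and B: "finite B" "\<forall>(u, p)\<in>B. awalk u p y" "b \<approx> (\<Sum>(u, p)\<in>B. con (d (u, p)) * path_poly u p)" by blast
  define c' d' where "c' = (\<lambda>g. if g \<in> A then c g else 0)" and "d' = (\<lambda>g. if g \<in> B then d g else 0)"
  have eqA: "(\<Sum>(u, p)\<in>A. con (c (u, p)) * path_poly u p) = (\<Sum>(u, p)\<in>A \<union> B. con (c' (u, p)) * path_poly u p)"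
    using A(1) B(1) by (intro sum.mono_neutral_cong_left) (auto simp: c'_def)
  have eqB: "(\<Sum>(u, p)\<in>B. con (d (u, p)) * path_poly u p) = (\<Sum>(u, p)\<in>A \<union> B. con (d' (u, p)) * path_poly u p)"
    using A(1) B(1) by (intro sum.mono_neutral_cong_left) (auto simp: d'_def)
  have "a + b \<approx> (\<Sum>(u, p)\<in>A \<union> B. con (c' (u, p)) * path_poly u p) + (\<Sum>(u, p)\<in>A \<union> B. con (d' (u, p)) * path_poly u p)"
    using cong_add[OF A(3) B(3)] unfolding eqA eqB .
  also have "\<dots> = (\<Sum>(u, p)\<in>A \<union> B. con (c' (u, p) + d' (u, p)) * path_poly u p)"
    by (simp add: sum.distrib[symmetric] split_def single_add distrib_right)
  finally show ?case using A B by (intro exI[of _ "A \<union> B"] exI[of _ "\<lambda>g. c' g + d' g"]) auto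
qed

section \<open>Faithfulness of the action\<close>

lemma gen_range:
  assumes "a \<in> leavitt_gens G"
  shows "\<exists>v\<in>verts G. mon [a] * vpoly v \<approx> mon [a]"
proof (cases a)
  case (Vert v) then show ?thesis using assms relations_mod_J(1)[of v v] by (auto simp: leavitt_gens_def)
next
  case (Edge e) then show ?thesis using assms relations_mod_J(3)[of e] by (auto simp: leavitt_gens_def)
next
  case (Ghost e) then show ?thesis using assms relations_mod_J(5)[of e] by (auto simp: leavitt_gens_def)
qed

text \<open>
  The sum of the vertices is a right unit modulo the relations, for polynomials without constant
  term: the last letter of each word has a range.
\<close>

lemma mult_unit:
  assumes "x \<in> carrier R" "Poly_Mapping.lookup x 0 = 0"
  shows "x * (\<Sum>v\<in>verts G. vpoly v) \<approx> x"
  using assms(1)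
proof (induction rule: free_algebra_induct)
  case (word xs c)
  let ?I = "\<Sum>v\<in>verts G. vpoly v"
  have I: "?I \<in> carrier R" by (intro free_algebra_sum_closed gen_carrier)
  have "xs \<noteq> []" using word assms(2) by (metis in_keys_iff zero_free_word_def)
  then obtain ys a where xs: "xs = ys @ [a]" by (metis rev_exhaust)
  with word have a: "a \<in> leavitt_gens G" "mon [a] \<in> carrier R" "mon ys \<in> carrier R"
    by (simp_all add: free_algebra_closed)
  obtain v where v: "v \<in> verts G" "mon [a] * vpoly v \<approx> mon [a]" using gen_range[OF a(1)] by blast
  have "mon [a] * ?I \<approx> mon [a] * vpoly v * ?I" by (rule cong_multR[OF cong_sym[OF v(2)] I])
  also have "\<dots> = mon [a] * (\<Sum>w\<in>verts G. vpoly v * vpoly w)" by (simp add: mult.assoc sum_distrib_left)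
  also have "\<dots> \<approx> mon [a] * (\<Sum>w\<in>verts G. if v = w then vpoly v else 0)"
    by (intro cong_multL cong_sum relations_mod_J v a)
  also have "\<dots> = mon [a] * vpoly v" using v by simp
  also have "\<dots> \<approx> mon [a]" by (rule v(2))
  finally have "con c * mon ys * (mon [a] * ?I) \<approx> con c * mon ys * mon [a]"
    by (rule cong_multL) (intro free_algebra_closed a)
  then show ?case by (simp add: xs monomial_append mult.assoc)
qed (auto simp: distrib_right intro: cong_add)

text \<open>
  By the relation \<open>v = \<Sum> e e\<^sup>*\<close>, if \<open>q\<close> does not end in a sink, then \<open>x q\<close> is the sum of the elements
  \<open>x (q e) e\<^sup>*\<close>.  So membership in the ideal descends from longer to shorter paths, down to vertices.
\<close>

lemma descent_free:
  assumes x: "x \<in> carrier R" "Poly_Mapping.lookup x 0 = 0"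
    and long: "\<And>u q y. awalk u q y \<Longrightarrow> long N q y \<Longrightarrow> x * path_poly u q \<in> J"
  shows "x \<in> J"
proof -
  have *: "awalk u q y \<Longrightarrow> N \<le> length q + k \<Longrightarrow> x * path_poly u q \<in> J" for k u q y
  proof (induction k arbitrary: u q y)
    case 0 then show ?case using long by (auto simp: long_def)
  next
    case (Suc k)
    show ?case
    proof (cases "out_arcs G y = {}")
      case True then show ?thesis using long Suc by (auto simp: long_def)
    next
      case False
      have "x * path_poly u q \<approx> x * (\<Sum>e\<in>out_arcs G y. path_poly u (q @ [e]) * gpoly e)"
        by (rule cong_multL[OF path_poly_expand[OF Suc.prems(1) False] x(1)])
      also have "\<dots> = (\<Sum>e\<in>out_arcs G y. x * path_poly u (q @ [e]) * gpoly e)"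
        by (simp add: sum_distrib_left mult.assoc)
      finally show ?thesis
      proof (rule cong_in_J[OF _ J_sum])
        fix e assume "e \<in> out_arcs G y"
        then have "gpoly e \<in> carrier R" "x * path_poly u (q @ [e]) \<in> J"
          using Suc.IH[of u "q @ [e]" "head G e"] Suc.prems
            by (auto simp: gen_carrier awalk_Cons_iff awalk_Nil_iff)
        then show "x * path_poly u (q @ [e]) * gpoly e \<in> J" using J_closed(5) by blast
      qed
    qed
  qed
  have "x * vpoly v \<in> J" if "v \<in> verts G" for v
    using *[of v "[]" v N] that by (simp add: awalk_Nil_iff path_poly_def monomial_Nil)
  then have "x * (\<Sum>v\<in>verts G. vpoly v) \<in> J" by (simp add: sum_distrib_left J_sum)
  with cong_in_J[OF cong_sym[OF mult_unit[OF x]]] show ?thesis .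
qed

lemma ev_path_poly: "ev (path_poly u p) = path_op u p"
  by (simp add: path_poly_def ev_mon path_op_def o_def)

lemma path_ops_independent:
  assumes "finite A" "\<forall>(u, p)\<in>A. awalk u p y" "(\<Sum>(u, p)\<in>A. scal (c (u, p)) * path_op u p) = 0" "(u, p) \<in> A"
  shows "c (u, p) = 0"
proof -
  have "coef u p (path_op v q) = (if (v, q) = (u, p) then 1 else 0)" if "(v, q) \<in> A" for v q
  proof -
    have "awalk u p y" "awalk v q y" using assms(2,4) that by auto
    from coef_path_op[OF this] show ?thesis by simp
  qed
  then have "coef u p (\<Sum>(u, p)\<in>A. scal (c (u, p)) * path_op u p) = (\<Sum>g\<in>A. if g = (u, p) then c g else 0)"
    unfolding coef_sum by (intro sum.cong) (auto split: if_splits)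
  then show ?thesis using assms by simp
qed

text \<open>
  After multiplication by a long path only real paths remain; their operators are independent, so
  that all coefficients are 0.
\<close>

lemma ev_inj:
  assumes "x \<in> carrier R" "Poly_Mapping.lookup x 0 = 0" "ev x = 0"
  shows "x \<in> J"
proof -
  obtain N where N: "eventually_real x N" using eventually_real_exists[OF assms(1)] by blast
  show ?thesis
  proof (rule descent_free[OF assms(1,2), of N])
    fix u q y assume q: "awalk u q y" "long N q y"
    with N have "x * path_poly u q \<in> real_polys y" unfolding eventually_real_def by blast
    from real_polys_explicit[OF this] obtain A c where A: "finite A" "\<forall>(u, p)\<in>A. awalk u p y"
      and eq: "x * path_poly u q \<approx> (\<Sum>(u, p)\<in>A. con (c (u, p)) * path_poly u p)"
      by blast
    then have "ev (x * path_poly u q - (\<Sum>(u, p)\<in>A. con (c (u, p)) * path_poly u p)) = 0"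
      by (intro ev_J) (simp add: congruent_mod_J_def)
    then have "(\<Sum>(u, p)\<in>A. scal (c (u, p)) * path_op u p) = 0"
      by (simp add: assms(3) ev_sum split_def ev_path_poly)
    then have "con (c (v, p)) * path_poly v p = 0" if "(v, p) \<in> A" for v p
      using path_ops_independent[OF A, where c = c, OF _ that] by simp
    then have "(\<Sum>(u, p)\<in>A. con (c (u, p)) * path_poly u p) = 0" by (intro sum.neutral) auto
    with eq show "x * path_poly u q \<in> J" by (simp add: cong_0_iff)
  qed
qed

text \<open>
  The image of \<open>L(G)\<close>.
\<close>

definition leavitt_ops :: "('a, 'b, 'f) operator set" where
  "leavitt_ops = ev ` {p \<in> carrier R. Poly_Mapping.lookup p 0 = 0}"

definition real_span :: "'a \<Rightarrow> ('a, 'b, 'f) operator set" where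
  "real_span y = {T. \<exists>A c. finite A \<and> (\<forall>(u, p)\<in>A. awalk u p y) \<and> T = (\<Sum>(u, p)\<in>A. scal (c (u, p)) * path_op u p)}"

text \<open>
  The tool for the study of central elements: long paths absorb all ghosts.
\<close>

lemma leavitt_ops_real:
  assumes "T \<in> leavitt_ops"
  shows "\<exists>N. \<forall>u q y. awalk u q y \<longrightarrow> long N q y \<longrightarrow> T * path_op u q \<in> real_span y"
proof -
  obtain x where x: "x \<in> carrier R" "T = ev x" using assms by (auto simp: leavitt_ops_def)
  obtain N where N: "eventually_real x N" using eventually_real_exists[OF x(1)] by blast
  have "T * path_op u q \<in> real_span y" if q: "awalk u q y" "long N q y" for u q y
  proof -
    from N q have "x * path_poly u q \<in> real_polys y" unfolding eventually_real_def by blast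
    from real_polys_explicit[OF this] obtain A c where A: "finite A" "\<forall>(u, p)\<in>A. awalk u p y"
      and eq: "x * path_poly u q \<approx> (\<Sum>(u, p)\<in>A. con (c (u, p)) * path_poly u p)"
      by blast
    then have "ev (x * path_poly u q - (\<Sum>(u, p)\<in>A. con (c (u, p)) * path_poly u p)) = 0"
      by (intro ev_J) (simp add: congruent_mod_J_def)
    then have "T * path_op u q = (\<Sum>(u, p)\<in>A. scal (c (u, p)) * path_op u p)"
      by (simp add: x ev_sum split_def ev_path_poly)
    with A show ?thesis by (auto simp: real_span_def)
  qed
  then show ?thesis by blast
qed

section \<open>The images of the subalgebras\<close>

text \<open>
  The image of \<open>L(H)\<close>, as the subalgebra of operators with the same generators.
\<close>

inductive_set sub_ops :: "'a set \<Rightarrow> ('a, 'b, 'f) operator set" for H where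
  sub_ops_vertex: "w \<in> H \<Longrightarrow> vertex_op w \<in> sub_ops H"
| sub_ops_edge: "e \<in> arcs_between G H H \<Longrightarrow> edge_op e \<in> sub_ops H"
| sub_ops_ghost: "e \<in> arcs_between G H H \<Longrightarrow> ghost_op e \<in> sub_ops H"
| sub_ops_0: "0 \<in> sub_ops H"
| sub_ops_add: "S \<in> sub_ops H \<Longrightarrow> T \<in> sub_ops H \<Longrightarrow> S + T \<in> sub_ops H"
| sub_ops_mult: "S \<in> sub_ops H \<Longrightarrow> T \<in> sub_ops H \<Longrightarrow> S * T \<in> sub_ops H"
| sub_ops_scal: "T \<in> sub_ops H \<Longrightarrow> scal c * T \<in> sub_ops H"

lemma sub_ops_diff: "S \<in> sub_ops H \<Longrightarrow> T \<in> sub_ops H \<Longrightarrow> S - T \<in> sub_ops H"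
proof -
  assume "S \<in> sub_ops H" "T \<in> sub_ops H"
  then have "S + scal (0 - 1) * T \<in> sub_ops H" by (intro sub_ops_add sub_ops_scal)
  then show ?thesis unfolding scal_diff by simp
qed

lemma sub_ops_sum: "(\<And>a. a \<in> A \<Longrightarrow> f a \<in> sub_ops H) \<Longrightarrow> sum f A \<in> sub_ops H"
  by (induction A rule: infinite_finite_induct) (simp_all add: sub_ops_0 sub_ops_add)

definition aug_polys :: "('a, 'b, 'f) leavitt_poly set" where
  "aug_polys = {p \<in> carrier R. Poly_Mapping.lookup p 0 = 0}"

lemma lookup_mult_0:
  assumes "Poly_Mapping.lookup (q :: ('a, 'b, 'f) leavitt_poly) 0 = 0"
  shows "Poly_Mapping.lookup (p * q) 0 = 0"
proof (rule ccontr)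
  assume "Poly_Mapping.lookup (p * q) 0 \<noteq> 0"
  then have "0 \<in> Poly_Mapping.keys (p * q)" by (simp add: in_keys_iff)
  then obtain v w where "0 = v + w" and w: "w \<in> Poly_Mapping.keys q" using keys_mult[of p q] by blast
  then have "w = 0" by (cases w) (simp add: plus_free_word_def zero_free_word_def)
  with w assms show False by (simp add: in_keys_iff)
qed

lemma aug_polys_closed:
  "0 \<in> aug_polys" "p \<in> aug_polys \<Longrightarrow> q \<in> aug_polys \<Longrightarrow> p + q \<in> aug_polys" "p \<in> aug_polys \<Longrightarrow> q \<in> aug_polys \<Longrightarrow> p - q \<in> aug_polys"
  "p \<in> aug_polys \<Longrightarrow> q \<in> aug_polys \<Longrightarrow> p * q \<in> aug_polys" "p \<in> aug_polys \<Longrightarrow> con c * p \<in> aug_polys"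
  "set xs \<subseteq> leavitt_gens G \<Longrightarrow> xs \<noteq> [] \<Longrightarrow> mon xs \<in> aug_polys"
  by (auto simp: aug_polys_def free_algebra_closed lookup_add lookup_minus lookup_mult_0)
     (auto simp: monomial_def lookup_single zero_free_word_def)

lemma aug_polys_carrier: "p \<in> aug_polys \<Longrightarrow> p \<in> carrier R" by (simp add: aug_polys_def)

lemma aug_polys_sum: "(\<And>a. a \<in> A \<Longrightarrow> f a \<in> aug_polys) \<Longrightarrow> sum f A \<in> aug_polys"
  by (induction A rule: infinite_finite_induct) (simp_all add: aug_polys_closed)

lemma leavitt_ops_aug: "leavitt_ops = ev ` aug_polys" by (simp add: leavitt_ops_def aug_polys_def)

lemma arcs_between_verts: "e \<in> arcs_between G (verts G) (verts G) \<longleftrightarrow> e \<in> arcs G"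
  by (auto simp: arcs_between_def)

lemma sub_ops_word: "set xs \<subseteq> leavitt_gens G \<Longrightarrow> xs \<noteq> [] \<Longrightarrow> prod_list (map gen xs) \<in> sub_ops (verts G)"
proof (induction xs)
  case (Cons a xs)
  have "gen a \<in> sub_ops (verts G)"
    using Cons.prems by (cases a) (auto simp: leavitt_gens_def arcs_between_verts intro: sub_ops.intros)
  then show ?case using Cons by (cases "xs = []") (auto intro: sub_ops_mult)
qed simp

lemma sub_ops_verts: "sub_ops (verts G) = leavitt_ops"
proof (intro equalityI subsetI)
  fix T assume "T \<in> sub_ops (verts G)"
  then show "T \<in> leavitt_ops" unfolding leavitt_ops_aug
  proof induction
    case (sub_ops_vertex w) then show ?case
      by (intro image_eqI[of _ _ "mon [Vert w]"] aug_polys_closed) (simp_all add: ev_mon)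
  next
    case (sub_ops_edge e) then show ?case
      by (intro image_eqI[of _ _ "mon [Edge e]"] aug_polys_closed) (simp_all add: ev_mon arcs_between_verts)
  next
    case (sub_ops_ghost e) then show ?case
      by (intro image_eqI[of _ _ "mon [Ghost e]"] aug_polys_closed) (simp_all add: ev_mon arcs_between_verts)
  next
    case sub_ops_0 then show ?case using aug_polys_closed(1) by (intro image_eqI[of _ _ 0]) simp_all
  next
    case (sub_ops_add S T) then obtain p q where "p \<in> aug_polys" "q \<in> aug_polys" "S = ev p" "T = ev q"
      by auto
    then show ?case by (intro image_eqI[of _ _ "p + q"] aug_polys_closed) simp_all
  next
    case (sub_ops_mult S T) then obtain p q where "p \<in> aug_polys" "q \<in> aug_polys" "S = ev p" "T = ev q"
      by auto
    then show ?case by (intro image_eqI[of _ _ "p * q"] aug_polys_closed) simp_all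
  next
    case (sub_ops_scal T c) then obtain p where "p \<in> aug_polys" "T = ev p" by auto
    then show ?case by (intro image_eqI[of _ _ "con c * p"] aug_polys_closed) simp_all
  qed
next
  fix T assume "T \<in> leavitt_ops"
  then obtain p where p: "p \<in> carrier R" "Poly_Mapping.lookup p 0 = 0" "T = ev p"
    by (auto simp: leavitt_ops_def)
  from p(1) have "ev p \<in> sub_ops (verts G)"
  proof (induction rule: free_algebra_induct)
    case zero show ?case by (simp add: sub_ops_0)
  next
    case (word xs c)
    then have "xs \<noteq> []" using p(2) by (metis in_keys_iff zero_free_word_def)
    with word show ?case by (simp add: ev_mon sub_ops_scal sub_ops_word)
  next
    case (add a b) then show ?case by (simp add: sub_ops_add)
  qed
  then show "T \<in> sub_ops (verts G)" using p by simp
qed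

section \<open>From classes of polynomials to operators\<close>

abbreviation L :: "('f, ('a, 'b, 'f) leavitt_poly set) module" where "L \<equiv> leavitt G"
abbreviation cls :: "('a, 'b, 'f) leavitt_poly \<Rightarrow> ('a, 'b, 'f) leavitt_poly set" where "cls \<equiv> leavitt_class G"

lemma in_class_iff: "p \<in> carrier R \<Longrightarrow> q \<in> cls p \<longleftrightarrow> q - p \<in> J"
  by (auto simp: leavitt_class_def a_r_coset_def r_coset_def intro!: bexI[of _ "q - p"])

lemma class_eqI: "p - q \<in> J \<Longrightarrow> p \<in> carrier R \<Longrightarrow> q \<in> carrier R \<Longrightarrow> cls p = cls q"
proof -
  assume *: "p - q \<in> J" "p \<in> carrier R" "q \<in> carrier R"
  have "x - p \<in> J \<longleftrightarrow> x - q \<in> J" for x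
    using J_closed(3)[of "x - p" "p - q"] J_closed(4)[of "x - q" "p - q"] *(1) by auto
  then show ?thesis using * by (auto simp: in_class_iff)
qed

lemma L_carrier: "carrier L = cls ` aug_polys"
  by (simp add: leavitt_def Let_def aug_polys_def)

lemma cls_mult: "p \<in> carrier R \<Longrightarrow> q \<in> carrier R \<Longrightarrow> cls p \<otimes>\<^bsub>L\<^esub> cls q = cls (p * q)"
  using ideal.rcoset_mult_add[OF ideal_J, of p q] by (simp add: leavitt_def Let_def leavitt_class_def)

lemma cls_add: "p \<in> carrier R \<Longrightarrow> q \<in> carrier R \<Longrightarrow> cls p \<oplus>\<^bsub>L\<^esub> cls q = cls (p + q)"
  using abelian_subgroup.a_rcos_sum[of J R p q] abelian_subgroupI3[OF ideal.axioms(1)[OF ideal_J] ring.is_abelian_group[OF ring_free_algebra]]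
  by (simp add: leavitt_def Let_def leavitt_class_def)

lemma cls_smult: "p \<in> carrier R \<Longrightarrow> c \<odot>\<^bsub>L\<^esub> cls p = cls (con c * p)"
proof -
  assume p: "p \<in> carrier R"
  have "cls (con c * q) = cls (con c * p)" if "q \<in> cls p" for q
  proof (rule class_eqI)
    have "q - p \<in> J" using that p by (simp add: in_class_iff)
    then have q: "q \<in> carrier R" using free_algebra_closed(3)[OF J_closed(1) p] by fastforce
    have "con c * (q - p) \<in> J" by (intro J_closed free_algebra_closed \<open>q - p \<in> J\<close>)
    then show "con c * q - con c * p \<in> J" by (simp add: algebra_simps)
    show "con c * q \<in> carrier R" "con c * p \<in> carrier R" using p q by (simp_all add: free_algebra_closed)
  qed
  moreover have "p \<in> cls p" using p by (simp add: in_class_iff J_closed)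
  ultimately have "(\<Union>q\<in>cls p. cls (con c * q)) = cls (con c * p)" by blast
  then show ?thesis by (simp add: leavitt_def Let_def)
qed

lemma L_zero: "\<zero>\<^bsub>L\<^esub> = cls 0"
proof -
  have "cls 0 = J" using in_class_iff[of 0] free_algebra_closed(1) by auto
  then show ?thesis by (simp add: leavitt_def Let_def)
qed

text \<open>
  The choice of the representative does not matter, as the evaluation vanishes on the ideal.
\<close>

definition Phi :: "('a, 'b, 'f) leavitt_poly set \<Rightarrow> ('a, 'b, 'f) operator" where
  "Phi X = ev (SOME p. p \<in> X)"

lemma Phi_cls: assumes "p \<in> carrier R" shows "Phi (cls p) = ev p"
proof -
  have "p \<in> cls p" using assms by (simp add: in_class_iff J_closed)
  then have "(SOME q. q \<in> cls p) \<in> cls p" by (rule someI)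
  then have "(SOME q. q \<in> cls p) - p \<in> J" using in_class_iff[OF assms] by blast
  from ev_J[OF this] show ?thesis by (simp add: Phi_def)
qed

lemma Phi_image: "Phi ` carrier L = leavitt_ops"
  unfolding L_carrier leavitt_ops_aug image_image
    by (rule image_cong) (simp_all add: Phi_cls aug_polys_carrier)

lemma Phi_inj: "x \<in> carrier L \<Longrightarrow> y \<in> carrier L \<Longrightarrow> Phi x = Phi y \<Longrightarrow> x = y"
proof -
  assume "x \<in> carrier L" "y \<in> carrier L" and eq: "Phi x = Phi y"
  then obtain p q where *: "p \<in> aug_polys" "q \<in> aug_polys" "x = cls p" "y = cls q" by (auto simp: L_carrier)
  have "p - q \<in> J"
  proof (rule ev_inj)
    show "p - q \<in> carrier R" "Poly_Mapping.lookup (p - q) 0 = 0" using aug_polys_closed(3)[OF *(1,2)]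
      by (simp_all add: aug_polys_def)
    show "ev (p - q) = 0" using eq * by (simp add: Phi_cls aug_polys_carrier)
  qed
  then show ?thesis using * by (simp add: class_eqI aug_polys_carrier)
qed

lemma L_closed:
  assumes "x \<in> carrier L" "y \<in> carrier L"
  shows "x \<oplus>\<^bsub>L\<^esub> y \<in> carrier L" "x \<otimes>\<^bsub>L\<^esub> y \<in> carrier L" "c \<odot>\<^bsub>L\<^esub> x \<in> carrier L"
    "Phi (x \<oplus>\<^bsub>L\<^esub> y) = Phi x + Phi y" "Phi (x \<otimes>\<^bsub>L\<^esub> y) = Phi x * Phi y"
    "Phi (c \<odot>\<^bsub>L\<^esub> x) = scal c * Phi x"
proof -
  obtain p q where *: "p \<in> aug_polys" "q \<in> aug_polys" "x = cls p" "y = cls q" using assms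
    by (auto simp: L_carrier)
  then have c: "p \<in> carrier R" "q \<in> carrier R" by (simp_all add: aug_polys_carrier)
  show "x \<oplus>\<^bsub>L\<^esub> y \<in> carrier L" "x \<otimes>\<^bsub>L\<^esub> y \<in> carrier L" "c \<odot>\<^bsub>L\<^esub> x \<in> carrier L"
    using * c by (auto simp: cls_add cls_mult cls_smult L_carrier intro!: aug_polys_closed imageI)
  show "Phi (x \<oplus>\<^bsub>L\<^esub> y) = Phi x + Phi y" "Phi (x \<otimes>\<^bsub>L\<^esub> y) = Phi x * Phi y"
    "Phi (c \<odot>\<^bsub>L\<^esub> x) = scal c * Phi x"
    using * c by (simp_all add: cls_add cls_mult cls_smult Phi_cls free_algebra_closed)
qed

lemma L_0: "\<zero>\<^bsub>L\<^esub> \<in> carrier L" "Phi \<zero>\<^bsub>L\<^esub> = 0"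
  by (auto simp: L_zero L_carrier Phi_cls free_algebra_closed aug_polys_closed)

lemma abelian_monoid_L: "abelian_monoid L"
proof (rule abelian_monoidI)
  fix x y z assume "x \<in> carrier L" "y \<in> carrier L" "z \<in> carrier L"
  then show "x \<oplus>\<^bsub>L\<^esub> y \<oplus>\<^bsub>L\<^esub> z = x \<oplus>\<^bsub>L\<^esub> (y \<oplus>\<^bsub>L\<^esub> z)"
    by (intro Phi_inj) (simp_all add: L_closed add.assoc)
next
  fix x y assume "x \<in> carrier L" "y \<in> carrier L"
  then show "x \<oplus>\<^bsub>L\<^esub> y = y \<oplus>\<^bsub>L\<^esub> x" by (intro Phi_inj) (simp_all add: L_closed add.commute)
next
  fix x assume "x \<in> carrier L"
  then show "\<zero>\<^bsub>L\<^esub> \<oplus>\<^bsub>L\<^esub> x = x" by (intro Phi_inj) (simp_all add: L_closed L_0)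
qed (simp_all add: L_closed L_0)

lemma L_finsum:
  assumes "f \<in> A \<rightarrow> carrier L"
  shows "(\<Oplus>\<^bsub>L\<^esub>i\<in>A. f i) \<in> carrier L" "Phi (\<Oplus>\<^bsub>L\<^esub>i\<in>A. f i) = (\<Sum>i\<in>A. Phi (f i))"
proof -
  interpret abelian_monoid L by (rule abelian_monoid_L)
  show "(\<Oplus>\<^bsub>L\<^esub>i\<in>A. f i) \<in> carrier L" using assms by (rule finsum_closed)
  show "Phi (\<Oplus>\<^bsub>L\<^esub>i\<in>A. f i) = (\<Sum>i\<in>A. Phi (f i))"
    using assms
  proof (induction A rule: infinite_finite_induct)
    case (infinite A) then show ?case by (simp add: finsum_infinite L_0)
  next
    case empty show ?case by (simp add: L_0)
  next
    case (insert a A)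
    then have "f a \<in> carrier L" "f \<in> A \<rightarrow> carrier L" by auto
    then show ?case using insert by (simp add: L_closed finsum_closed)
  qed
qed

lemma Phi_gens:
  "v \<in> verts G \<Longrightarrow> cls (mon [Vert v]) \<in> carrier L" "v \<in> verts G \<Longrightarrow> Phi (cls (mon [Vert v])) = vertex_op v"
  "e \<in> arcs G \<Longrightarrow> cls (mon [Edge e]) \<in> carrier L" "e \<in> arcs G \<Longrightarrow> Phi (cls (mon [Edge e])) = edge_op e"
  "e \<in> arcs G \<Longrightarrow> cls (mon [Ghost e]) \<in> carrier L" "e \<in> arcs G \<Longrightarrow> Phi (cls (mon [Ghost e])) = ghost_op e"
  by (auto simp: L_carrier Phi_cls gen_carrier ev_mon intro!: aug_polys_closed)

lemma leavitt_sub_simps [simp]: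
  "mult (leavitt_sub G H) = mult L" "add (leavitt_sub G H) = add L" "zero (leavitt_sub G H) = zero L"
  "smult (leavitt_sub G H) = smult L" "one (leavitt_sub G H) = cls (\<Sum>w\<in>H. mon [Vert w])"
  by (simp_all add: leavitt_sub_def)

lemma center_simps [simp]:
  "mult (center A) = mult A" "add (center A) = add A" "zero (center A) = zero A"
  "smult (center A) = smult A" "one (center A) = one A"
  by (simp_all add: center_def)

lemma leavitt_sub_carrier:
  assumes "H \<subseteq> verts G"
  shows "carrier (leavitt_sub G H) = {x \<in> carrier L. Phi x \<in> sub_ops H}"
proof -
  let ?X = "(\<lambda>w. cls (mon [Vert w])) ` H \<union> (\<lambda>e. cls (mon [Edge e])) ` arcs_between G H H \<union>
         (\<lambda>e. cls (mon [Ghost e])) ` arcs_between G H H"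
  have arcs: "e \<in> arcs_between G H H \<Longrightarrow> e \<in> arcs G" for e by (simp add: arcs_between_def)
  have "generated_subalgebra L ?X \<subseteq> {x \<in> carrier L. Phi x \<in> sub_ops H}"
    unfolding generated_subalgebra_def
  proof (rule Inter_lower, safe)
    show "is_subalgebra L {x \<in> carrier L. Phi x \<in> sub_ops H}"
      by (auto simp: is_subalgebra_def L_closed L_0 intro: sub_ops.intros)
  qed (auto simp: Phi_gens subsetD[OF assms] arcs intro: sub_ops.intros)
  moreover have "x \<in> S" if "x \<in> carrier L" "Phi x \<in> sub_ops H" and S: "is_subalgebra L S" "?X \<subseteq> S" for x S
  proof -
    have S': "S \<subseteq> carrier L" "\<zero>\<^bsub>L\<^esub> \<in> S" "\<And>x y. x \<in> S \<Longrightarrow> y \<in> S \<Longrightarrow> x \<oplus>\<^bsub>L\<^esub> y \<in> S"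
      "\<And>x y. x \<in> S \<Longrightarrow> y \<in> S \<Longrightarrow> x \<otimes>\<^bsub>L\<^esub> y \<in> S" "\<And>c x. x \<in> S \<Longrightarrow> c \<odot>\<^bsub>L\<^esub> x \<in> S"
      using S(1) by (auto simp: is_subalgebra_def)
    have "\<exists>y\<in>S. Phi y = Phi x"
      using that(2)
    proof induction
      case (sub_ops_vertex w) then show ?case using S(2) assms
        by (intro bexI[of _ "cls (mon [Vert w])"]) (auto simp: Phi_gens)
    next
      case (sub_ops_edge w) then show ?case using S(2) arcs
        by (intro bexI[of _ "cls (mon [Edge w])"]) (auto simp: Phi_gens)
    next
      case (sub_ops_ghost w) then show ?case using S(2) arcs
        by (intro bexI[of _ "cls (mon [Ghost w])"]) (auto simp: Phi_gens)
    next
      case sub_ops_0 then show ?case using S' L_0 by auto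
    next
      case (sub_ops_add a b)
      then obtain y z where "y \<in> S" "z \<in> S" "Phi y = a" "Phi z = b" by blast
      then show ?case using S' by (intro bexI[of _ "y \<oplus>\<^bsub>L\<^esub> z"]) (auto simp: L_closed subset_iff)
    next
      case (sub_ops_mult a b)
      then obtain y z where "y \<in> S" "z \<in> S" "Phi y = a" "Phi z = b" by blast
      then show ?case using S' by (intro bexI[of _ "y \<otimes>\<^bsub>L\<^esub> z"]) (auto simp: L_closed subset_iff)
    next
      case (sub_ops_scal a c)
      then obtain y where "y \<in> S" "Phi y = a" by blast
      then show ?case using S' by (intro bexI[of _ "c \<odot>\<^bsub>L\<^esub> y"]) (auto simp: L_closed subset_iff)
    qed
    then show "x \<in> S" using Phi_inj S'(1) that(1) by blast
  qed
  ultimately show ?thesis unfolding leavitt_sub_def generated_subalgebra_def by auto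
qed

definition central_ops :: "'a set \<Rightarrow> ('a, 'b, 'f) operator set" where
  "central_ops H = {z \<in> sub_ops H. \<forall>a\<in>sub_ops H. a * z = z * a}"

lemma sub_ops_subset: "H \<subseteq> verts G \<Longrightarrow> sub_ops H \<subseteq> leavitt_ops"
  unfolding sub_ops_verts[symmetric]
proof
  fix T assume "H \<subseteq> verts G" "T \<in> sub_ops H"
  from this(2,1) show "T \<in> sub_ops (verts G)"
    by induction (auto intro: sub_ops.intros simp: arcs_between_def)
qed

lemma Phi_ex: "H \<subseteq> verts G \<Longrightarrow> T \<in> sub_ops H \<Longrightarrow> \<exists>x\<in>carrier L. Phi x = T"
proof -
  assume "H \<subseteq> verts G" "T \<in> sub_ops H"
  then have "T \<in> Phi ` carrier L" unfolding Phi_image using sub_ops_subset by auto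
  then show ?thesis by auto
qed

lemma center_transfer:
  assumes "mult A = mult L" "carrier A = {x \<in> carrier L. Phi x \<in> sub_ops H}" "H \<subseteq> verts G"
  shows "carrier (center A) = {z \<in> carrier L. Phi z \<in> central_ops H}"
proof -
  have "(\<forall>a\<in>carrier A. a \<otimes>\<^bsub>L\<^esub> z = z \<otimes>\<^bsub>L\<^esub> a) \<longleftrightarrow> (\<forall>a\<in>sub_ops H. a * Phi z = Phi z * a)" if z: "z \<in> carrier L"
    for z
  proof (intro iffI ballI)
    fix T assume *: "\<forall>a\<in>carrier A. a \<otimes>\<^bsub>L\<^esub> z = z \<otimes>\<^bsub>L\<^esub> a" "T \<in> sub_ops H"
    then obtain a where "a \<in> carrier L" "Phi a = T" using Phi_ex[OF assms(3)] by blast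
    with *(1) assms(2) *(2) z show "T * Phi z = Phi z * T"
      by (metis (mono_tags, lifting) L_closed(5) mem_Collect_eq)
  next
    fix a assume "\<forall>a\<in>sub_ops H. a * Phi z = Phi z * a" "a \<in> carrier A"
    then show "a \<otimes>\<^bsub>L\<^esub> z = z \<otimes>\<^bsub>L\<^esub> a" using z by (intro Phi_inj) (auto simp: assms(2) L_closed)
  qed
  then show ?thesis by (auto simp: center_def assms(1,2) central_ops_def)
qed

lemma center_sub: "H \<subseteq> verts G \<Longrightarrow> carrier (center (leavitt_sub G H)) = {z \<in> carrier L. Phi z \<in> central_ops H}"
  by (rule center_transfer) (simp_all add: leavitt_sub_carrier)

lemma center_L: "carrier (center L) = {z \<in> carrier L. Phi z \<in> central_ops (verts G)}"
  by (rule center_transfer) (use Phi_image sub_ops_verts in auto)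

section \<open>Cancellation and descent along paths\<close>

lemma coef_path_sum:
  assumes "\<And>p. p \<in> B \<Longrightarrow> awalk v (f p) y" "awalk v q y'"
  shows "coef v q (\<Sum>p\<in>B. scal (c p) * path_op v (f p)) = (\<Sum>p\<in>B. if f p = q then c p else 0)"
  unfolding coef_sum by (intro sum.cong) (auto simp: coef_path_op[OF assms(2) assms(1)])

lemma real_span_from:
  assumes "T \<in> real_span y" "vertex_op v * T = T"
  shows "\<exists>B c. finite B \<and> (\<forall>p\<in>B. awalk v p y \<and> c p \<noteq> 0) \<and> T = (\<Sum>p\<in>B. scal (c p) * path_op v p)"
proof -
  obtain A c where A: "finite A" "\<forall>(u, p)\<in>A. awalk u p y" "T = (\<Sum>(u, p)\<in>A. scal (c (u, p)) * path_op u p)"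
    using assms(1) by (auto simp: real_span_def)
  let ?B = "{p. (v, p) \<in> A \<and> c (v, p) \<noteq> 0}"
  have "Pair v ` ?B \<subseteq> A" by auto
  then have "finite (Pair v ` ?B)" using A(1) finite_subset by blast
  then have fin: "finite ?B" by (rule finite_imageD) (simp add: inj_on_def)
  have "T = (\<Sum>(u, p)\<in>A. vertex_op v * (scal (c (u, p)) * path_op u p))"
    using assms(2) A(3) by (metis (no_types, lifting) split_def sum.cong sum_distrib_left)
  also have "\<dots> = (\<Sum>(u, p)\<in>A. if u = v \<and> c (u, p) \<noteq> 0 then scal (c (u, p)) * path_op u p else 0)"
    by (intro sum.cong) (auto simp: scal_commL vertex_path)
  also have "\<dots> = (\<Sum>(u, p)\<in>Pair v ` ?B. scal (c (u, p)) * path_op u p)"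
    by (rule sum.mono_neutral_cong_right) (use A(1) in auto)
  also have "\<dots> = (\<Sum>p\<in>?B. scal (c (v, p)) * path_op v p)"
    by (subst sum.reindex) (auto simp: inj_on_def)
  finally show ?thesis using A(2) fin by (intro exI[of _ ?B] exI[of _ "\<lambda>p. c (v, p)"]) auto
qed

text \<open>
  Appending the same path to different paths leaves them different.
\<close>

lemma real_span_cancel:
  assumes "T \<in> real_span y" "vertex_op v * T = T" "awalk y p w" "T * path_op y p = 0"
  shows "T = 0"
proof -
  obtain B c where B: "finite B" "\<forall>p\<in>B. awalk v p y \<and> c p \<noteq> 0" "T = (\<Sum>p\<in>B. scal (c p) * path_op v p)"
    using real_span_from[OF assms(1,2)] by blast
  have "B = {}"
  proof (rule ccontr)
    assume "B \<noteq> {}"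
    then obtain q where q: "q \<in> B" by blast
    have "T * path_op y p = (\<Sum>q\<in>B. scal (c q) * path_op v (q @ p))"
      unfolding B(3) sum_distrib_right
      by (intro sum.cong) (use B(2) in \<open>auto simp: path_op_append mult.assoc\<close>)
    then have "coef v (q @ p) (\<Sum>q\<in>B. scal (c q) * path_op v (q @ p)) = 0" using assms(4) by simp
    moreover have "coef v (q @ p) (\<Sum>q\<in>B. scal (c q) * path_op v (q @ p)) = (\<Sum>q'\<in>B. if q' @ p = q @ p then c q' else 0)"
      using B(2) q assms(3) by (intro coef_path_sum[of _ _ _ w _ w]) auto
    ultimately show False using q B(1,2) by simp
  qed
  then show ?thesis using B(3) by simp
qed

lemma path_op_expand:
  assumes "awalk u q y" "out_arcs G y \<noteq> {}"
  shows "path_op u q = (\<Sum>e\<in>out_arcs G y. path_op u (q @ [e]) * ghost_op e)"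
proof -
  have "path_op u q = path_op u q * vertex_op y" using path_vertex[OF assms(1), of y] by simp
  also have "\<dots> = (\<Sum>e\<in>out_arcs G y. path_op u q * (edge_op e * ghost_op e))"
    by (subst CK2[OF assms(2)]) (simp only: sum_distrib_left)
  also have "\<dots> = (\<Sum>e\<in>out_arcs G y. path_op u (q @ [e]) * ghost_op e)"
    using assms(1) by (intro sum.cong) (auto simp: path_op_snoc mult.assoc)
  finally show ?thesis .
qed

text \<open>
  The descent from long paths to vertices once more, for any set that is closed under addition and
  under the ghosts that occur.  With \<open>D = {0}\<close> it shows that an element vanishes at a vertex, with
  the image of \<open>L(H)\<close> that an element of a corner lies in \<open>L(H)\<close>.
\<close>

lemma descent:
  assumes D: "0 \<in> D" "\<And>a b. a \<in> D \<Longrightarrow> b \<in> D \<Longrightarrow> a + b \<in> D"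
    and S: "\<And>a q e. a \<in> D \<Longrightarrow> e \<in> arcs G \<Longrightarrow> awalk u q (tail G e) \<Longrightarrow> a * ghost_op e \<in> D"
    and long: "\<And>q y. awalk u q y \<Longrightarrow> long N q y \<Longrightarrow> T * path_op u q \<in> D"
    and u: "u \<in> verts G"
  shows "T * vertex_op u \<in> D"
proof -
  have sum: "sum f A \<in> D" if "\<And>a. a \<in> A \<Longrightarrow> f a \<in> D" for f :: "'b \<Rightarrow> _" and A
    using that by (induction A rule: infinite_finite_induct) (auto intro: D)
  have *: "awalk u q y \<Longrightarrow> N \<le> length q + k \<Longrightarrow> T * path_op u q \<in> D" for k q y
  proof (induction k arbitrary: q y)
    case 0 then show ?case using long by (auto simp: long_def)
  next
    case (Suc k)
    show ?case
    proof (cases "out_arcs G y = {}")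
      case True then show ?thesis using long Suc by (auto simp: long_def)
    next
      case False
      have "T * path_op u q = (\<Sum>e\<in>out_arcs G y. T * path_op u (q @ [e]) * ghost_op e)"
        by (subst path_op_expand[OF Suc.prems(1) False]) (simp add: sum_distrib_left mult.assoc)
      also have "\<dots> \<in> D"
      proof (rule sum)
        fix e assume e: "e \<in> out_arcs G y"
        then have "T * path_op u (q @ [e]) \<in> D"
          using Suc.IH[of "q @ [e]" "head G e"] Suc.prems by (auto simp: awalk_Cons_iff awalk_Nil_iff)
        then show "T * path_op u (q @ [e]) * ghost_op e \<in> D" using e Suc.prems by (intro S) auto
      qed
      finally show ?thesis .
    qed
  qed
  show ?thesis using *[of "[]" u N] u by (simp add: awalk_Nil_iff)
qed

lemma long_walk_exists: "u \<in> verts G \<Longrightarrow> \<exists>s y. awalk u s y \<and> long N s y"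
proof (induction N)
  case 0 then show ?case by (intro exI[of _ "[]"] exI[of _ u]) (simp add: awalk_Nil_iff long_def)
next
  case (Suc N)
  then obtain s y where s: "awalk u s y" "long N s y" by blast
  show ?case
  proof (cases "out_arcs G y = {}")
    case True then show ?thesis using s by (auto simp: long_def)
  next
    case False
    then obtain e where "e \<in> out_arcs G y" by blast
    then show ?thesis using s False
      by (intro exI[of _ "s @ [e]"] exI[of _ "head G e"]) (auto simp: long_def awalk_Cons_iff awalk_Nil_iff)
  qed
qed

section \<open>Hereditary sets and corners\<close>

lemma hereditaryD: "hereditary G H \<Longrightarrow> w \<in> H \<Longrightarrow> awalk w p x \<Longrightarrow> x \<in> H"
  by (auto simp: hereditary_def)
lemma hereditary_arc: "hereditary G H \<Longrightarrow> e \<in> arcs G \<Longrightarrow> tail G e \<in> H \<Longrightarrow> head G e \<in> H"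
  using hereditaryD[of H "tail G e" "[e]" "head G e"] by (auto intro: arc_implies_awalk)
lemma hereditary_verts: "hereditary G H \<Longrightarrow> H \<subseteq> verts G" by (simp add: hereditary_def)
lemma hereditary_finite: "hereditary G H \<Longrightarrow> finite H"
  using hereditary_verts finite_verts finite_subset by blast
lemma hereditary_arcs_between: "hereditary G H \<Longrightarrow> e \<in> arcs G \<Longrightarrow> tail G e \<in> H \<Longrightarrow> e \<in> arcs_between G H H"
  by (simp add: arcs_between_def hereditary_arc)

lemma sub_ops_path: "hereditary G H \<Longrightarrow> u \<in> H \<Longrightarrow> awalk u p y \<Longrightarrow> path_op u p \<in> sub_ops H"
proof (induction p arbitrary: u)
  case (Cons e p)
  then have "e \<in> arcs_between G H H" "u = tail G e" "awalk (head G e) p y"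
    by (auto simp: awalk_Cons_iff hereditary_arcs_between)
  moreover have "head G e \<in> H" using \<open>e \<in> arcs_between G H H\<close> by (simp add: arcs_between_def)
  ultimately show ?case using Cons by (auto simp: path_op_Cons intro: sub_ops.intros)
qed (auto intro: sub_ops_vertex)

lemma sub_ops_ghost_path: "hereditary G H \<Longrightarrow> u \<in> H \<Longrightarrow> awalk u p y \<Longrightarrow> gpath_op u p \<in> sub_ops H"
proof (induction p arbitrary: u)
  case (Cons e p)
  then have "e \<in> arcs_between G H H" "u = tail G e" "awalk (head G e) p y"
    by (auto simp: awalk_Cons_iff hereditary_arcs_between)
  moreover have "head G e \<in> H" using \<open>e \<in> arcs_between G H H\<close> by (simp add: arcs_between_def)
  ultimately show ?case using Cons by (auto simp: gpath_op_Cons intro: sub_ops.intros)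
qed (auto intro: sub_ops_vertex)

lemma hereditary_all: "hereditary G (verts G)"
  by (auto simp: hereditary_def dest: awalk_last_in_verts)

definition unit_of :: "'a set \<Rightarrow> ('a, 'b, 'f) operator" where "unit_of H = (\<Sum>w\<in>H. vertex_op w)"

lemma unit_of_vertex: "finite H \<Longrightarrow> unit_of H * vertex_op w = (if w \<in> H then vertex_op w else 0)"
  "finite H \<Longrightarrow> vertex_op w * unit_of H = (if w \<in> H then vertex_op w else 0)"
  by (simp_all add: unit_of_def sum_distrib_right sum_distrib_left vertex_vertex)

lemma sub_ops_unit:
  assumes "finite H"
  shows "T \<in> sub_ops H \<Longrightarrow> unit_of H * T = T \<and> T * unit_of H = T"
proof (induction rule: sub_ops.induct)
  case (sub_ops_vertex w) then show ?case by (simp add: unit_of_vertex assms)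
next
  case (sub_ops_edge e)
  then have "unit_of H * (vertex_op (tail G e) * edge_op e) = vertex_op (tail G e) * edge_op e"
    "(edge_op e * vertex_op (head G e)) * unit_of H = edge_op e * vertex_op (head G e)"
    using assms
      by (simp_all add: unit_of_vertex arcs_between_def mult.assoc del: edge_ends flip: mult.assoc[of "unit_of H"])
  then show ?case by simp
next
  case (sub_ops_ghost e)
  then have "unit_of H * (vertex_op (head G e) * ghost_op e) = vertex_op (head G e) * ghost_op e"
    "(ghost_op e * vertex_op (tail G e)) * unit_of H = ghost_op e * vertex_op (tail G e)"
    using assms
      by (simp_all add: unit_of_vertex arcs_between_def mult.assoc del: edge_ends flip: mult.assoc[of "unit_of H"])
  then show ?case by simp
next
  case (sub_ops_mult S T)
  have "unit_of H * (S * T) = (unit_of H * S) * T" by (simp only: mult.assoc)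
  then show ?case using sub_ops_mult by (simp add: mult.assoc)
next
  case (sub_ops_scal T c) then show ?case by (simp add: scal_commL mult.assoc)
qed (simp_all add: distrib_left distrib_right)

text \<open>
  For a long path \<open>q\<close> from a vertex of \<open>H\<close> and \<open>u \<in> H\<close>, the element \<open>u T q\<close> is a combination of real
  paths that start in \<open>H\<close>, and these lie in \<open>L(H)\<close>.  The descent to the source of \<open>q\<close> only uses
  ghosts of arcs in \<open>H\<close>.  So the corner of \<open>L(G)\<close> at \<open>H\<close> is \<open>L(H)\<close>.
\<close>

lemma corner_in_sub_ops:
  assumes H: "hereditary G H" and T: "T \<in> leavitt_ops"
  shows "unit_of H * T * unit_of H \<in> sub_ops H"
proof -
  have "vertex_op u * T * vertex_op w \<in> sub_ops H" if u: "u \<in> H" and w: "w \<in> H" for u w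
  proof -
    obtain N where N: "\<forall>u q y. awalk u q y \<longrightarrow> long N q y \<longrightarrow> T * path_op u q \<in> real_span y"
      using leavitt_ops_real[OF T] by blast
    show ?thesis
    proof (rule descent[of "sub_ops H" w N])
      fix q y assume q: "awalk w q y" "long N q y"
      with N have "T * path_op w q \<in> real_span y" by blast
      then obtain A c where A: "finite A" "\<forall>(u, p)\<in>A. awalk u p y" "T * path_op w q = (\<Sum>(u, p)\<in>A. scal (c (u, p)) * path_op u p)"
        unfolding real_span_def by auto
      have "vertex_op u * T * path_op w q = (\<Sum>(v, p)\<in>A. scal (c (v, p)) * (vertex_op u * path_op v p))"
        unfolding mult.assoc A(3) sum_distrib_left by (intro sum.cong) (auto simp: scal_commL)
      also have "\<dots> \<in> sub_ops H"
      proof (rule sub_ops_sum, safe)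
        fix v p assume "(v, p) \<in> A"
        then have "awalk v p y" using A(2) by blast
        then show "scal (c (v, p)) * (vertex_op u * path_op v p) \<in> sub_ops H"
          using sub_ops_path[OF H u] by (auto simp: vertex_path intro: sub_ops.intros)
      qed
      finally show "vertex_op u * T * path_op w q \<in> sub_ops H" .
    next
      fix a q e assume "a \<in> sub_ops H" "e \<in> arcs G" "awalk w q (tail G e)"
      then show "a * ghost_op e \<in> sub_ops H"
        using hereditaryD[OF H w] by (intro sub_ops_mult sub_ops_ghost hereditary_arcs_between H) auto
    qed (use H w hereditary_verts in \<open>auto intro: sub_ops.intros\<close>)
  qed
  then show ?thesis unfolding unit_of_def sum_distrib_left sum_distrib_right by (intro sub_ops_sum)
qed

section \<open>Central elements: scalars and zeros\<close>

abbreviation "Z \<equiv> central_ops (verts G)"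

lemma Z_leavitt_ops: "z \<in> Z \<Longrightarrow> z \<in> leavitt_ops" unfolding central_ops_def sub_ops_verts by blast
lemma Z_comm: "z \<in> Z \<Longrightarrow> a \<in> leavitt_ops \<Longrightarrow> a * z = z * a" unfolding central_ops_def sub_ops_verts by blast
lemma leavitt_ops_path: "awalk u p y \<Longrightarrow> path_op u p \<in> leavitt_ops" "awalk u p y \<Longrightarrow> gpath_op u p \<in> leavitt_ops"
  using sub_ops_path[OF hereditary_all, of u p y] sub_ops_ghost_path[OF hereditary_all, of u p y]
    by (auto simp: sub_ops_verts)
lemma leavitt_ops_vertex: "v \<in> verts G \<Longrightarrow> vertex_op v \<in> leavitt_ops" using sub_ops_vertex[of v "verts G"]
  by (simp add: sub_ops_verts)

lemma Z_path: "z \<in> Z \<Longrightarrow> awalk u p y \<Longrightarrow> path_op u p * z = z * path_op u p" "z \<in> Z \<Longrightarrow> awalk u p y \<Longrightarrow> gpath_op u p * z = z * gpath_op u p"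
  by (simp_all add: Z_comm leavitt_ops_path)
lemma Z_vertex: "z \<in> Z \<Longrightarrow> vertex_op v * z = z * vertex_op v"
  by (cases "v \<in> verts G") (simp_all add: Z_comm leavitt_ops_vertex vertex_op_outside)

lemma Z_vertex_path: "z \<in> Z \<Longrightarrow> vertex_op u * (z * path_op u p) = z * path_op u p"
proof -
  assume "z \<in> Z"
  then have "vertex_op u * (z * path_op u p) = z * (vertex_op u * path_op u p)" using Z_vertex[of z u]
    by (simp only: mult.assoc[symmetric])
  then show ?thesis by (simp add: vertex_path)
qed

lemma central_opsI: "x \<in> sub_ops H \<Longrightarrow> (\<And>a. a \<in> sub_ops H \<Longrightarrow> a * x = x * a) \<Longrightarrow> x \<in> central_ops H"
  unfolding central_ops_def by blast
lemma central_opsD: "x \<in> central_ops H \<Longrightarrow> x \<in> sub_ops H" "x \<in> central_ops H \<Longrightarrow> a \<in> sub_ops H \<Longrightarrow> a * x = x * a"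
  unfolding central_ops_def by blast+

lemma central_ops_closed:
  "0 \<in> central_ops H" "x \<in> central_ops H \<Longrightarrow> y \<in> central_ops H \<Longrightarrow> x + y \<in> central_ops H" "x \<in> central_ops H \<Longrightarrow> y \<in> central_ops H \<Longrightarrow> x - y \<in> central_ops H"
  "x \<in> central_ops H \<Longrightarrow> y \<in> central_ops H \<Longrightarrow> x * y \<in> central_ops H" "x \<in> central_ops H \<Longrightarrow> scal c * x \<in> central_ops H"
proof -
  show "0 \<in> central_ops H" by (rule central_opsI) (simp_all add: sub_ops_0)
  assume x: "x \<in> central_ops H"
  show "scal c * x \<in> central_ops H"
  proof (rule central_opsI[OF sub_ops_scal[OF central_opsD(1)[OF x]]])
    fix a assume "a \<in> sub_ops H"
    from central_opsD(2)[OF x this] show "a * (scal c * x) = scal c * x * a"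
      by (simp only: scal_commL mult.assoc)
  qed
  assume y: "y \<in> central_ops H"
  show "x + y \<in> central_ops H"
  proof (rule central_opsI[OF sub_ops_add[OF central_opsD(1)[OF x] central_opsD(1)[OF y]]])
    fix a assume "a \<in> sub_ops H"
    from central_opsD(2)[OF x this] central_opsD(2)[OF y this] show "a * (x + y) = (x + y) * a"
      by (simp only: distrib_left distrib_right)
  qed
  show "x - y \<in> central_ops H"
  proof (rule central_opsI[OF sub_ops_diff[OF central_opsD(1)[OF x] central_opsD(1)[OF y]]])
    fix a assume "a \<in> sub_ops H"
    from central_opsD(2)[OF x this] central_opsD(2)[OF y this] show "a * (x - y) = (x - y) * a"
      by (simp only: left_diff_distrib right_diff_distrib)
  qed
  show "x * y \<in> central_ops H"
  proof (rule central_opsI[OF sub_ops_mult[OF central_opsD(1)[OF x] central_opsD(1)[OF y]]])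
    fix a assume a: "a \<in> sub_ops H"
    have "a * (x * y) = a * x * y" by (simp only: mult.assoc)
    also have "\<dots> = x * y * a" by (simp only: central_opsD(2)[OF x a] central_opsD(2)[OF y a] mult.assoc)
    finally show "a * (x * y) = x * y * a" .
  qed
qed

lemma central_ops_sum: "(\<And>a. a \<in> A \<Longrightarrow> f a \<in> central_ops H) \<Longrightarrow> sum f A \<in> central_ops H"
  by (induction A rule: infinite_finite_induct) (simp_all add: central_ops_closed)

lemma unit_central:
  assumes "finite H"
  shows "unit_of H \<in> central_ops H"
proof (rule central_opsI)
  show "unit_of H \<in> sub_ops H" unfolding unit_of_def by (intro sub_ops_sum sub_ops_vertex)
  show "a * unit_of H = unit_of H * a" if "a \<in> sub_ops H" for a using sub_ops_unit[OF assms that] by simp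
qed

text \<open>
  With \<open>p\<close> from \<open>v\<close> to \<open>w\<close>, we have \<open>w = p\<^sup>* v p\<close>, and \<open>z\<close> can be moved past \<open>p\<^sup>*\<close>.
\<close>

lemma scalar_propagates:
  assumes z: "z \<in> Z" and v: "z * vertex_op v = scal c * vertex_op v" and p: "awalk v p w"
  shows "z * vertex_op w = scal c * vertex_op w"
proof -
  have "z * vertex_op w = z * gpath_op v p * path_op v p" using ghost_path_path[OF p]
    by (simp add: mult.assoc)
  also have "\<dots> = gpath_op v p * (z * (vertex_op v * path_op v p))"
    by (simp add: vertex_path) (simp only: mult.assoc[symmetric] Z_path(2)[OF z p])
  also have "\<dots> = gpath_op v p * (z * vertex_op v * path_op v p)" by (simp only: mult.assoc)
  also have "\<dots> = scal c * (gpath_op v p * path_op v p)" unfolding v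
    by (simp add: vertex_path mult.assoc scal_commL)
  finally show ?thesis using ghost_path_path[OF p] by simp
qed

text \<open>
  For a long path \<open>q\<close> from \<open>u\<close> to \<open>y\<close>, take \<open>p\<close> from \<open>y\<close> to a vertex \<open>w\<close> with \<open>z w = 0\<close>.  Then
  \<open>z q p = q p (z w) = 0\<close>; but \<open>z q\<close> is a combination of real paths, from which \<open>p\<close> can be cancelled.
\<close>

lemma central_vanishes_at:
  assumes z: "z \<in> Z" and u: "u \<in> verts G"
    and reach: "\<And>q y. awalk u q y \<Longrightarrow> \<exists>p w. awalk y p w \<and> z * vertex_op w = 0"
  shows "z * vertex_op u = 0"
proof -
  obtain N where N: "\<forall>u q y. awalk u q y \<longrightarrow> long N q y \<longrightarrow> z * path_op u q \<in> real_span y"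
    using leavitt_ops_real[OF Z_leavitt_ops[OF z]] by blast
  have "z * vertex_op u \<in> {0}"
  proof (rule descent[of _ u N])
    fix q y assume q: "awalk u q y" "long N q y"
    obtain p w where p: "awalk y p w" "z * vertex_op w = 0" using reach[OF q(1)] by blast
    have qp: "awalk u (q @ p) w" using q(1) p(1) by auto
    have "z * path_op u q * path_op y p = z * path_op u (q @ p)" using q(1)
      by (simp add: path_op_append mult.assoc)
    also have "\<dots> = path_op u (q @ p) * z" using Z_path(1)[OF z qp] by simp
    also have "\<dots> = path_op u (q @ p) * vertex_op w * z" using path_vertex[OF qp, of w] by simp
    also have "\<dots> = 0" using p(2) Z_vertex[OF z, of w] by (simp add: mult.assoc)
    finally have "z * path_op u q * path_op y p = 0" .
    from real_span_cancel[OF _ _ p(1) this, of u] N q Z_vertex_path[OF z] show "z * path_op u q \<in> {0}"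
      by auto
  qed (use u in auto)
  then show ?thesis by simp
qed

section \<open>Central elements on cycles\<close>

definition iter :: "'b list \<Rightarrow> nat \<Rightarrow> 'b list" where "iter C n = concat (replicate n C)"

lemma iter_0 [simp]: "iter C 0 = []"
  and iter_Suc: "iter C (Suc n) = C @ iter C n"
  by (simp_all add: iter_def)
lemma iter_add: "iter C (m + n) = iter C m @ iter C n" by (simp add: iter_def replicate_add)
lemma length_iter: "length (iter C n) = n * length C" by (induction n) (simp_all add: iter_Suc)
lemma iter_commute: "iter C m @ iter C n = iter C n @ iter C m" by (metis add.commute iter_add)
lemma iter_inj: "C \<noteq> [] \<Longrightarrow> iter C m = iter C n \<Longrightarrow> m = n"
  by (metis length_iter length_0_conv mult_right_cancel)
lemma awalk_iter: "awalk v C v \<Longrightarrow> awalk v (iter C n) v"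
  by (induction n) (auto simp: iter_Suc awalk_Nil_iff dest: awalk_hd_in_verts)

text \<open>
  Running around a cycle, its source is visited only after complete turns.
\<close>

lemma closed_prefix_iter:
  assumes "awalk v C v" "distinct (map (tail G) C)" "C \<noteq> []" "awalk v p v" "iter C k = p @ r"
  shows "\<exists>a. p = iter C a"
  using assms(4,5)
proof (induction k arbitrary: p)
  case 0 then show ?case by (intro exI[of _ 0]) auto
next
  case (Suc k)
  show ?case
  proof (cases "length C \<le> length p")
    case True
    with Suc.prems(2) obtain p' where p': "p = C @ p'" "iter C k = p' @ r"
      by (auto simp: iter_Suc append_eq_append_conv2)
    then have "awalk v p' v" using Suc.prems(1) assms(1)
      by (metis awalk_append_iff awalk_ends_eqD assms(3) awalk_ends)
    from Suc.IH[OF this p'(2)] obtain a where "p' = iter C a" by blast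
    then show ?thesis using p'(1) by (intro exI[of _ "Suc a"]) (simp add: iter_Suc)
  next
    case False
    with Suc.prems(2) obtain q where q: "C = p @ q" "q \<noteq> []" by (auto simp: iter_Suc append_eq_append_conv2)
    then have "tail G (hd q) = v"
      using assms(1) Suc.prems(1) by (cases q; cases "p = []") (auto simp: awalk_Cons_iff dest: awalk_ends)
    have "p = []"
    proof (rule ccontr)
      assume "p \<noteq> []"
      then have "tail G (hd p) = v" using Suc.prems(1) by (cases p) (auto simp: awalk_Cons_iff)
      then show False using assms(2) q \<open>p \<noteq> []\<close> \<open>tail G (hd q) = v\<close> by (cases p; cases q) auto
    qed
    then show ?thesis by (intro exI[of _ 0]) simp
  qed
qed

text \<open>
  The arc \<open>e\<close> marks the point where the walk stops following \<open>C\<close>.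
\<close>

lemma exit_position_unique:
  assumes "C \<noteq> []" "e \<noteq> hd C" "iter C m @ e # p = iter C n @ e # q"
  shows "m = n"
  using assms(3)
proof (induction m arbitrary: n)
  case 0 then show ?case using assms(1,2) by (cases n; cases C) (auto simp: iter_Suc)
next
  case (Suc m) then show ?case using assms(1,2) by (cases n; cases C) (auto simp: iter_Suc)
qed

text \<open>
  For large \<open>N\<close>, the element \<open>z C\<^sup>N\<close> is a combination of real closed paths, and it commutes with all
  \<open>C\<^sup>k\<close>.  If \<open>p\<close> is one of the paths, then comparing the coefficients of \<open>p C\<^sup>k\<close> yields some \<open>q\<close>
  among them with \<open>C\<^sup>k q = p C\<^sup>k\<close>.  Thus \<open>p\<close> is an initial segment of a power of \<open>C\<close>, and being closed it is
  a power of \<open>C\<close>.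
\<close>

lemma central_on_cycle:
  assumes z: "z \<in> Z" and C: "awalk v C v" "distinct (map (tail G) C)" "C \<noteq> []"
  shows "\<exists>N A c. finite A \<and> z * path_op v (iter C N) = (\<Sum>a\<in>A. scal (c a) * path_op v (iter C a))"
proof -
  obtain N where N: "\<forall>u q y. awalk u q y \<longrightarrow> long N q y \<longrightarrow> z * path_op u q \<in> real_span y"
    using leavitt_ops_real[OF Z_leavitt_ops[OF z]] by blast
  have "N \<le> length (iter C N)" using C(3) by (cases C) (simp_all add: length_iter)
  then have "z * path_op v (iter C N) \<in> real_span v" using N awalk_iter[OF C(1)] by (auto simp: long_def)
  from real_span_from[OF this Z_vertex_path[OF z]] obtain B c where B: "finite B" "\<forall>p\<in>B. awalk v p v \<and> c p \<noteq> 0"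
    and eq: "z * path_op v (iter C N) = (\<Sum>p\<in>B. scal (c p) * path_op v p)" by blast
  have ex: "\<exists>a. p = iter C a" if p: "p \<in> B" for p
  proof -
    \<comment> \<open>with this exponent, \<open>C\<^sup>k\<close> is at least as long as \<open>p\<close>\<close>
    define k where "k = length p"
    let ?k = "iter C k"
    have k: "awalk v ?k v" by (rule awalk_iter[OF C(1)])
    have "(\<Sum>q\<in>B. scal (c q) * path_op v (q @ ?k)) = z * path_op v (iter C N) * path_op v ?k"
      unfolding eq sum_distrib_right using B(2) by (intro sum.cong) (auto simp: path_op_append mult.assoc)
    also have "\<dots> = z * path_op v (iter C N @ ?k)"
      using path_op_append[OF awalk_iter[OF C(1)], of N ?k] by (simp add: mult.assoc)
    also have "\<dots> = z * path_op v ?k * path_op v (iter C N)"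
      unfolding iter_commute[of C N k] using path_op_append[OF k, of "iter C N"] by (simp add: mult.assoc)
    also have "\<dots> = path_op v ?k * (z * path_op v (iter C N))"
      by (simp only: mult.assoc[symmetric] Z_path(1)[OF z k])
    also have "\<dots> = (\<Sum>q\<in>B. scal (c q) * path_op v (?k @ q))"
      unfolding eq sum_distrib_left using path_op_append[OF k] by (intro sum.cong) (auto simp: scal_commL)
    finally have *: "(\<Sum>q\<in>B. scal (c q) * path_op v (q @ ?k)) = (\<Sum>q\<in>B. scal (c q) * path_op v (?k @ q))" .
    have "(\<Sum>q\<in>B. if q @ ?k = p @ ?k then c q else 0) = coef v (p @ ?k) (\<Sum>q\<in>B. scal (c q) * path_op v (q @ ?k))"
      using B(2) p k by (intro coef_path_sum[symmetric, of _ _ _ v _ v]) auto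
    also have "\<dots> = (\<Sum>q\<in>B. if ?k @ q = p @ ?k then c q else 0)"
      unfolding * using B(2) p k by (intro coef_path_sum[of _ _ _ v _ v]) auto
    finally have "c p = (\<Sum>q\<in>B. if ?k @ q = p @ ?k then c q else 0)" using p B(1) by simp
    moreover have "c p \<noteq> 0" using B(2) p by blast
    ultimately have nz: "(\<Sum>q\<in>B. if ?k @ q = p @ ?k then c q else 0) \<noteq> 0" by metis
    have "\<exists>q\<in>B. ?k @ q = p @ ?k"
    proof (rule ccontr)
      assume "\<not> (\<exists>q\<in>B. ?k @ q = p @ ?k)"
      then have "(\<Sum>q\<in>B. if ?k @ q = p @ ?k then c q else 0) = 0" by (intro sum.neutral) simp
      with nz show False by blast
    qed
    then obtain q where "q \<in> B" "?k @ q = p @ ?k" by blast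
    moreover have "length p \<le> length ?k" using C(3) by (cases C) (simp_all add: length_iter k_def)
    ultimately obtain r where "?k = p @ r" by (auto simp: append_eq_append_conv2)
    then show ?thesis using closed_prefix_iter[OF C _ \<open>?k = p @ r\<close>] B(2) p by blast
  qed
  have inj: "inj (iter C)" using iter_inj[OF C(3)] by (auto simp: inj_on_def)
  have im: "B = iter C ` (iter C -` B)" using ex by auto
  have fin: "finite (iter C -` B)" by (rule finite_vimageI[OF B(1) inj])
  have "(\<Sum>p\<in>iter C ` (iter C -` B). scal (c p) * path_op v p) = (\<Sum>a\<in>iter C -` B. scal (c (iter C a)) * path_op v (iter C a))"
    by (simp only: sum.reindex[OF inj_on_subset[OF inj subset_UNIV]] o_def)
  then have "z * path_op v (iter C N) = (\<Sum>a\<in>iter C -` B. scal (c (iter C a)) * path_op v (iter C a))"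
    using eq im by simp
  with fin show ?thesis by (intro exI[of _ N] exI[of _ "iter C -` B"] exI[of _ "\<lambda>a. c (iter C a)"] conjI)
qed

text \<open>
  By \<open>central_on_cycle\<close>, \<open>z C\<^sup>N = \<Sum> c\<^sub>a C\<^sup>a\<close>.  Let \<open>s\<close> be a long path from the range of the exit \<open>e\<close>.  All
  paths in \<open>z C\<^sup>N e s = C\<^sup>N e (z s)\<close> begin with \<open>C\<^sup>N e\<close>, while those in \<open>\<Sum> c\<^sub>a C\<^sup>a e s\<close> begin with
  \<open>C\<^sup>a e\<close>.  So only \<open>a = N\<close> contributes, and cancelling \<open>C\<^sup>N\<close> shows that \<open>z v\<close> is \<open>c\<^sub>N v\<close>.
\<close>

lemma scalar_at_exit:
  assumes z: "z \<in> Z" and C: "awalk v C v" "distinct (map (tail G) C)" "C \<noteq> []"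
    and e: "e \<in> arcs G" "tail G e = v" "e \<noteq> hd C"
  shows "\<exists>c. z * vertex_op v = scal c * vertex_op v"
proof -
  obtain N A c where A: "finite A" "z * path_op v (iter C N) = (\<Sum>a\<in>A. scal (c a) * path_op v (iter C a))"
    using central_on_cycle[OF z C] by blast
  obtain M where M: "\<forall>u q y. awalk u q y \<longrightarrow> long M q y \<longrightarrow> z * path_op u q \<in> real_span y"
    using leavitt_ops_real[OF Z_leavitt_ops[OF z]] by blast
  let ?x = "head G e"
  obtain s y where s: "awalk ?x s y" "long M s y" using long_walk_exists[of ?x M] e(1) by auto
  then have "z * path_op ?x s \<in> real_span y" using M by blast
  from real_span_from[OF this Z_vertex_path[OF z]] obtain B d where B: "finite B" "\<forall>p\<in>B. awalk ?x p y \<and> d p \<noteq> 0"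
    "z * path_op ?x s = (\<Sum>p\<in>B. scal (d p) * path_op ?x p)" by blast
  have w: "awalk v (iter C a @ e # p) y" if "awalk ?x p y" for a p
    using awalk_iter[OF C(1), of a] that e by (auto simp: awalk_Cons_iff)
  have split: "path_op v (iter C a @ e # p) = path_op v (iter C a) * (edge_op e * path_op ?x p)" for a p
    using path_op_append[OF awalk_iter[OF C(1)], of a "e # p"] path_op_Cons[of e p] e(2) by simp
  have "(\<Sum>a\<in>A. scal (c a) * path_op v (iter C a @ e # s)) = z * path_op v (iter C N) * (edge_op e * path_op ?x s)"
    unfolding A(2) sum_distrib_right split by (simp only: mult.assoc)
  also have "\<dots> = path_op v (iter C N) * (edge_op e * (z * path_op ?x s))"
  proof -
    have "edge_op e * z = z * edge_op e" using Z_path(1)[OF z arc_implies_awalk[OF e(1)]]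
      by (simp add: path_op_Cons)
    then have "path_op v (iter C N) * (edge_op e * (z * path_op ?x s)) = path_op v (iter C N) * z * (edge_op e * path_op ?x s)"
      by (simp only: mult.assoc[symmetric])
    then show ?thesis using Z_path(1)[OF z awalk_iter[OF C(1)], of N] by simp
  qed
  also have "\<dots> = (\<Sum>p\<in>B. scal (d p) * path_op v (iter C N @ e # p))"
    unfolding B(3) split sum_distrib_left by (simp only: scal_commL)
  finally have eq: "(\<Sum>a\<in>A. scal (c a) * path_op v (iter C a @ e # s)) = (\<Sum>p\<in>B. scal (d p) * path_op v (iter C N @ e # p))" .
  have zero: "c b = 0" if b: "b \<in> A" "b \<noteq> N" for b
  proof -
    have "c b = (\<Sum>a\<in>A. if iter C a @ e # s = iter C b @ e # s then c a else 0)"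
    proof -
      have "(\<Sum>a\<in>A. if iter C a @ e # s = iter C b @ e # s then c a else 0) = (\<Sum>a\<in>A. if a = b then c a else 0)"
      proof (intro sum.cong refl)
        fix a
        have "iter C a @ e # s = iter C b @ e # s \<longleftrightarrow> a = b" using iter_inj[OF C(3), of a b] by auto
        then show "(if iter C a @ e # s = iter C b @ e # s then c a else 0) = (if a = b then c a else 0)"
          by simp
      qed
      then show ?thesis using A(1) b(1) by simp
    qed
    also have "\<dots> = coef v (iter C b @ e # s) (\<Sum>a\<in>A. scal (c a) * path_op v (iter C a @ e # s))"
      by (rule coef_path_sum[symmetric]) (rule w[OF s(1)])+
    also have "\<dots> = (\<Sum>p\<in>B. if iter C N @ e # p = iter C b @ e # s then d p else 0)"
      unfolding eq by (rule coef_path_sum[OF w w[OF s(1)]]) (use B(2) in blast)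
    also have "\<dots> = 0"
    proof (intro sum.neutral ballI)
      fix p
      have "iter C N @ e # p \<noteq> iter C b @ e # s" using exit_position_unique[OF C(3) e(3)] b(2) by blast
      then show "(if iter C N @ e # p = iter C b @ e # s then d p else 0) = 0" by simp
    qed
    finally show ?thesis .
  qed
  define c' where "c' = (if N \<in> A then c N else 0)"
  have "z * path_op v (iter C N) = (\<Sum>a\<in>A. if a = N then scal (c N) * path_op v (iter C N) else 0)"
    unfolding A(2) by (intro sum.cong) (auto simp: zero)
  also have "\<dots> = scal c' * path_op v (iter C N)" using A(1) by (simp add: c'_def)
  finally have *: "z * path_op v (iter C N) = scal c' * path_op v (iter C N)" .
  have PSP: "gpath_op v (iter C N) * path_op v (iter C N) = vertex_op v"
    by (rule ghost_path_path[OF awalk_iter[OF C(1)]])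
  have "z * vertex_op v = gpath_op v (iter C N) * (z * path_op v (iter C N))"
  proof -
    have "gpath_op v (iter C N) * (z * path_op v (iter C N)) = z * (gpath_op v (iter C N) * path_op v (iter C N))"
      by (simp only: mult.assoc[symmetric] Z_path(2)[OF z awalk_iter[OF C(1)]])
    then show ?thesis by (simp only: PSP)
  qed
  also have "\<dots> = scal c' * vertex_op v" unfolding * scal_commL PSP ..
  finally show ?thesis by blast
qed

text \<open>
  At a sink the vertex counts as a long path, and it is the only path from the sink to itself.
\<close>

lemma scalar_at_sink:
  assumes z: "z \<in> Z" and v: "v \<in> verts G" "out_arcs G v = {}"
  shows "\<exists>c. z * vertex_op v = scal c * vertex_op v"
proof -
  have "awalk v [] v" using v by (simp add: awalk_Nil_iff)
  then have "z * path_op v [] \<in> real_span v" using leavitt_ops_real[OF Z_leavitt_ops[OF z]] v(2)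
    unfolding long_def by blast
  from real_span_from[OF this Z_vertex_path[OF z]] obtain B c where B: "finite B" "\<forall>p\<in>B. awalk v p v \<and> c p \<noteq> 0"
    "z * path_op v [] = (\<Sum>p\<in>B. scal (c p) * path_op v p)" by blast
  have "B \<subseteq> {[]}"
  proof
    fix p assume "p \<in> B"
    then have "awalk v p v" using B(2) by blast
    then show "p \<in> {[]}" using v(2) by (cases p) (auto simp: awalk_Cons_iff out_arcs_def)
  qed
  then consider "B = {}" | "B = {[]}" by blast
  then show ?thesis
  proof cases
    case 1 then show ?thesis using B(3) by (intro exI[of _ 0]) simp
  next
    case 2 then show ?thesis using B(3) by (intro exI[of _ "c []"]) simp
  qed
qed

section \<open>The diagonal embedding\<close>

definition phi :: "'a set \<Rightarrow> ('a, 'b, 'f) operator \<Rightarrow> ('a, 'b, 'f) operator" where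
  "phi H T = (\<Sum>(u, p)\<in>arrival_paths G H. path_op u p * T * gpath_op u p)"

lemma arrivalD: "(u, p) \<in> arrival_paths G H \<Longrightarrow> \<exists>w\<in>H. awalk u p w"
  by (auto simp: arrival_paths_def)

lemma arrival_from_inside:
  assumes "H \<subseteq> verts G" "u \<in> H"
  shows "(u, p) \<in> arrival_paths G H \<longleftrightarrow> p = []"
  using assms by (cases p) (auto simp: arrival_paths_def awalk_Cons_iff awalk_Nil_iff)

lemma arrival_Cons:
  assumes "e \<in> arcs G" "tail G e \<notin> H"
  shows "(u, e # p) \<in> arrival_paths G H \<longleftrightarrow> u = tail G e \<and> (head G e, p) \<in> arrival_paths G H"
  using assms by (auto simp: arrival_paths_def awalk_Cons_iff)

lemma arrival_tail: "(u, f # p) \<in> arrival_paths G H \<Longrightarrow> u = tail G f"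
  by (auto simp: arrival_paths_def awalk_Cons_iff)

lemma vertex_phi: "vertex_op w * phi H T = (\<Sum>(u, p)\<in>arrival_paths G H. if u = w then path_op u p * T * gpath_op u p else 0)"
proof -
  have "vertex_op w * phi H T = (\<Sum>(u, p)\<in>arrival_paths G H. (vertex_op w * path_op u p) * T * gpath_op u p)"
    by (simp add: phi_def sum_distrib_left split_def mult.assoc)
  also have "\<dots> = (\<Sum>(u, p)\<in>arrival_paths G H. if u = w then path_op u p * T * gpath_op u p else 0)"
    by (intro sum.cong) (auto simp: vertex_path)
  finally show ?thesis .
qed

lemma phi_vertex: "phi H T * vertex_op w = vertex_op w * phi H T"
proof -
  have "phi H T * vertex_op w = (\<Sum>(u, p)\<in>arrival_paths G H. path_op u p * T * (gpath_op u p * vertex_op w))"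
    by (simp add: phi_def sum_distrib_right split_def mult.assoc)
  also have "\<dots> = (\<Sum>(u, p)\<in>arrival_paths G H. if u = w then path_op u p * T * gpath_op u p else 0)"
    by (intro sum.cong) (auto simp: ghost_path_vertex)
  finally show ?thesis by (simp add: vertex_phi)
qed

text \<open>
  The only arrival path from a vertex in \<open>H\<close> is the vertex itself.
\<close>

lemma phi_inside:
  assumes H: "hereditary G H" "finitary G H" and w: "w \<in> H" and T: "T \<in> central_ops H"
  shows "vertex_op w * phi H T = vertex_op w * T"
proof -
  have iff: "(w, p) \<in> arrival_paths G H \<longleftrightarrow> p = []" for p
    by (rule arrival_from_inside[OF hereditary_verts[OF H(1)] w])
  have "vertex_op w * phi H T = (\<Sum>(u, p)\<in>{(w, [])}. path_op u p * T * gpath_op u p)"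
    unfolding vertex_phi
  proof (rule sum.mono_neutral_cong_right)
    show "finite (arrival_paths G H)" using H(2) by (simp add: finitary_def)
    show "{(w, [])} \<subseteq> arrival_paths G H" by (simp add: iff)
    show "\<forall>i\<in>arrival_paths G H - {(w, [])}. (case i of (u, p) \<Rightarrow> if u = w then path_op u p * T * gpath_op u p else 0) = 0"
    proof
      fix i assume *: "i \<in> arrival_paths G H - {(w, [])}"
      obtain u p where i: "i = (u, p)" by (cases i)
      with * iff[of p] have "u \<noteq> w" by auto
      then show "(case i of (u, p) \<Rightarrow> if u = w then path_op u p * T * gpath_op u p else 0) = 0"
        by (simp add: i)
    qed
  qed simp
  also have "\<dots> = vertex_op w * (T * vertex_op w)" by (simp add: mult.assoc)
  also have "\<dots> = vertex_op w * T" unfolding central_opsD(2)[OF T sub_ops_vertex[OF w], symmetric]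
    by (simp add: vertex_vertex flip: mult.assoc)
  finally show ?thesis .
qed

lemma phi_outside: "(\<And>p x. x \<in> H \<Longrightarrow> \<not> awalk w p x) \<Longrightarrow> vertex_op w * phi H T = 0"
  unfolding vertex_phi
proof (intro sum.neutral ballI)
  fix i assume *: "\<And>p x. x \<in> H \<Longrightarrow> \<not> awalk w p x" "i \<in> arrival_paths G H"
  obtain u p where i: "i = (u, p)" by (cases i)
  with arrivalD[of u p H] * have "u \<noteq> w" by blast
  then show "(case i of (u, p) \<Rightarrow> if u = w then path_op u p * T * gpath_op u p else 0) = 0" by (simp add: i)
qed

text \<open>
  With \<open>v\<close> the source of \<open>e\<close>, write \<open>e\<^sup>* x = e\<^sup>* x v = \<Sum> e\<^sup>* x f f\<^sup>* = \<Sum> e\<^sup>* f x f\<^sup>*\<close>; only the term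
  with \<open>f = e\<close> survives.
\<close>

lemma commutes_with_ghost:
  assumes V: "\<And>v. vertex_op v * x = x * vertex_op v" and e: "e \<in> arcs G"
    and E: "\<And>f. f \<in> out_arcs G (tail G e) \<Longrightarrow> edge_op f * x = x * edge_op f"
  shows "ghost_op e * x = x * ghost_op e"
proof -
  let ?v = "tail G e"
  have ne: "out_arcs G ?v \<noteq> {}" using e by auto
  have "ghost_op e * x = ghost_op e * (vertex_op ?v * x)" by (simp flip: mult.assoc)
  also have "\<dots> = ghost_op e * (x * vertex_op ?v)" by (simp only: V)
  also have "\<dots> = (\<Sum>f\<in>out_arcs G ?v. ghost_op e * (x * edge_op f) * ghost_op f)"
    by (subst CK2[OF ne]) (simp add: sum_distrib_left mult.assoc)
  also have "\<dots> = (\<Sum>f\<in>out_arcs G ?v. (ghost_op e * edge_op f) * x * ghost_op f)"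
  proof (intro sum.cong refl)
    fix f assume "f \<in> out_arcs G ?v"
    then have "x * edge_op f = edge_op f * x" using E by metis
    then show "ghost_op e * (x * edge_op f) * ghost_op f = ghost_op e * edge_op f * x * ghost_op f"
      by (simp only: mult.assoc)
  qed
  also have "\<dots> = (\<Sum>f\<in>out_arcs G ?v. if e = f then vertex_op (head G e) * x * ghost_op e else 0)"
    by (intro sum.cong) (auto simp: ghost_edge e)
  also have "\<dots> = x * (vertex_op (head G e) * ghost_op e)"
    using e by (simp add: finite_out_arcs) (simp only: V mult.assoc edge_ends)
  finally show ?thesis by simp
qed

lemma central_ops_generators:
  assumes H: "hereditary G H" and x: "x \<in> sub_ops H" and V: "\<And>v. vertex_op v * x = x * vertex_op v"
    and E: "\<And>e. e \<in> arcs G \<Longrightarrow> tail G e \<in> H \<Longrightarrow> edge_op e * x = x * edge_op e"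
  shows "x \<in> central_ops H"
proof (rule central_opsI[OF x])
  fix a assume "a \<in> sub_ops H"
  then show "a * x = x * a"
  proof induction
    case (sub_ops_mult S T)
    have "S * T * x = S * (T * x)" by (simp only: mult.assoc)
    also have "\<dots> = (S * x) * T" by (simp only: sub_ops_mult.IH(2) mult.assoc)
    also have "\<dots> = x * (S * T)" by (simp only: sub_ops_mult.IH(1)) (simp only: mult.assoc)
    finally show ?case .
  next
    case (sub_ops_scal T c) then show ?case by (simp only: scal_commL mult.assoc)
  next
    case (sub_ops_ghost e)
    then have e: "e \<in> arcs G" "tail G e \<in> H" by (simp_all add: arcs_between_def)
    then have "edge_op f * x = x * edge_op f" if "f \<in> out_arcs G (tail G e)" for f using E that by simp
    from commutes_with_ghost[OF V e(1) this] show ?case .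
  qed (auto simp: V E arcs_between_def distrib_left distrib_right)
qed

lemma central_ops_edge: "T \<in> central_ops H \<Longrightarrow> hereditary G H \<Longrightarrow> e \<in> arcs G \<Longrightarrow> tail G e \<in> H \<Longrightarrow> edge_op e * T = T * edge_op e"
  by (intro central_opsD(2) sub_ops_edge hereditary_arcs_between)

text \<open>
  Let \<open>e\<close> be an arc.  If its source lies in \<open>H\<close>, only vertices occur as arrival paths and the claim
  is that \<open>T\<close> commutes with \<open>e\<close>.  Otherwise \<open>p \<mapsto> e p\<close> is a bijection from the arrival paths from the
  range of \<open>e\<close> to those that begin with \<open>e\<close>: the former contribute \<open>(e p) T p\<^sup>*\<close> to the product with
  \<open>e\<close> on the left, the latter the same elements to the product with \<open>e\<close> on the right.
\<close>

lemma phi_central: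
  assumes H: "hereditary G H" "finitary G H" and T: "T \<in> central_ops H"
  shows "phi H T \<in> Z"
proof (rule central_ops_generators[OF hereditary_all])
  have "T \<in> leavitt_ops" using central_opsD(1)[OF T] sub_ops_subset[OF hereditary_verts[OF H(1)]] by blast
  then show "phi H T \<in> sub_ops (verts G)" unfolding phi_def
    by (intro sub_ops_sum, clarify, intro sub_ops_mult; simp add: sub_ops_verts) (auto dest!: arrivalD intro: leavitt_ops_path)
  show "vertex_op v * phi H T = phi H T * vertex_op v" for v by (rule phi_vertex[symmetric])
  fix e assume e: "e \<in> arcs G"
  show "edge_op e * phi H T = phi H T * edge_op e"
  proof (cases "tail G e \<in> H")
    case True
    then have h: "head G e \<in> H" using hereditary_arc[OF H(1) e] by simp
    have "edge_op e * phi H T = edge_op e * (vertex_op (head G e) * phi H T)" by (simp flip: mult.assoc)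
    also have "\<dots> = edge_op e * T" unfolding phi_inside[OF H h T] by (simp flip: mult.assoc)
    also have "\<dots> = T * (vertex_op (tail G e) * edge_op e)" using central_ops_edge[OF T H(1) e True] by simp
    also have "\<dots> = vertex_op (tail G e) * T * edge_op e" using central_opsD(2)[OF T sub_ops_vertex[OF True]]
      by (simp add: mult.assoc)
    also have "\<dots> = phi H T * (vertex_op (tail G e) * edge_op e)"
      unfolding phi_inside[OF H True T, symmetric] by (simp only: phi_vertex[symmetric] mult.assoc)
    finally show ?thesis by simp
  next
    case False
    have "edge_op e * phi H T = (\<Sum>(u, p)\<in>arrival_paths G H. (edge_op e * (vertex_op (head G e) * path_op u p)) * T * gpath_op u p)"
      by (simp add: phi_def sum_distrib_left split_def flip: mult.assoc)
    also have "\<dots> = (\<Sum>(u, p)\<in>arrival_paths G H. if u = head G e then path_op (tail G e) (e # p) * T * gpath_op (head G e) p else 0)"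
      by (intro sum.cong) (auto simp: vertex_path path_op_Cons)
    also have "\<dots> = (\<Sum>(u, p)\<in>{(u, p) \<in> arrival_paths G H. u = head G e}. path_op (tail G e) (e # p) * T * gpath_op (head G e) p)"
      using H(2) by (intro sum.mono_neutral_cong_right) (auto simp: finitary_def split: if_splits)
    also have "\<dots> = (\<Sum>(u, p)\<in>{(u, p) \<in> arrival_paths G H. p \<noteq> [] \<and> hd p = e}. path_op u p * T * gpath_op (head G e) (tl p))"
      by (rule sum.reindex_bij_witness[of _ "\<lambda>(u, p). (head G e, tl p)" "\<lambda>(u, p). (tail G e, e # p)"])
        (auto simp: neq_Nil_conv arrival_Cons[OF e False] dest: arrival_tail)
    also have "\<dots> = (\<Sum>(u, p)\<in>arrival_paths G H. path_op u p * T * (gpath_op u p * edge_op e))"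
    proof (intro sum.mono_neutral_cong_left)
      show "finite (arrival_paths G H)" using H(2) by (simp add: finitary_def)
      have *: "gpath_op u p * edge_op e = (if p \<noteq> [] \<and> hd p = e then gpath_op (head G e) (tl p) else 0)"
        if "(u, p) \<in> arrival_paths G H" for u p
      proof (cases p)
        case Nil
        then have "u \<noteq> tail G e" using that False by (auto simp: arrival_paths_def awalk_Nil_iff)
        then show ?thesis using Nil by (simp add: vertex_edge)
      next
        case (Cons f q)
        then have f: "f \<in> arcs G" "u = tail G f" "\<exists>w. awalk (head G f) q w"
          using arrivalD[OF that] by (auto simp: awalk_Cons_iff)
        then show ?thesis by (auto simp: Cons gpath_op_Cons ghost_edge mult.assoc ghost_path_vertex)
      qed
      show "\<forall>i\<in>arrival_paths G H - {(u, p) \<in> arrival_paths G H. p \<noteq> [] \<and> hd p = e}.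
          (case i of (u, p) \<Rightarrow> path_op u p * T * (gpath_op u p * edge_op e)) = 0"
        by (auto simp: * simp del: gpath_op_Nil split: if_splits)
      show "(case i of (u, p) \<Rightarrow> path_op u p * T * gpath_op (head G e) (tl p)) = (case i of (u, p) \<Rightarrow> path_op u p * T * (gpath_op u p * edge_op e))"
        if "i \<in> {(u, p) \<in> arrival_paths G H. p \<noteq> [] \<and> hd p = e}" for i
        using that by (cases i) (simp add: *)
    qed auto
    also have "\<dots> = phi H T * edge_op e" by (simp add: phi_def sum_distrib_right split_def mult.assoc)
    finally show ?thesis .
  qed
qed

text \<open>
  So the diagonal embedding is a section of the restriction \<open>z \<mapsto> 1\<^sub>H z\<close> to central elements.  This
  reduces \<open>Z(L(H))\<close> to \<open>Z(L(G))\<close>.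
\<close>

lemma unit_phi:
  assumes H: "hereditary G H" "finitary G H" and T: "T \<in> central_ops H"
  shows "unit_of H * phi H T = T"
proof -
  have "unit_of H * phi H T = unit_of H * T"
    unfolding unit_of_def sum_distrib_right by (intro sum.cong refl phi_inside assms)
  then show ?thesis using sub_ops_unit[OF hereditary_finite[OF H(1)] central_opsD(1)[OF T]] by simp
qed

lemma unit_comm: "z \<in> Z \<Longrightarrow> unit_of H * z = z * unit_of H"
  unfolding unit_of_def sum_distrib_left sum_distrib_right by (intro sum.cong refl Z_vertex)

lemma restrict_central:
  assumes H: "hereditary G H" and z: "z \<in> Z"
  shows "unit_of H * z \<in> central_ops H"
proof (rule central_opsI)
  let ?o = "unit_of H"
  have fin: "finite H" by (rule hereditary_finite[OF H])
  have oo: "?o * ?o = ?o"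
    unfolding unit_of_def[of H] sum_distrib_right[of _ H]
    by (intro sum.cong refl) (use unit_of_vertex(2)[OF fin] in \<open>simp add: unit_of_def\<close>)
  have "?o * z = ?o * z * ?o" using unit_comm[OF z, of H] oo by (metis mult.assoc)
  then show "?o * z \<in> sub_ops H" using corner_in_sub_ops[OF H Z_leavitt_ops[OF z]] by simp
  fix a assume a: "a \<in> sub_ops H"
  have a1: "a * ?o = a" "?o * a = a" using sub_ops_unit[OF fin a] by auto
  have az: "a * z = z * a" using Z_comm[OF z] a sub_ops_subset[OF hereditary_verts[OF H]] by blast
  have "a * (?o * z) = a * ?o * z" by (simp only: mult.assoc)
  also have "\<dots> = z * (?o * a)" unfolding a1 by (rule az)
  also have "\<dots> = ?o * z * a" unfolding unit_comm[OF z] by (simp only: mult.assoc)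
  finally show "a * (?o * z) = ?o * z * a" .
qed

lemma Z_eq_0I: "z \<in> Z \<Longrightarrow> (\<And>v. v \<in> verts G \<Longrightarrow> z * vertex_op v = 0) \<Longrightarrow> z = 0"
proof -
  assume z: "z \<in> Z" "\<And>v. v \<in> verts G \<Longrightarrow> z * vertex_op v = 0"
  have "z = z * unit_of (verts G)" using sub_ops_unit[OF finite_verts] central_opsD(1)[OF z(1)] by simp
  also have "\<dots> = 0" unfolding unit_of_def sum_distrib_left by (intro sum.neutral ballI z(2))
  finally show ?thesis .
qed

lemma vanishes_on_unit: "(\<And>u. u \<in> H \<Longrightarrow> z * vertex_op u = 0) \<Longrightarrow> z * unit_of H = 0"
  unfolding unit_of_def sum_distrib_left by (intro sum.neutral) blast

end

section \<open>Minimal hereditary subsets and cycles\<close>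

context fin_digraph
begin

lemma hereditary_perp: "hereditary G (perp G X)"
  unfolding hereditary_def
proof (intro conjI ballI allI impI)
  show "perp G X \<subseteq> verts G" by (auto simp: perp_def)
  fix w p x assume w: "w \<in> perp G X" "awalk w p x"
  then have "\<not> awalk x q y" if "y \<in> X" for q y
    using that awalk_appendI[OF w(2)] w(1) unfolding perp_def by blast
  then show "x \<in> perp G X" using awalk_last_in_verts[OF w(2)] by (auto simp: perp_def)
qed

text \<open>
  The double perp consists of the vertices from which \<open>X\<close> cannot be missed: wherever a walk goes, it
  can be continued to \<open>X\<close>.
\<close>

lemma in_perp_perp:
  "u \<in> perp G (perp G X) \<longleftrightarrow> u \<in> verts G \<and> (\<forall>p y. awalk u p y \<longrightarrow> (\<exists>q. \<exists>w\<in>X. awalk y q w))"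
  unfolding perp_def using awalk_last_in_verts by blast

text \<open>
  The descendants of \<open>w\<close> form a hereditary subset of \<open>W\<close>, which by minimality is \<open>W\<close>.
\<close>

lemma minimal_hereditary_connected:
  assumes "minimal_hereditary G W" "w \<in> W" "x \<in> W"
  shows "\<exists>p. awalk w p x"
proof -
  have W: "hereditary G W" using assms(1) by (simp add: minimal_hereditary_def)
  let ?D = "{x. \<exists>p. awalk w p x}"
  have wv: "w \<in> verts G" using W assms(2) by (auto simp: hereditary_def)
  have "hereditary G ?D" by (auto simp: hereditary_def dest: awalk_last_in_verts awalk_appendI)
  moreover have "?D \<subseteq> W" using W assms(2) by (auto simp: hereditary_def)
  moreover have "w \<in> ?D" using wv by (auto simp: awalk_Nil_iff intro: exI[of _ "[]"])
  ultimately have "?D = W" using assms(1) unfolding minimal_hereditary_def by blast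
  then show ?thesis using assms(3) by blast
qed

lemma minimal_hereditary_disjoint:
  assumes "minimal_hereditary G A" "minimal_hereditary G B" "A \<inter> B \<noteq> {}"
  shows "A = B"
proof -
  have "hereditary G (A \<inter> B)" using assms(1,2) by (auto simp: minimal_hereditary_def hereditary_def)
  then show ?thesis using assms unfolding minimal_hereditary_def by (metis inf_le1 inf_le2)
qed

lemma reaches_minimal_hereditary:
  assumes "v \<in> verts G"
  shows "\<exists>X w p. minimal_hereditary G X \<and> w \<in> X \<and> awalk v p w"
proof -
  let ?D = "{x. \<exists>p. awalk v p x}"
  let ?F = "{X. hereditary G X \<and> X \<noteq> {} \<and> X \<subseteq> ?D}"
  have "hereditary G ?D" by (auto simp: hereditary_def dest: awalk_last_in_verts awalk_appendI)
  moreover have "v \<in> ?D" using assms by (auto simp: awalk_Nil_iff intro: exI[of _ "[]"])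
  ultimately have "?D \<in> ?F" by blast
  have "?F \<subseteq> Pow (verts G)" by (auto simp: hereditary_def)
  then have "finite ?F" using finite_verts finite_subset by blast
  from finite_has_minimal2[OF this \<open>?D \<in> ?F\<close>]
  obtain X where X: "X \<in> ?F" "\<forall>Y\<in>?F. Y \<subseteq> X \<longrightarrow> X = Y" by blast
  then have "minimal_hereditary G X" unfolding minimal_hereditary_def by blast
  then show ?thesis using X(1) by blast
qed

text \<open>
  In a closed walk the ranges of the arcs are the sources, cyclically shifted.
\<close>

lemma distinct_tails:
  assumes "awalk u p u" "p \<noteq> []"
  shows "distinct (tl (awalk_verts u p)) \<longleftrightarrow> distinct (map (tail G) p)"
proof -
  obtain e q where p: "p = e # q" using assms(2) by (cases p) auto
  have "tl (awalk_verts u p) = map (tail G) q @ [u]"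
    using assms(1)
      by (simp add: p awalk_Cons_iff awalk_verts_conv) (metis awalk_conv awalk_verts_conv last_snoc last.simps)
  then show ?thesis using assms(1) by (auto simp: p awalk_Cons_iff)
qed

lemma cycle_iff: "cycle C \<longleftrightarrow> (\<exists>v. awalk v C v \<and> distinct (map (tail G) C) \<and> C \<noteq> [])"
  unfolding cycle_def using distinct_tails by blast

lemma cycle_rotate:
  assumes "cycle C" "v \<in> cycle_verts G C"
  obtains C' where "awalk v C' v" "distinct (map (tail G) C')" "C' \<noteq> []" "set C' = set C" "length C' = length C"
proof -
  obtain u where u: "awalk u C u" "distinct (map (tail G) C)" using assms(1) by (auto simp: cycle_iff)
  obtain e where e: "e \<in> set C" "v = tail G e" using assms(2) by (auto simp: cycle_verts_def)
  then obtain q r where C: "C = q @ e # r" by (meson split_list)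
  show ?thesis
  proof
    have "awalk u q v" "awalk v (e # r) u" using u(1) e(2) unfolding C by (auto simp: awalk_Cons_iff)
    then show "awalk v ((e # r) @ q) v" by (rule awalk_appendI[rotated])
    show "distinct (map (tail G) ((e # r) @ q))" using u(2) by (auto simp: C)
  qed (auto simp: C)
qed

lemma cycle_connected:
  assumes "cycle C" "u \<in> cycle_verts G C" "v \<in> cycle_verts G C"
  shows "\<exists>p. awalk u p v"
proof -
  obtain C' where C': "awalk u C' u" "set C' = set C" using cycle_rotate[OF assms(1,2)] by metis
  obtain e where "e \<in> set C'" "v = tail G e" using assms(3) C'(2) by (auto simp: cycle_verts_def)
  then obtain q r where "C' = q @ e # r" by (meson split_list)
  then show ?thesis using C'(1) \<open>v = tail G e\<close> by (auto simp: awalk_Cons_iff)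
qed

lemma cycle_head: "cycle C \<Longrightarrow> e \<in> set C \<Longrightarrow> head G e \<in> cycle_verts G C"
proof -
  assume C: "cycle C" and e: "e \<in> set C"
  obtain C' where C': "awalk (tail G e) C' (tail G e)" "distinct (map (tail G) C')" "C' \<noteq> []" "set C' = set C"
    using cycle_rotate[OF C, of "tail G e"] e by (auto simp: cycle_verts_def)
  then obtain f r where f: "C' = f # r" by (cases C') auto
  have "tail G f = tail G e" "tail G f \<notin> tail G ` set r" "e = f \<or> e \<in> set r"
    using C'(1,2,4) e f by (auto simp: awalk_Cons_iff)
  then have "f = e" by (metis image_eqI)
  then have w: "awalk (head G e) r (tail G e)" using C'(1) f by (auto simp: awalk_Cons_iff)
  have "head G e \<in> tail G ` set C'"
    using w f \<open>f = e\<close> by (cases r) (auto simp: awalk_Cons_iff awalk_Nil_iff)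
  then show ?thesis using C'(4) by (simp add: cycle_verts_def)
qed

lemma cycle_arcs: "cycle C \<Longrightarrow> e \<in> set C \<Longrightarrow> e \<in> arcs G"
  by (auto simp: cycle_iff awalk_def)

lemma closed_walk_to_cycle:
  assumes "awalk x (e # r) x"
  obtains C where "cycle C" "x \<in> cycle_verts G C" "set C \<subseteq> set (e # r)"
proof
  let ?q = "awalk_to_apath r"
  have w: "e \<in> arcs G" "x = tail G e" "awalk (head G e) r x" using assms by (auto simp: awalk_Cons_iff)
  have q: "apath (head G e) ?q x" by (rule apath_awalk_to_apath[OF w(3)])
  then have d: "distinct (map (tail G) ?q @ [x])"
    unfolding apath_def
      by (metis awalk_conv awalk_verts_conv append_Nil distinct_singleton last_snoc list.map(1))
  have "awalk x (e # ?q) x" using w q by (auto simp: awalk_Cons_iff apath_def)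
  then show "cycle (e # ?q)" using d w(2) by (auto simp: cycle_iff)
  show "x \<in> cycle_verts G (e # ?q)" using w by (simp add: cycle_verts_def)
  show "set (e # ?q) \<subseteq> set (e # r)" using awalk_to_apath_subset[OF w(3)] by auto
qed

lemma cycle_exit:
  assumes "cycle C" "v \<in> cycle_verts G C" "awalk v p x" "x \<notin> cycle_verts G C"
  shows "\<exists>e\<in>arcs G. e \<notin> set C \<and> tail G e \<in> cycle_verts G C"
  using assms(2,3)
proof (induction p arbitrary: v)
  case Nil then show ?case using assms(4) by (auto simp: awalk_Nil_iff)
next
  case (Cons e p)
  then have e: "e \<in> arcs G" "v = tail G e" "awalk (head G e) p x" by (auto simp: awalk_Cons_iff)
  show ?case
  proof (cases "e \<in> set C")
    case True then show ?thesis using Cons.IH[OF cycle_head[OF assms(1) True] e(3)] by simp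
  next
    case False then show ?thesis using e Cons.prems(1) by blast
  qed
qed

lemma leads_to_exit:
  assumes "cycle C" "cycle_leads_to G C W"
  shows "\<exists>e\<in>arcs G. e \<notin> set C \<and> tail G e \<in> cycle_verts G C"
proof -
  have "cycle_verts G C \<noteq> {}" using assms(1) by (auto simp: cycle_iff cycle_verts_def)
  then obtain v where v: "v \<in> cycle_verts G C" by blast
  then obtain p w where "awalk v p w" "w \<in> W" using assms(2) by (auto simp: cycle_leads_to_def)
  moreover have "w \<notin> cycle_verts G C" using assms(2) \<open>w \<in> W\<close> by (auto simp: cycle_leads_to_def)
  ultimately show ?thesis using cycle_exit[OF assms(1) v] by blast
qed

text \<open>
  Only finitely many paths have no repeated vertex.  So some arrival path visits a vertex twice;
  the part between the visits runs outside \<open>H\<close> and contains a cycle, and the rest of the path leads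
  on to \<open>H\<close>.
\<close>

lemma not_finitary_cycle:
  assumes H: "hereditary G H" "\<not> finitary G H"
  shows "\<exists>C. cycle C \<and> cycle_leads_to G C H"
proof -
  let ?f = "\<lambda>(u, p, w). (u, p)"
  have "\<not> arrival_paths G H \<subseteq> ?f ` {(u, p, w). apath u p w}"
    using H apaths_finite_triple finite_subset finite_imageI unfolding finitary_def by metis
  then obtain u p where up: "(u, p) \<in> arrival_paths G H" "(u, p) \<notin> ?f ` {(u, p, w). apath u p w}" by auto
  then obtain w where w: "w \<in> H" "awalk u p w" by (auto simp: arrival_paths_def)
  have "\<not> apath u p w"
  proof
    assume "apath u p w"
    then have "(u, p) \<in> ?f ` {(u, p, w). apath u p w}" by (intro image_eqI[of _ _ "(u, p, w)"]) auto
    with up(2) show False by blast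
  qed
  then have "\<not> distinct (awalk_verts u p)" using w by (simp add: apath_def)
  from awalk_not_distinct_decomp[OF w(2) this] obtain q r s x where
    d: "p = q @ r @ s" "0 < length r" "awalk x r x" "awalk x s w" by blast
  obtain e r' where r: "r = e # r'" using d(2) by (cases r) auto
  obtain C where C: "cycle C" "x \<in> cycle_verts G C" "set C \<subseteq> set r"
    using closed_walk_to_cycle[of x e r'] d(3) unfolding r by metis
  have "cycle_verts G C \<inter> H = {}"
    using C(3) up(1) d(1) by (auto simp: cycle_verts_def arrival_paths_def)
  moreover have "\<exists>p. \<exists>w\<in>H. awalk v p w" if "v \<in> cycle_verts G C" for v
    using cycle_connected[OF C(1) that C(2)] d(4) w(1) by (meson awalk_appendI)
  ultimately show ?thesis using C(1) by (auto simp: cycle_leads_to_def)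
qed

text \<open>
  A vertex of \<open>W\<close> that is not a sink lies on a cycle inside \<open>W\<close>, because it can be reached again from
  the range of any of its arcs.  If the cycle has no exit, then its vertices have no other descendants
  and make up \<open>W\<close>.
\<close>

lemma minimal_hereditary_cases:
  assumes W: "minimal_hereditary G W"
  obtains (sink) w where "w \<in> W" "out_arcs G w = {}"
  | (exit) C e where "cycle C" "cycle_verts G C \<subseteq> W" "e \<in> arcs G" "e \<notin> set C" "tail G e \<in> cycle_verts G C"
  | (ne) C where "ne_cycle G C" "W = cycle_verts G C"
proof -
  have h: "hereditary G W" "W \<noteq> {}" using W by (auto simp: minimal_hereditary_def)
  then obtain w where w: "w \<in> W" by blast
  show ?thesis
  proof (cases "out_arcs G w = {}")
    case True then show ?thesis using sink w by blast
  next
    case False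
    then obtain e where "e \<in> out_arcs G w" by blast
    then have e: "e \<in> arcs G" "tail G e = w" by simp_all
    then have "head G e \<in> W"
      using h(1) w arc_implies_awalk[OF e(1)] unfolding hereditary_def by blast
    then obtain r where "awalk (head G e) r w" using minimal_hereditary_connected[OF W] w by blast
    then have "awalk w (e # r) w" using e by (simp add: awalk_Cons_iff)
    then obtain C where C: "cycle C" "w \<in> cycle_verts G C" by (rule closed_walk_to_cycle)
    have "cycle_verts G C \<subseteq> W"
      using cycle_connected[OF C(1,2)] h(1) w unfolding hereditary_def by blast
    show ?thesis
    proof (cases "\<exists>e\<in>arcs G. e \<notin> set C \<and> tail G e \<in> cycle_verts G C")
      case True then show ?thesis using exit C(1) \<open>cycle_verts G C \<subseteq> W\<close> by blast
    next
      case False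
      then have "W = cycle_verts G C"
        using cycle_exit[OF C] minimal_hereditary_connected[OF W w] \<open>cycle_verts G C \<subseteq> W\<close> by blast
      then show ?thesis using ne C(1) False by (auto simp: ne_cycle_def)
    qed
  qed
qed

end

section \<open>Central elements on minimal hereditary subsets\<close>

context leavitt_digraph
begin

definition scalar_on :: "('a, 'b, 'f) operator \<Rightarrow> 'a set \<Rightarrow> 'f \<Rightarrow> bool" where
  "scalar_on z W c \<longleftrightarrow> (\<forall>w\<in>W. z * vertex_op w = scal c * vertex_op w)"

lemma vertex_op_neq_0: "v \<in> verts G \<Longrightarrow> vertex_op v \<noteq> 0"
  using coef_path_op[of v "[]" v v "[]" v] coef_simps(1)[of v "[]"] by (auto simp: awalk_Nil_iff)

lemma scalar_on_unique:
  assumes "scalar_on z W c" "scalar_on z W d" "w \<in> W" "w \<in> verts G"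
  shows "c = d"
proof (rule ccontr)
  assume "c \<noteq> d"
  have "scal c * vertex_op w = scal d * vertex_op w" using assms by (auto simp: scalar_on_def)
  then have "scal (c - d) * vertex_op w = 0" by (simp add: scal_diff left_diff_distrib)
  then have "scal (inverse (c - d) * (c - d)) * vertex_op w = 0" by (simp add: scal_mult mult.assoc)
  then show False using \<open>c \<noteq> d\<close> vertex_op_neq_0[OF assms(4)] by simp
qed

lemma scalar_on_minimal:
  assumes "z \<in> Z" "z * vertex_op v = scal c * vertex_op v" "minimal_hereditary G W" "awalk v p w" "w \<in> W"
  shows "scalar_on z W c"
  unfolding scalar_on_def
proof
  fix x assume "x \<in> W"
  then obtain q where "awalk w q x" using minimal_hereditary_connected[OF assms(3,5)] by blast
  with assms(4) have "awalk v (p @ q) x" by auto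
  from scalar_propagates[OF assms(1,2) this] show "z * vertex_op x = scal c * vertex_op x" .
qed

lemma scalar_at_cycle_exit:
  assumes z: "z \<in> Z" and C: "cycle C" "e \<in> arcs G" "e \<notin> set C" "tail G e \<in> cycle_verts G C"
  shows "\<exists>c. z * vertex_op (tail G e) = scal c * vertex_op (tail G e)"
proof -
  obtain C' where C': "awalk (tail G e) C' (tail G e)" "distinct (map (tail G) C')" "C' \<noteq> []" "set C' = set C"
    using cycle_rotate[OF C(1,4)] by metis
  have "e \<noteq> hd C'" using C'(3,4) C(3) by (cases C') auto
  then show ?thesis using scalar_at_exit[OF z C'(1-3) C(2) refl] by simp
qed

text \<open>
  A path from the cycle to \<open>W\<close>, which is disjoint from it, leaves the cycle by an exit.  From there
  the scalar is passed on to \<open>W\<close> and to \<open>W'\<close>.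
\<close>

lemma scalar_of_leads_to:
  assumes z: "z \<in> Z" and C: "cycle C" "cycle_leads_to G C W" "cycle_leads_to G C W'"
    and W: "minimal_hereditary G W" "minimal_hereditary G W'"
  shows "\<exists>c. scalar_on z W c \<and> scalar_on z W' c"
proof -
  obtain e where e: "e \<in> arcs G" "e \<notin> set C" "tail G e \<in> cycle_verts G C" using leads_to_exit[OF C(1,2)]
    by blast
  obtain c where c: "z * vertex_op (tail G e) = scal c * vertex_op (tail G e)"
    using scalar_at_cycle_exit[OF z C(1) e] by blast
  obtain p w p' w' where "awalk (tail G e) p w" "w \<in> W" "awalk (tail G e) p' w'" "w' \<in> W'"
    using C(2,3) e(3) unfolding cycle_leads_to_def by meson
  then show ?thesis using scalar_on_minimal[OF z c W(1)] scalar_on_minimal[OF z c W(2)] by blast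
qed

text \<open>
  If \<open>W\<close> is a cycle without exits that is not finitary, then another cycle leads to it, and that one
  does have exits.
\<close>

lemma scalar_on_minimal_hereditary:
  assumes z: "z \<in> Z" and W: "minimal_hereditary G W" and n: "\<not> (\<exists>C. finitary_ne_cycle G C \<and> W = cycle_verts G C)"
  shows "\<exists>c. scalar_on z W c"
  using W
proof (cases rule: minimal_hereditary_cases)
  case (sink w)
  then have "w \<in> verts G" using W by (auto simp: minimal_hereditary_def hereditary_def)
  then obtain c where "z * vertex_op w = scal c * vertex_op w" using scalar_at_sink[OF z _ sink(2)] by blast
  then show ?thesis using scalar_on_minimal[OF z _ W _ sink(1), of w c "[]"] \<open>w \<in> verts G\<close>
    by (auto simp: awalk_Nil_iff)
next
  case (exit C e)
  then obtain c where c: "z * vertex_op (tail G e) = scal c * vertex_op (tail G e)"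
    using scalar_at_cycle_exit[OF z] by blast
  have "awalk (tail G e) [] (tail G e)" using exit by (simp add: awalk_Nil_iff)
  then show ?thesis using scalar_on_minimal[OF z c W] exit by blast
next
  case (ne C)
  then have "\<not> finitary G W" using n by (auto simp: finitary_ne_cycle_def)
  moreover have "hereditary G W" using W by (simp add: minimal_hereditary_def)
  ultimately obtain D where "cycle D" "cycle_leads_to G D W" using not_finitary_cycle by blast
  then show ?thesis using scalar_of_leads_to[OF z _ _ _ W W] by blast
qed

end

section \<open>A finitary cycle without exits\<close>

text \<open>
  The powers, with integer exponents, of \<open>x\<close> and its inverse \<open>y\<close> in a corner with unit \<open>i\<close>, which is
  the power with exponent 0.
\<close>

definition corner_power :: "'r::ring_1 \<Rightarrow> 'r \<Rightarrow> 'r \<Rightarrow> int \<Rightarrow> 'r" where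
  "corner_power i x y a = (if 0 \<le> a then i * x ^ nat a else i * y ^ nat (- a))"

lemma corner_power_0: "corner_power i x y 0 = i" by (simp add: corner_power_def)

lemma corner_power_succ:
  assumes "i * i = i" "y * i = y" "y * x = i"
  shows "corner_power i x y (a + 1) = corner_power i x y a * x"
proof (cases "0 \<le> a")
  case True
  then have "nat (a + 1) = Suc (nat a)" by simp
  then show ?thesis using True by (simp add: corner_power_def power_Suc2 mult.assoc del: power_Suc)
next
  case False
  define m where "m = nat (- a) - 1"
  have m: "a = - int (Suc m)" using False by (simp add: m_def)
  have yi: "i * y ^ m * i = i * y ^ m" using assms(1,2)
    by (cases m) (simp_all add: power_Suc2 mult.assoc del: power_Suc)
  have "corner_power i x y a * x = i * y ^ m * (y * x)"
  proof -
    have "nat (- a) = Suc m" using m by simp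
    then show ?thesis using False by (simp add: corner_power_def power_Suc2 mult.assoc del: power_Suc)
  qed
  also have "\<dots> = i * y ^ m" by (simp only: assms(3) yi)
  also have "\<dots> = corner_power i x y (a + 1)"
  proof -
    have "a + 1 = - int m" using m by simp
    then show ?thesis by (cases "m = 0") (simp_all add: corner_power_def)
  qed
  finally show ?thesis ..
qed

lemma corner_power_uminus: "corner_power i x y (- a) = corner_power i y x a"
  by (auto simp: corner_power_def)

lemma corner_power_pred:
  assumes "i * i = i" "x * i = x" "x * y = i"
  shows "corner_power i x y (a - 1) = corner_power i x y a * y"
  using corner_power_succ[OF assms, of "- a"] corner_power_uminus[of i x y] corner_power_uminus[of i y x "a - 1"]
    corner_power_uminus[of i y x a] by simp

lemma corner_power_add:
  assumes "i * i = i" "x * i = x" "y * i = y" "x * y = i" "y * x = i"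
  shows "corner_power i x y (a + b) = corner_power i x y a * corner_power i x y b"
proof (induction b rule: int_induct[of _ 0])
  case base
  have "corner_power i x y a * i = corner_power i x y a"
  proof -
    have "i * z ^ n * i = i * z ^ n" if "z * i = z" for z n
      using assms(1) that by (cases n) (simp_all add: power_Suc2 mult.assoc del: power_Suc)
    then show ?thesis using assms(2,3) by (simp add: corner_power_def)
  qed
  then show ?case by (simp add: corner_power_0)
next
  case (step1 b)
  have "a + (b + 1) = a + b + 1" by simp
  then show ?case using step1 by (simp only: corner_power_succ[OF assms(1,3,5)] mult.assoc)
next
  case (step2 b)
  have "a + (b - 1) = a + b - 1" by simp
  then show ?case using step2 by (simp only: corner_power_pred[OF assms(1,2,4)] mult.assoc)
qed

locale ne_cycle_digraph = leavitt_digraph G base_field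
  for G :: "('a, 'b) pre_digraph" and base_field :: "'f::field itself" +
  fixes C :: "'b list"
  assumes ne: "ne_cycle G C"
begin

abbreviation W :: "'a set" where "W \<equiv> cycle_verts G C"

lemma C_cycle: "cycle C" using ne by (simp add: ne_cycle_def)

lemma no_exit: "e \<in> arcs G \<Longrightarrow> tail G e \<in> W \<Longrightarrow> e \<in> set C"
  using ne by (auto simp: ne_cycle_def)

lemma hereditary_W: "hereditary G W"
  unfolding hereditary_def
proof (intro conjI ballI allI impI)
  show "W \<subseteq> verts G" using cycle_arcs[OF C_cycle] by (auto simp: cycle_verts_def)
  show "x \<in> W" if "w \<in> W" "awalk w p x" for w p x
    using that
    by (induction p arbitrary: w) (auto simp: awalk_Nil_iff awalk_Cons_iff intro: cycle_head[OF C_cycle] dest: no_exit)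
qed

lemma out_arcs_W: "e \<in> set C \<Longrightarrow> out_arcs G (tail G e) = {e}"
proof -
  assume e: "e \<in> set C"
  have "inj_on (tail G) (set C)" using C_cycle by (auto simp: cycle_iff distinct_map)
  moreover have "f \<in> set C" if "f \<in> out_arcs G (tail G e)" for f
    using that e no_exit[of f] by (auto simp: cycle_verts_def)
  moreover have "e \<in> out_arcs G (tail G e)" using e cycle_arcs[OF C_cycle] by simp
  ultimately show ?thesis using e by (auto dest: inj_onD simp del: in_out_arcs_conv) (auto dest: inj_onD)
qed

lemma walk_unique:
  "w \<in> W \<Longrightarrow> awalk w p x \<Longrightarrow> awalk w q y \<Longrightarrow> length p = length q \<Longrightarrow> p = q"
proof (induction p arbitrary: w q)
  case (Cons e p)
  then obtain f q' where q: "q = f # q'" by (cases q) auto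
  have *: "e \<in> arcs G" "tail G e = w" "awalk (head G e) p x" "f \<in> arcs G" "tail G f = w" "awalk (head G f) q' y"
    using Cons.prems(2,3) by (auto simp: q awalk_Cons_iff)
  then have "e \<in> set C" using no_exit Cons.prems(1) by blast
  moreover have "f \<in> out_arcs G (tail G e)" using * by simp
  ultimately have "f = e" using out_arcs_W by blast
  moreover have "head G e \<in> W" using cycle_head[OF C_cycle] * no_exit Cons.prems(1) by blast
  ultimately show ?case using Cons.IH[of "head G e" q'] * Cons.prems(4) q by simp
qed simp

text \<open>
  On the cycle the sum in \<open>v = \<Sum> e e\<^sup>*\<close> has a single term.
\<close>

lemma path_ghost_path: "w \<in> W \<Longrightarrow> awalk w p x \<Longrightarrow> path_op w p * gpath_op w p = vertex_op w"
proof (induction p arbitrary: w)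
  case Nil then show ?case by (simp add: vertex_vertex)
next
  case (Cons e p)
  then have e: "e \<in> arcs G" "w = tail G e" "awalk (head G e) p x" by (auto simp: awalk_Cons_iff)
  then have eC: "e \<in> set C" using no_exit Cons.prems(1) by blast
  have "path_op w (e # p) * gpath_op w (e # p) = edge_op e * (path_op (head G e) p * gpath_op (head G e) p) * ghost_op e"
    unfolding e(2) path_op_Cons gpath_op_Cons by (simp only: mult.assoc)
  also have "\<dots> = edge_op e * vertex_op (head G e) * ghost_op e"
    unfolding Cons.IH[OF cycle_head[OF C_cycle eC] e(3)] ..
  also have "\<dots> = vertex_op w" using CK2[of "tail G e"] out_arcs_W[OF eC] by (simp add: e(2))
  finally show ?case .
qed

text \<open>
  Once around the cycle, starting from \<open>w\<close>.  Walks from \<open>w\<close> are determined by their length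
  (\<open>walk_unique\<close>), so there is only one.
\<close>

definition cyc :: "'a \<Rightarrow> 'b list" where
  "cyc w = (SOME p. awalk w p w \<and> length p = length C \<and> distinct (map (tail G) p))"

lemma cyc: assumes "w \<in> W"
  shows "awalk w (cyc w) w" "length (cyc w) = length C" "distinct (map (tail G) (cyc w))" "cyc w \<noteq> []"
proof -
  obtain p where "awalk w p w \<and> length p = length C \<and> distinct (map (tail G) p)"
    using cycle_rotate[OF C_cycle assms] by metis
  then have *: "awalk w (cyc w) w \<and> length (cyc w) = length C \<and> distinct (map (tail G) (cyc w))"
    unfolding cyc_def by (rule someI)
  then show "awalk w (cyc w) w" "length (cyc w) = length C" "distinct (map (tail G) (cyc w))" by auto
  show "cyc w \<noteq> []" using * C_cycle by (auto simp: cycle_iff)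
qed

lemma tail_in_W: "e \<in> set C \<Longrightarrow> tail G e \<in> W" by (simp add: cycle_verts_def)

lemma cyc_shift:
  assumes e: "e \<in> set C"
  obtains r where "cyc (tail G e) = e # r" "cyc (head G e) = r @ [e]"
proof -
  note c = cyc[OF tail_in_W[OF e]]
  obtain f r where fr: "cyc (tail G e) = f # r" using c(4) by (cases "cyc (tail G e)") auto
  have f: "f \<in> arcs G" "tail G f = tail G e" using c(1) by (auto simp: fr awalk_Cons_iff)
  then have "f \<in> out_arcs G (tail G e)" by simp
  then have "f = e" using out_arcs_W[OF e] by blast
  then have walk: "awalk (head G e) (r @ [e]) (head G e)"
    using c(1) f by (auto simp: fr awalk_Cons_iff awalk_Nil_iff)
  note h = cycle_head[OF C_cycle e]
  have "cyc (head G e) = r @ [e]"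
    by (rule walk_unique[OF h cyc(1)[OF h] walk]) (use c(2) cyc(2)[OF h] fr in simp)
  then show ?thesis using that fr \<open>f = e\<close> by blast
qed

definition turn :: "('a, 'b, 'f) operator" where "turn = (\<Sum>w\<in>W. path_op w (cyc w))"
definition unturn :: "('a, 'b, 'f) operator" where "unturn = (\<Sum>w\<in>W. gpath_op w (cyc w))"

lemma finite_W: "finite W" by (simp add: cycle_verts_def)

lemma vertex_turn: "vertex_op u * turn = (if u \<in> W then path_op u (cyc u) else 0)"
proof -
  have "vertex_op u * turn = (\<Sum>w\<in>W. if u = w then path_op w (cyc w) else 0)"
    unfolding turn_def sum_distrib_left by (simp add: vertex_path)
  then show ?thesis using finite_W by simp
qed

lemma turn_vertex: "turn * vertex_op u = (if u \<in> W then path_op u (cyc u) else 0)"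
proof -
  have "turn * vertex_op u = (\<Sum>w\<in>W. if u = w then path_op w (cyc w) else 0)"
    unfolding turn_def sum_distrib_right by (intro sum.cong refl path_vertex cyc)
  then show ?thesis using finite_W by simp
qed

lemma vertex_unturn: "vertex_op u * unturn = (if u \<in> W then gpath_op u (cyc u) else 0)"
proof -
  have "vertex_op u * unturn = (\<Sum>w\<in>W. if u = w then gpath_op w (cyc w) else 0)"
    unfolding unturn_def sum_distrib_left by (intro sum.cong refl vertex_ghost_path cyc)
  then show ?thesis using finite_W by simp
qed

text \<open>
  The products with \<open>e\<close> from either side are the path that runs around the cycle from the source of
  \<open>e\<close> and then through \<open>e\<close> once more.
\<close>

lemma turn_central: "turn \<in> central_ops W"
proof (rule central_ops_generators[OF hereditary_W])
  show "turn \<in> sub_ops W" unfolding turn_def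
    by (rule sub_ops_sum) (rule sub_ops_path[OF hereditary_W _ cyc(1)])
  show "vertex_op v * turn = turn * vertex_op v" for v by (simp add: vertex_turn turn_vertex)
  fix e assume "e \<in> arcs G" "tail G e \<in> W"
  then have e: "e \<in> set C" by (rule no_exit)
  obtain r where r: "cyc (tail G e) = e # r" "cyc (head G e) = r @ [e]" using cyc_shift[OF e] .
  have h: "head G e \<in> W" by (rule cycle_head[OF C_cycle e])
  have er: "awalk (head G e) r (tail G e)" using cyc(1)[OF tail_in_W[OF e]] r(1)
    by (simp add: awalk_Cons_iff)
  have "edge_op e * turn = edge_op e * (vertex_op (head G e) * turn)" by (simp flip: mult.assoc)
  also have "\<dots> = edge_op e * (path_op (head G e) r * edge_op e)"
    using path_op_snoc[OF _ er] \<open>e \<in> arcs G\<close> by (simp add: vertex_turn h r)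
  also have "\<dots> = turn * vertex_op (tail G e) * edge_op e"
    using tail_in_W[OF e] by (simp add: turn_vertex r path_op_Cons mult.assoc)
  also have "\<dots> = turn * edge_op e" by (simp add: mult.assoc)
  finally show "edge_op e * turn = turn * edge_op e" .
qed

lemma turn_unturn: "turn * unturn = unit_of W"
proof -
  have "turn * unturn = (\<Sum>w\<in>W. path_op w (cyc w) * unturn)" by (simp add: turn_def sum_distrib_right)
  also have "\<dots> = (\<Sum>w\<in>W. vertex_op w)"
  proof (intro sum.cong refl)
    fix w assume w: "w \<in> W"
    have "path_op w (cyc w) * unturn = path_op w (cyc w) * vertex_op w * unturn"
      using path_vertex[OF cyc(1)[OF w], of w] by simp
    also have "\<dots> = vertex_op w" using path_ghost_path[OF w cyc(1)[OF w]]
      by (simp add: mult.assoc vertex_unturn w)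
    finally show "path_op w (cyc w) * unturn = vertex_op w" .
  qed
  finally show ?thesis by (simp add: unit_of_def)
qed

lemma unturn_turn: "unturn * turn = unit_of W"
proof -
  have "unturn * turn = (\<Sum>w\<in>W. gpath_op w (cyc w) * turn)" by (simp add: unturn_def sum_distrib_right)
  also have "\<dots> = (\<Sum>w\<in>W. vertex_op w)"
  proof (intro sum.cong refl)
    fix w assume w: "w \<in> W"
    have "gpath_op w (cyc w) * turn = gpath_op w (cyc w) * vertex_op w * turn"
      by (simp add: ghost_path_vertex)
    also have "\<dots> = vertex_op w" using ghost_path_path[OF cyc(1)[OF w]]
      by (simp add: mult.assoc vertex_turn w)
    finally show "gpath_op w (cyc w) * turn = vertex_op w" .
  qed
  finally show ?thesis by (simp add: unit_of_def)
qed

text \<open>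
  The inverse of a central element is central.
\<close>

lemma unturn_central: "unturn \<in> central_ops W"
proof (rule central_opsI)
  show unturn: "unturn \<in> sub_ops W" unfolding unturn_def
    by (rule sub_ops_sum) (rule sub_ops_ghost_path[OF hereditary_W _ cyc(1)])
  fix a assume a: "a \<in> sub_ops W"
  note u = sub_ops_unit[OF finite_W]
  have "a * unturn = unit_of W * a * unturn" using u[OF a] by simp
  also have "\<dots> = unturn * (turn * a) * unturn" unfolding unturn_turn[symmetric] by (simp only: mult.assoc)
  also have "\<dots> = unturn * a * (turn * unturn)" unfolding central_opsD(2)[OF turn_central a, symmetric]
    by (simp only: mult.assoc)
  also have "\<dots> = unturn * a" using u[OF a] by (simp add: turn_unturn mult.assoc)
  finally show "a * unturn = unturn * a" .
qed

end

text \<open>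
  The vertices of \<open>U\<close> can reach the cycle.  In the application \<open>U\<close> is the double perp of its vertex
  set.
\<close>

locale ne_cycle_closure = ne_cycle_digraph G base_field C
  for G :: "('a, 'b) pre_digraph" and base_field :: "'f::field itself" and C +
  fixes U :: "'a set" and v :: 'a
  assumes finitary_W: "finitary G W" and U: "hereditary G U" "finitary G U"
    and W_U: "W \<subseteq> U" and v: "v \<in> W"
    and reach: "\<And>u. u \<in> U \<Longrightarrow> \<exists>p. \<exists>w\<in>W. awalk u p w"
begin

lemma vU: "v \<in> U" using v W_U by blast
lemma finite_U: "finite U" by (rule hereditary_finite[OF U(1)])

text \<open>
  Every vertex of \<open>U\<close> and each of its descendants reach \<open>v\<close>, so that a central element of \<open>L(U)\<close> which
  vanishes at \<open>v\<close> is 0.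
\<close>

lemma central_ops_eqI:
  assumes x: "x \<in> central_ops U" and y: "y \<in> central_ops U" and eq: "vertex_op v * x = vertex_op v * y"
  shows "x = y"
proof -
  let ?d = "x - y"
  have d: "?d \<in> central_ops U" by (rule central_ops_closed(3)[OF x y])
  let ?z = "phi U ?d"
  have z: "?z \<in> Z" by (rule phi_central[OF U d])
  have zv: "?z * vertex_op v = 0"
    using phi_inside[OF U vU d] eq Z_vertex[OF z, of v] by (simp add: right_diff_distrib)
  have "?z * vertex_op u = 0" if u: "u \<in> U" for u
  proof (rule central_vanishes_at[OF z])
    show "u \<in> verts G" using u hereditary_verts[OF U(1)] by blast
    fix q y assume "awalk u q y"
    then have "y \<in> U" by (rule hereditaryD[OF U(1) u])
    then obtain p w where p: "awalk y p w" "w \<in> W" using reach by blast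
    obtain q where "awalk w q v" using cycle_connected[OF C_cycle p(2) v] by blast
    with p(1) have "awalk y (p @ q) v" by auto
    then show "\<exists>p w. awalk y p w \<and> ?z * vertex_op w = 0" using zv by blast
  qed
  then have "unit_of U * ?z = 0" using vanishes_on_unit[of U ?z] unit_comm[OF z, of U] by simp
  then show ?thesis using unit_phi[OF U d] by simp
qed

text \<open>
  The generator that corresponds to \<open>t\<close>: one turn around the cycle, extended by the diagonal
  embedding of \<open>L(W)\<close> and restricted to \<open>U\<close>.
\<close>

definition \<tau> :: "('a, 'b, 'f) operator" where "\<tau> = unit_of U * phi W turn"
definition \<tau>' :: "('a, 'b, 'f) operator" where "\<tau>' = unit_of U * phi W unturn"

lemma \<tau>_ZL: "\<tau> \<in> central_ops U" "\<tau>' \<in> central_ops U"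
  unfolding \<tau>_def \<tau>'_def
  by (intro restrict_central[OF U(1)] phi_central[OF hereditary_W finitary_W] turn_central unturn_central)+

lemma vertex_unit: "vertex_op v * unit_of U = vertex_op v" using unit_of_vertex(2)[OF finite_U, of v] vU
  by simp

lemma V_\<tau>: "vertex_op v * \<tau> = path_op v (cyc v)" "vertex_op v * \<tau>' = gpath_op v (cyc v)"
  unfolding \<tau>_def \<tau>'_def mult.assoc[symmetric] vertex_unit
  by (simp_all add: phi_inside[OF hereditary_W finitary_W v turn_central] phi_inside[OF hereditary_W finitary_W v unturn_central] vertex_turn vertex_unturn v)

lemma \<tau>_\<tau>': "\<tau> * \<tau>' = unit_of U"
proof (rule central_ops_eqI[OF central_ops_closed(4)[OF \<tau>_ZL] unit_central[OF finite_U]])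
  have "vertex_op v * (\<tau> * \<tau>') = path_op v (cyc v) * \<tau>'" by (simp add: V_\<tau> flip: mult.assoc)
  also have "\<dots> = path_op v (cyc v) * vertex_op v * \<tau>'" using path_vertex[OF cyc(1)[OF v], of v] by simp
  also have "\<dots> = vertex_op v" by (simp add: mult.assoc V_\<tau> path_ghost_path[OF v cyc(1)[OF v]])
  finally show "vertex_op v * (\<tau> * \<tau>') = vertex_op v * unit_of U" by (simp add: vertex_unit)
qed

lemma \<tau>'_\<tau>: "\<tau>' * \<tau> = unit_of U"
  using central_opsD(2)[OF \<tau>_ZL(1) central_opsD(1)[OF \<tau>_ZL(2)]] \<tau>_\<tau>' by simp

definition tau_power :: "int \<Rightarrow> ('a, 'b, 'f) operator" where "tau_power = corner_power (unit_of U) \<tau> \<tau>'"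

lemma unit_absorb: "x \<in> central_ops U \<Longrightarrow> unit_of U * x = x" "x \<in> central_ops U \<Longrightarrow> x * unit_of U = x"
  using sub_ops_unit[OF finite_U] central_opsD(1) by blast+

lemma tau_power_add: "tau_power (a + b) = tau_power a * tau_power b"
  unfolding tau_power_def
    by (rule corner_power_add) (simp_all add: unit_absorb unit_central[OF finite_U] \<tau>_ZL \<tau>_\<tau>' \<tau>'_\<tau>)

lemma tau_power_0: "tau_power 0 = unit_of U" by (simp add: tau_power_def corner_power_0)

lemma tau_power_central: "tau_power a \<in> central_ops U"
proof -
  have *: "unit_of U * x ^ n \<in> central_ops U" if "x \<in> central_ops U" for x n
  proof (induction n)
    case (Suc n)
    have "unit_of U * x ^ Suc n = unit_of U * x ^ n * x" by (simp only: power_Suc2 mult.assoc)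
    then show ?case using central_ops_closed(4)[OF Suc that] by simp
  qed (simp add: unit_central[OF finite_U])
  then show ?thesis using \<tau>_ZL by (simp add: tau_power_def corner_power_def)
qed

lemma vertex_tau_power: "vertex_op v * tau_power (int n) = path_op v (iter (cyc v) n)"
proof (induction n)
  case 0 then show ?case by (simp add: tau_power_0 vertex_unit)
next
  case (Suc n)
  have p1: "tau_power 1 = \<tau>" unfolding tau_power_def corner_power_def using unit_absorb(1)[OF \<tau>_ZL(1)]
    by simp
  have "vertex_op v * tau_power (int (Suc n)) = vertex_op v * tau_power (int n) * \<tau>"
    using tau_power_add[of "int n" 1] by (simp add: p1 mult.assoc add.commute)
  also have "\<dots> = path_op v (iter (cyc v) n) * vertex_op v * \<tau>"
    using path_vertex[OF awalk_iter[OF cyc(1)[OF v]], of n v] by (simp add: Suc)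
  also have "\<dots> = path_op v (iter (cyc v) n @ iter (cyc v) 1)"
    using path_op_append[OF awalk_iter[OF cyc(1)[OF v]], of n] by (simp add: mult.assoc V_\<tau> iter_Suc)
  finally show ?case by (simp flip: iter_add)
qed

definition laurent_value :: "(int \<Rightarrow>\<^sub>0 'f) \<Rightarrow> ('a, 'b, 'f) operator" where
  "laurent_value = lin_ext tau_power"

lemma laurent_value_mult: "laurent_value (f * g) = laurent_value f * laurent_value g"
  unfolding laurent_value_def by (rule lin_ext_mult) (rule tau_power_add)

lemma laurent_value_central: "laurent_value f \<in> central_ops U"
  unfolding laurent_value_def lin_ext_def by (intro central_ops_sum central_ops_closed tau_power_central)

text \<open>
  At \<open>v\<close>, and after multiplication by a high power of the cycle, the exponents become natural numbers
  and the terms become different real paths.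
\<close>

lemma laurent_value_eq_0:
  assumes "laurent_value f = 0"
  shows "f = 0"
proof (rule ccontr)
  assume "f \<noteq> 0"
  then obtain a0 where a0: "a0 \<in> Poly_Mapping.keys f" by (metis all_not_in_conv keys_eq_empty)
  let ?K = "Poly_Mapping.keys f" and ?c = "Poly_Mapping.lookup f"
  \<comment> \<open>adding \<open>N\<close> makes all exponents of \<open>f\<close> nonnegative\<close>
  define N where "N = nat (Max ((\<lambda>a. \<bar>a\<bar>) ` ?K))"
  have N: "0 \<le> a + int N" if "a \<in> ?K" for a
  proof -
    have "\<bar>a\<bar> \<le> Max ((\<lambda>a. \<bar>a\<bar>) ` ?K)" using that by (intro Max_ge) auto
    then show ?thesis unfolding N_def by linarith
  qed
  let ?r = "\<lambda>a. iter (cyc v) (nat (a + int N))"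
  have "0 = vertex_op v * (laurent_value f * tau_power (int N))" using assms by simp
  also have "\<dots> = (\<Sum>a\<in>?K. scal (?c a) * (vertex_op v * tau_power (a + int N)))"
    unfolding laurent_value_def lin_ext_def sum_distrib_left sum_distrib_right
    by (intro sum.cong refl) (simp only: tau_power_add scal_commL mult.assoc)
  also have "\<dots> = (\<Sum>a\<in>?K. scal (?c a) * path_op v (?r a))"
  proof (intro sum.cong refl)
    fix a assume "a \<in> ?K"
    then have "int (nat (a + int N)) = a + int N" using N by simp
    from vertex_tau_power[of "nat (a + int N)", unfolded this]
    show "scal (?c a) * (vertex_op v * tau_power (a + int N)) = scal (?c a) * path_op v (?r a)" by simp
  qed
  finally have "coef v (?r a0) (\<Sum>a\<in>?K. scal (?c a) * path_op v (?r a)) = 0" by simp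
  moreover have "coef v (?r a0) (\<Sum>a\<in>?K. scal (?c a) * path_op v (?r a)) = (\<Sum>a\<in>?K. if ?r a = ?r a0 then ?c a else 0)"
    by (rule coef_path_sum; rule awalk_iter[OF cyc(1)[OF v]])
  moreover have "(\<Sum>a\<in>?K. if ?r a = ?r a0 then ?c a else 0) = (\<Sum>a\<in>?K. if a = a0 then ?c a else 0)"
  proof (intro sum.cong refl)
    fix a assume "a \<in> ?K"
    then have "?r a = ?r a0 \<longleftrightarrow> a = a0"
      using iter_inj[OF cyc(4)[OF v], of "nat (a + int N)" "nat (a0 + int N)"] N[of a] N[OF a0] by auto
    then show "(if ?r a = ?r a0 then ?c a else 0) = (if a = a0 then ?c a else 0)" by simp
  qed
  ultimately show False using a0 by (simp add: in_keys_iff)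
qed

text \<open>
  At \<open>v\<close>, and after multiplication by \<open>C\<^sup>N\<close>, a central element is a polynomial in \<open>C\<close>.  Lowering the
  exponents by \<open>N\<close> gives the Laurent polynomial.
\<close>

lemma laurent_value_surj:
  assumes T: "T \<in> central_ops U"
  shows "\<exists>f. laurent_value f = T"
proof -
  let ?z = "phi U T" and ?p = "iter (cyc v)"
  have z: "?z \<in> Z" by (rule phi_central[OF U T])
  obtain N A c where A: "finite A" "?z * path_op v (?p N) = (\<Sum>a\<in>A. scal (c a) * path_op v (?p a))"
    using central_on_cycle[OF z cyc(1)[OF v] cyc(3)[OF v] cyc(4)[OF v]] by blast
  define f where "f = (\<Sum>a\<in>A. Poly_Mapping.single (int a - int N) (c a))"
  have lf: "laurent_value f = (\<Sum>a\<in>A. scal (c a) * tau_power (int a - int N))"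
    by (simp add: f_def laurent_value_def lin_ext_sum lin_ext_single)
  have eq: "vertex_op v * laurent_value f * tau_power (int N) = vertex_op v * T * tau_power (int N)"
  proof -
    have "vertex_op v * laurent_value f * tau_power (int N) = (\<Sum>a\<in>A. scal (c a) * (vertex_op v * tau_power (int a - int N + int N)))"
      unfolding lf sum_distrib_left sum_distrib_right tau_power_add
      by (intro sum.cong refl) (simp only: scal_commL mult.assoc)
    also have "\<dots> = ?z * path_op v (?p N)" by (simp add: A(2) vertex_tau_power)
    also have "\<dots> = vertex_op v * ?z * tau_power (int N)"
      by (simp only: vertex_tau_power[symmetric] Z_vertex[OF z, symmetric] mult.assoc[symmetric])
    also have "\<dots> = vertex_op v * T * tau_power (int N)" by (simp only: phi_inside[OF U vU T])
    finally show ?thesis .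
  qed
  have inv: "x * tau_power (int N) * tau_power (- int N) = x * unit_of U" for x
    using tau_power_add[of "int N" "- int N"] by (simp add: mult.assoc tau_power_0)
  have "vertex_op v * laurent_value f = vertex_op v * laurent_value f * tau_power (int N) * tau_power (- int N)"
    unfolding inv by (simp add: mult.assoc unit_absorb laurent_value_central)
  also have "\<dots> = vertex_op v * T" unfolding eq inv by (simp add: mult.assoc unit_absorb T)
  finally have "laurent_value f = T" by (rule central_ops_eqI[OF laurent_value_central T])
  then show ?thesis by blast
qed

lemma laurent_value_bij: "bij_betw laurent_value UNIV (central_ops U)"
proof (rule bij_betwI')
  show "laurent_value f = laurent_value g \<longleftrightarrow> f = g" for f g
  proof
    assume "laurent_value f = laurent_value g"
    moreover have "laurent_value (f - g) + laurent_value g = laurent_value f"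
      by (simp add: laurent_value_def flip: lin_ext_add)
    ultimately have "laurent_value (f - g) = 0" by simp
    then show "f = g" using laurent_value_eq_0 by fastforce
  qed simp
qed (use laurent_value_central laurent_value_surj in \<open>auto simp: eq_commute\<close>)

end

section \<open>Isomorphisms and embeddings in terms of operators\<close>

context leavitt_digraph
begin

lemma Phi_unit:
  assumes "H \<subseteq> verts G"
  shows "cls (\<Sum>w\<in>H. mon [Vert w]) \<in> carrier L" "Phi (cls (\<Sum>w\<in>H. mon [Vert w])) = unit_of H"
proof -
  have "(\<Sum>w\<in>H. mon [Vert w]) \<in> aug_polys" using assms by (intro aug_polys_sum aug_polys_closed) auto
  then show "cls (\<Sum>w\<in>H. mon [Vert w]) \<in> carrier L" "Phi (cls (\<Sum>w\<in>H. mon [Vert w])) = unit_of H"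
    by (simp_all add: L_carrier Phi_cls aug_polys_carrier ev_sum ev_mon unit_of_def)
qed

text \<open>
  The maps that are easily described go from the explicit algebra to the operators.  The isomorphism
  asked for is the inverse.
\<close>

lemma isomorphic_center:
  fixes B :: "('f, 'c) module"
  assumes H: "H \<subseteq> verts G" and B: "carrier B = UNIV" and g: "bij_betw g UNIV (central_ops H)"
    and mult: "\<And>x y. g (x \<otimes>\<^bsub>B\<^esub> y) = g x * g y" and add: "\<And>x y. g (x \<oplus>\<^bsub>B\<^esub> y) = g x + g y"
    and one: "g \<one>\<^bsub>B\<^esub> = unit_of H" and smult: "\<And>c x. g (c \<odot>\<^bsub>B\<^esub> x) = scal c * g x"
  shows "isomorphic_algebras (center (leavitt_sub G H)) B"
proof -
  let ?A = "center (leavitt_sub G H)"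
  define h where "h x = inv_into UNIV g (Phi x)" for x
  have inj: "inj g" using g by (simp add: bij_betw_def)
  have A: "carrier ?A = {z \<in> carrier L. Phi z \<in> central_ops H}" by (rule center_sub[OF H])
  have gh: "g (h x) = Phi x" if "x \<in> carrier ?A" for x
    using that g unfolding h_def A by (auto simp: bij_betw_def intro: f_inv_into_f)
  have "bij_betw Phi (carrier ?A) (central_ops H)"
    unfolding bij_betw_def
  proof
    show "inj_on Phi (carrier ?A)" by (intro inj_onI, rule Phi_inj) (auto simp: A)
    show "Phi ` carrier ?A = central_ops H" using Phi_ex[OF H] central_opsD(1) unfolding A by blast
  qed
  from bij_betw_trans[OF this bij_betw_inv_into[OF g]]
  have bij: "bij_betw h (carrier ?A) (carrier B)" unfolding B h_def o_def .
  have c: "x \<otimes>\<^bsub>L\<^esub> y \<in> carrier ?A" "x \<oplus>\<^bsub>L\<^esub> y \<in> carrier ?A" "c \<odot>\<^bsub>L\<^esub> x \<in> carrier ?A"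
    if "x \<in> carrier ?A" "y \<in> carrier ?A" for x y c
    using that by (auto simp: A L_closed central_ops_closed)
  have L: "x \<in> carrier L" if "x \<in> carrier ?A" for x using that by (simp add: A)
  have "h \<in> ring_hom ?A B"
  proof (rule ring_hom_memI)
    fix x y :: "('a, 'b, 'f) leavitt_poly set" assume *: "x \<in> carrier ?A" "y \<in> carrier ?A"
    show "h (x \<otimes>\<^bsub>?A\<^esub> y) = h x \<otimes>\<^bsub>B\<^esub> h y"
      by (rule injD[OF inj]) (simp add: mult gh c * L_closed L)
    show "h (x \<oplus>\<^bsub>?A\<^esub> y) = h x \<oplus>\<^bsub>B\<^esub> h y"
      by (rule injD[OF inj]) (simp add: add gh c * L_closed L)
  next
    have "h (cls (\<Sum>w\<in>H. mon [Vert w])) = \<one>\<^bsub>B\<^esub>"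
      unfolding h_def Phi_unit[OF H] one[symmetric] by (rule inv_into_f_f[OF inj UNIV_I])
    then show "h \<one>\<^bsub>?A\<^esub> = \<one>\<^bsub>B\<^esub>" by simp
  qed (simp add: B)
  moreover have "h (c \<odot>\<^bsub>?A\<^esub> x) = c \<odot>\<^bsub>B\<^esub> h x" if "x \<in> carrier ?A" for c x
    by (rule injD[OF inj]) (simp add: smult gh c(3)[OF that that] that L_closed(6)[OF L L, OF that that])
  ultimately show ?thesis using bij unfolding isomorphic_algebras_def ring_iso_def by auto
qed

lemma prod_edge_ops: "awalk u p y \<Longrightarrow> p \<noteq> [] \<Longrightarrow> prod_list (map edge_op p) = path_op u p"
  by (cases p) (auto simp: path_op_def awalk_Cons_iff simp flip: mult.assoc)

lemma prod_ghost_ops: "awalk u p y \<Longrightarrow> p \<noteq> [] \<Longrightarrow> prod_list (map ghost_op (rev p)) = gpath_op u p"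
  by (cases p) (auto simp: gpath_op_def awalk_Cons_iff mult.assoc)

lemma Phi_path:
  assumes "awalk u p y"
  shows "path_elem G (u, p) \<in> carrier L" "Phi (path_elem G (u, p)) = path_op u p"
    "path_star G (u, p) \<in> carrier L" "Phi (path_star G (u, p)) = gpath_op u p"
proof -
  have u: "u \<in> verts G" "set p \<subseteq> arcs G" using assms by auto
  let ?e = "if p = [] then [Vert u] else map Edge p" and ?s = "if p = [] then [Vert u] else map Ghost (rev p)"
  have "Edge ` set p \<subseteq> leavitt_gens G" "Ghost ` set p \<subseteq> leavitt_gens G"
    using u(2) by (auto simp: leavitt_gens_def)
  then have e: "mon ?e \<in> aug_polys" and s: "mon ?s \<in> aug_polys"
    using u(1) by (auto intro!: aug_polys_closed)
  show "path_elem G (u, p) \<in> carrier L" "path_star G (u, p) \<in> carrier L"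
    using e s by (simp_all add: L_carrier del: if_image_distrib)
  show "Phi (path_elem G (u, p)) = path_op u p"
    using aug_polys_carrier[OF e] prod_edge_ops[OF assms] by (simp add: Phi_cls ev_mon o_def)
  show "Phi (path_star G (u, p)) = gpath_op u p"
    using aug_polys_carrier[OF s] prod_ghost_ops[OF assms] by (simp add: Phi_cls ev_mon o_def)
qed

text \<open>
  The diagonal embedding is specified only on diagonal elements; a central element \<open>a\<close> is one of
  them, being the sum of the \<open>w a w\<close>.
\<close>

lemma diagonal_embedding_transfer:
  assumes H: "hereditary G H" and a: "a \<in> carrier (center (leavitt_sub G H))"
  shows "diagonal_embedding G H a \<in> carrier L" "Phi (diagonal_embedding G H a) = phi H (Phi a)"
proof -
  note Hv = hereditary_verts[OF H]
  have a': "a \<in> carrier L" "Phi a \<in> central_ops H" using a by (auto simp: center_sub[OF Hv])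
  have V: "cls (mon [Vert w]) \<in> carrier L" "Phi (cls (mon [Vert w])) = vertex_op w" if "w \<in> H" for w
    using that Hv by (auto simp: Phi_gens)
  let ?f = "\<lambda>w. cls (mon [Vert w]) \<otimes>\<^bsub>L\<^esub> a \<otimes>\<^bsub>L\<^esub> cls (mon [Vert w])"
  have f: "?f \<in> H \<rightarrow> carrier L" using V a' by (auto simp: L_closed)
  have "a = (\<Oplus>\<^bsub>L\<^esub>w\<in>H. ?f w)"
  proof (rule Phi_inj[OF a'(1) L_finsum(1)[OF f]])
    have "Phi (\<Oplus>\<^bsub>L\<^esub>w\<in>H. ?f w) = (\<Sum>w\<in>H. vertex_op w * Phi a * vertex_op w)"
      unfolding L_finsum(2)[OF f] by (intro sum.cong) (auto simp: V a' L_closed)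
    also have "\<dots> = (\<Sum>w\<in>H. vertex_op w * Phi a)"
    proof (intro sum.cong refl)
      fix w assume "w \<in> H"
      then have "vertex_op w * Phi a = Phi a * vertex_op w" using central_opsD(2)[OF a'(2) sub_ops_vertex]
        by blast
      then show "vertex_op w * Phi a * vertex_op w = vertex_op w * Phi a"
        by (simp add: mult.assoc vertex_vertex)
    qed
    also have "\<dots> = unit_of H * Phi a" by (simp add: unit_of_def sum_distrib_right)
    finally show "Phi a = Phi (\<Oplus>\<^bsub>L\<^esub>w\<in>H. ?f w)"
      using sub_ops_unit[OF hereditary_finite[OF H] central_opsD(1)[OF a'(2)]] by simp
  qed
  moreover have "a \<in> carrier (leavitt_sub G H)" using a by (simp add: center_def)
  ultimately have diag: "a \<in> leavitt_diag G H" unfolding leavitt_diag_def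
    by (intro CollectI exI[of _ "\<lambda>_. a"]) auto
  let ?g = "\<lambda>q. path_elem G q \<otimes>\<^bsub>L\<^esub> a \<otimes>\<^bsub>L\<^esub> path_star G q"
  have p: "path_elem G q \<in> carrier L" "Phi (path_elem G q) = path_op (fst q) (snd q)"
    "path_star G q \<in> carrier L" "Phi (path_star G q) = gpath_op (fst q) (snd q)" if "q \<in> arrival_paths G H"
      for q
    using that Phi_path[of "fst q" "snd q"] arrivalD[of "fst q" "snd q" H] by (metis prod.collapse)+
  have g: "?g \<in> arrival_paths G H \<rightarrow> carrier L" using p a' by (auto simp: L_closed)
  have eq: "diagonal_embedding G H a = (\<Oplus>\<^bsub>L\<^esub>q\<in>arrival_paths G H. ?g q)"
    using diag by (simp add: diagonal_embedding_def)
  show "diagonal_embedding G H a \<in> carrier L" unfolding eq by (rule L_finsum(1)[OF g])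
  show "Phi (diagonal_embedding G H a) = phi H (Phi a)"
    unfolding eq L_finsum(2)[OF g] phi_def by (intro sum.cong) (auto simp: p a' L_closed)
qed

lemma diagonal_embedding_image:
  assumes H: "hereditary G H"
  shows "diagonal_embedding G H ` carrier (center (leavitt_sub G H)) = {x \<in> carrier L. Phi x \<in> phi H ` central_ops H}"
proof (intro equalityI subsetI)
  fix x :: "('a, 'b, 'f) leavitt_poly set"
  assume "x \<in> diagonal_embedding G H ` carrier (center (leavitt_sub G H))"
  then show "x \<in> {x \<in> carrier L. Phi x \<in> phi H ` central_ops H}"
    using diagonal_embedding_transfer[OF H] center_sub[OF hereditary_verts[OF H]] by auto
next
  fix x :: "('a, 'b, 'f) leavitt_poly set"
  assume "x \<in> {x \<in> carrier L. Phi x \<in> phi H ` central_ops H}"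
  then obtain T where x: "x \<in> carrier L" and T: "T \<in> central_ops H" "Phi x = phi H T" by blast
  obtain a where a: "a \<in> carrier L" "Phi a = T"
    using Phi_ex[OF hereditary_verts[OF H] central_opsD(1)[OF T(1)]] by blast
  then have ac: "a \<in> carrier (center (leavitt_sub G H))" using T
    by (simp add: center_sub[OF hereditary_verts[OF H]])
  have "x = diagonal_embedding G H a"
    using diagonal_embedding_transfer[OF H ac] a T x by (intro Phi_inj) auto
  then show "x \<in> diagonal_embedding G H ` carrier (center (leavitt_sub G H))" using ac by blast
qed

end

section \<open>The direct sum decomposition\<close>

text \<open>
  What the decomposition needs to know about the sets \<open>U i\<close>: they do not reach each other, and
  every vertex reaches one of them.
\<close>

locale separating_family = leavitt_digraph G base_field
  for G :: "('a, 'b) pre_digraph" and base_field :: "'f::field itself" +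
  fixes K :: "'i set" and U :: "'i \<Rightarrow> 'a set"
  assumes finite_K: "finite K"
    and U: "i \<in> K \<Longrightarrow> hereditary G (U i)" "i \<in> K \<Longrightarrow> finitary G (U i)"
    and separated: "i \<in> K \<Longrightarrow> l \<in> K \<Longrightarrow> i \<noteq> l \<Longrightarrow> u \<in> U i \<Longrightarrow> x \<in> U l \<Longrightarrow> \<not> awalk u p x"
    and reaches: "v \<in> verts G \<Longrightarrow> \<exists>i\<in>K. \<exists>p. \<exists>x\<in>U i. awalk v p x"
begin

abbreviation one_at :: "'i \<Rightarrow> ('a, 'b, 'f) operator" where "one_at i \<equiv> unit_of (U i)"
abbreviation summand :: "'i \<Rightarrow> ('a, 'b, 'f) operator set" where "summand i \<equiv> phi (U i) ` central_ops (U i)"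

lemma one_phi:
  assumes "i \<in> K" "l \<in> K" "T \<in> central_ops (U l)"
  shows "one_at i * phi (U l) T = (if i = l then T else 0)"
proof (cases "i = l")
  case True then show ?thesis using unit_phi[OF U(1) U(2)] assms by simp
next
  case False
  then show ?thesis unfolding unit_of_def sum_distrib_right
    using separated[OF assms(1,2) False] by (simp add: phi_outside)
qed

lemma central_eq_0I:
  assumes z: "z \<in> Z" and 0: "\<And>i. i \<in> K \<Longrightarrow> one_at i * z = 0"
  shows "z = 0"
proof (rule Z_eq_0I[OF z], rule central_vanishes_at[OF z])
  fix v q y assume "awalk v q y"
  then obtain i p x where x: "i \<in> K" "x \<in> U i" "awalk y p x" using reaches awalk_last_in_verts by meson
  have "z * vertex_op x = vertex_op x * (one_at i * z)"
    using unit_of_vertex(2)[OF hereditary_finite[OF U(1)[OF x(1)]], of x] x(2) Z_vertex[OF z, of x]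
    by (simp flip: mult.assoc)
  also have "\<dots> = 0" using 0[OF x(1)] by simp
  finally show "\<exists>p w. awalk y p w \<and> z * vertex_op w = 0" using x by blast
qed

text \<open>
  Described by where its elements vanish, a summand is evidently closed under the operations, and no
  products of arrival paths have to be computed.
\<close>

lemma summand_iff:
  assumes i: "i \<in> K"
  shows "z \<in> summand i \<longleftrightarrow> z \<in> Z \<and> (\<forall>l\<in>K. l \<noteq> i \<longrightarrow> one_at l * z = 0)"
proof
  assume "z \<in> summand i"
  then show "z \<in> Z \<and> (\<forall>l\<in>K. l \<noteq> i \<longrightarrow> one_at l * z = 0)"
    using phi_central[OF U(1)[OF i] U(2)[OF i]] one_phi i by auto
next
  assume z: "z \<in> Z \<and> (\<forall>l\<in>K. l \<noteq> i \<longrightarrow> one_at l * z = 0)"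
  have T: "one_at i * z \<in> central_ops (U i)" using restrict_central[OF U(1)[OF i]] z by blast
  have "z - phi (U i) (one_at i * z) = 0"
  proof (rule central_eq_0I)
    show "z - phi (U i) (one_at i * z) \<in> Z"
      using z phi_central[OF U(1)[OF i] U(2)[OF i] T] by (intro central_ops_closed) auto
    show "one_at l * (z - phi (U i) (one_at i * z)) = 0" if "l \<in> K" for l
      using one_phi[OF that i T] z that by (simp add: right_diff_distrib)
  qed
  then show "z \<in> summand i" using T by auto
qed

lemma summand_closed:
  assumes i: "i \<in> K"
  shows "0 \<in> summand i" "x \<in> summand i \<Longrightarrow> y \<in> summand i \<Longrightarrow> x + y \<in> summand i"
    "x \<in> summand i \<Longrightarrow> y \<in> summand i \<Longrightarrow> x * y \<in> summand i" "x \<in> summand i \<Longrightarrow> scal c * x \<in> summand i"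
    "x \<in> summand i \<Longrightarrow> y \<in> summand i \<Longrightarrow> x - y \<in> summand i"
  unfolding summand_iff[OF i]
  by (auto simp: central_ops_closed distrib_left right_diff_distrib scal_commL) (simp flip: mult.assoc)

lemma summand_orthogonal:
  assumes "i \<in> K" "j \<in> K" "i \<noteq> j" "x \<in> summand i" "y \<in> summand j"
  shows "x * y = 0"
proof (rule central_eq_0I)
  have x: "x \<in> Z" "\<And>l. l \<in> K \<Longrightarrow> l \<noteq> i \<Longrightarrow> one_at l * x = 0" and y: "y \<in> Z" "one_at i * y = 0"
    using assms summand_iff by blast+
  show "x * y \<in> Z" by (rule central_ops_closed(4)[OF x(1) y(1)])
  show "one_at l * (x * y) = 0" if "l \<in> K" for l
  proof (cases "l = i")
    case True
    have "one_at i * (x * y) = x * (one_at i * y)" using unit_comm[OF x(1), of "U i"]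
      by (simp flip: mult.assoc)
    then show ?thesis using True y by simp
  next
    case False then show ?thesis using x(2)[OF that] by (simp flip: mult.assoc)
  qed
qed

lemma summand_sum_at:
  assumes j: "j \<in> K" and s: "\<And>i. i \<in> K \<Longrightarrow> s i \<in> summand i"
  shows "one_at j * (\<Sum>i\<in>K. s i) = one_at j * s j"
proof -
  have "one_at j * (\<Sum>i\<in>K. s i) = (\<Sum>i\<in>K. if i = j then one_at j * s j else 0)"
    unfolding sum_distrib_left by (intro sum.cong refl) (use s summand_iff j in auto)
  then show ?thesis using finite_K j by simp
qed

text \<open>
  A central element differs from the sum of the embedded restrictions by a central element that
  vanishes on every \<open>U i\<close>.  The restriction to \<open>U j\<close> recovers the summand with index \<open>j\<close> from a sum.
\<close>

lemma center_direct_sum: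
  "internal_direct_sum L K (\<lambda>i. diagonal_embedding G (U i) ` carrier (center (leavitt_sub G (U i)))) (carrier (center L))"
proof -
  define S where "S i = {x \<in> carrier L. Phi x \<in> summand i}" for i
  have S_eq: "diagonal_embedding G (U i) ` carrier (center (leavitt_sub G (U i))) = S i" if "i \<in> K" for i
    unfolding S_def by (rule diagonal_embedding_image[OF U(1)[OF that]])
  have "is_subalgebra L (S i)" if "i \<in> K" for i
    unfolding is_subalgebra_def S_def using summand_closed[OF that] by (auto simp: L_closed L_0)
  moreover have "x \<otimes>\<^bsub>L\<^esub> y = \<zero>\<^bsub>L\<^esub>" if "i \<in> K" "j \<in> K" "i \<noteq> j" "x \<in> S i" "y \<in> S j" for i j x y
    using that summand_orthogonal[OF that(1-3)] by (intro Phi_inj) (auto simp: S_def L_closed L_0)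
  moreover have "bij_betw (\<lambda>x. \<Oplus>\<^bsub>L\<^esub>i\<in>K. x i) (\<Pi>\<^sub>E i\<in>K. S i) (carrier (center L))"
    unfolding bij_betw_def
  proof
    have PiE: "x \<in> K \<rightarrow> carrier L" "\<And>i. i \<in> K \<Longrightarrow> Phi (x i) \<in> summand i" "\<And>i. i \<in> K \<Longrightarrow> x i \<in> carrier L"
      if "x \<in> (\<Pi>\<^sub>E i\<in>K. S i)" for x
      using that by (auto simp: S_def PiE_def Pi_def)
    show "inj_on (\<lambda>x. \<Oplus>\<^bsub>L\<^esub>i\<in>K. x i) (\<Pi>\<^sub>E i\<in>K. S i)"
    proof (rule inj_onI)
      fix x y assume x: "x \<in> (\<Pi>\<^sub>E i\<in>K. S i)" and y: "y \<in> (\<Pi>\<^sub>E i\<in>K. S i)"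
        and eq: "(\<Oplus>\<^bsub>L\<^esub>i\<in>K. x i) = (\<Oplus>\<^bsub>L\<^esub>i\<in>K. y i)"
      have sums: "(\<Sum>i\<in>K. Phi (x i)) = (\<Sum>i\<in>K. Phi (y i))"
        using eq L_finsum(2)[OF PiE(1)[OF x]] L_finsum(2)[OF PiE(1)[OF y]] by simp
      show "x = y"
      proof (rule PiE_ext[OF x y])
        fix j assume j: "j \<in> K"
        have d: "Phi (x j) - Phi (y j) \<in> summand j"
          by (rule summand_closed(5)[OF j PiE(2)[OF x j] PiE(2)[OF y j]])
        have "Phi (x j) - Phi (y j) = 0"
        proof (rule central_eq_0I)
          show "Phi (x j) - Phi (y j) \<in> Z" using d summand_iff[OF j] by blast
          fix l assume l: "l \<in> K"
          show "one_at l * (Phi (x j) - Phi (y j)) = 0"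
          proof (cases "l = j")
            case True
            then show ?thesis
              using summand_sum_at[OF j PiE(2)[OF x]] summand_sum_at[OF j PiE(2)[OF y]] sums
              by (simp add: right_diff_distrib)
          next
            case False then show ?thesis using d summand_iff[OF j] l by blast
          qed
        qed
        then show "x j = y j" using PiE(3)[OF x j] PiE(3)[OF y j] by (intro Phi_inj) auto
      qed
    qed
    show "(\<lambda>x. \<Oplus>\<^bsub>L\<^esub>i\<in>K. x i) ` (\<Pi>\<^sub>E i\<in>K. S i) = carrier (center L)"
    proof (intro equalityI subsetI)
      fix z assume "z \<in> (\<lambda>x. \<Oplus>\<^bsub>L\<^esub>i\<in>K. x i) ` (\<Pi>\<^sub>E i\<in>K. S i)"
      then obtain x where x: "x \<in> (\<Pi>\<^sub>E i\<in>K. S i)" "z = (\<Oplus>\<^bsub>L\<^esub>i\<in>K. x i)" by blast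
      have "(\<Sum>i\<in>K. Phi (x i)) \<in> Z" using PiE(2)[OF x(1)] summand_iff by (intro central_ops_sum) blast
      then show "z \<in> carrier (center L)"
        using L_finsum[OF PiE(1)[OF x(1)]] x(2) by (simp add: center_L)
    next
      fix z assume "z \<in> carrier (center L)"
      then have z: "z \<in> carrier L" "Phi z \<in> Z" by (auto simp: center_L)
      let ?s = "\<lambda>i. phi (U i) (one_at i * Phi z)"
      have T: "one_at i * Phi z \<in> central_ops (U i)" if "i \<in> K" for i
        using restrict_central[OF U(1)[OF that] z(2)] .
      have "\<exists>x\<in>carrier L. Phi x = ?s i" if "i \<in> K" for i
        using Phi_ex[OF order_refl central_opsD(1)[OF phi_central[OF U(1)[OF that] U(2)[OF that] T[OF that]]]] .
      then obtain y where y: "\<And>i. i \<in> K \<Longrightarrow> y i \<in> carrier L" "\<And>i. i \<in> K \<Longrightarrow> Phi (y i) = ?s i" by metis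
      let ?x = "restrict y K"
      have x: "?x \<in> (\<Pi>\<^sub>E i\<in>K. S i)" using y T by (auto simp: S_def)
      have "Phi z - (\<Sum>i\<in>K. ?s i) = 0"
      proof (rule central_eq_0I)
        show "Phi z - (\<Sum>i\<in>K. ?s i) \<in> Z"
          using z(2) phi_central[OF U(1) U(2) T] by (intro central_ops_closed central_ops_sum) auto
        fix j assume j: "j \<in> K"
        have "one_at j * (\<Sum>i\<in>K. ?s i) = one_at j * ?s j"
          using T by (intro summand_sum_at[OF j]) auto
        then show "one_at j * (Phi z - (\<Sum>i\<in>K. ?s i)) = 0"
          using one_phi[OF j j T[OF j]] by (simp add: right_diff_distrib)
      qed
      moreover have "(\<Sum>i\<in>K. Phi (?x i)) = (\<Sum>i\<in>K. ?s i)" using y by (intro sum.cong) auto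
      ultimately have "z = (\<Oplus>\<^bsub>L\<^esub>i\<in>K. ?x i)"
        using L_finsum[OF PiE(1)[OF x]] z(1) by (intro Phi_inj) auto
      then show "z \<in> (\<lambda>x. \<Oplus>\<^bsub>L\<^esub>i\<in>K. x i) ` (\<Pi>\<^sub>E i\<in>K. S i)" using x by blast
    qed
  qed
  moreover have "(\<Pi>\<^sub>E i\<in>K. diagonal_embedding G (U i) ` carrier (center (leavitt_sub G (U i)))) = (\<Pi>\<^sub>E i\<in>K. S i)"
    using S_eq by (intro PiE_cong) auto
  ultimately show ?thesis unfolding internal_direct_sum_def by (simp add: S_eq)
qed

end

section \<open>The classes of minimal hereditary subsets\<close>

lemma equiv_generated_equiv:
  assumes "r \<subseteq> A \<times> A"
  shows "equiv A (generated_equiv A r)" "r \<subseteq> generated_equiv A r"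
    "\<And>s. equiv A s \<Longrightarrow> r \<subseteq> s \<Longrightarrow> generated_equiv A r \<subseteq> s"
proof -
  have "equiv A (A \<times> A)" by (auto simp: equiv_def refl_on_def sym_def trans_def)
  then have sub: "generated_equiv A r \<subseteq> A \<times> A" using assms by (auto simp: generated_equiv_def)
  show "equiv A (generated_equiv A r)"
  proof (rule equivI[OF sub])
    show "refl_on A (generated_equiv A r)" by (auto simp: generated_equiv_def refl_on_def equiv_def)
    show "sym (generated_equiv A r)" by (auto simp: generated_equiv_def sym_def equiv_def)
    show "trans (generated_equiv A r)" unfolding generated_equiv_def equiv_def trans_def by blast
  qed
  show "r \<subseteq> generated_equiv A r" by (auto simp: generated_equiv_def)
  show "\<And>s. equiv A s \<Longrightarrow> r \<subseteq> s \<Longrightarrow> generated_equiv A r \<subseteq> s" by (auto simp: generated_equiv_def)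
qed

locale center_decomposition = leavitt_digraph G base_field
  for G :: "('a, 'b) pre_digraph" and base_field :: "'f::field itself" +
  fixes W U :: "nat \<Rightarrow> 'a set" and I :: "nat \<Rightarrow> nat set" and k m :: nat
  assumes W: "bij_betw W {1..k} {X. minimal_hereditary G X}"
    and I: "bij_betw I {1..m} ({1..k} // cycle_equiv G k W)"
    and U_eq: "\<And>i. i \<in> {1..m} \<Longrightarrow> U i = perp G (perp G (\<Union>j\<in>I i. W j))"
begin

abbreviation cycle_rel :: "(nat \<times> nat) set" where "cycle_rel \<equiv> cycle_equiv G k W"

lemma cycle_rel_facts:
  shows cycle_rel_equiv: "equiv {1..k} cycle_rel"
    and cycle_relI: "\<And>j l C. j \<in> {1..k} \<Longrightarrow> l \<in> {1..k} \<Longrightarrow> cycle C \<Longrightarrow> cycle_leads_to G C (W j) \<Longrightarrow> cycle_leads_to G C (W l) \<Longrightarrow> (j, l) \<in> cycle_rel"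
    and cycle_rel_least: "\<And>s. equiv {1..k} s \<Longrightarrow>
      (\<And>j l C. j \<in> {1..k} \<Longrightarrow> l \<in> {1..k} \<Longrightarrow> cycle C \<Longrightarrow> cycle_leads_to G C (W j) \<Longrightarrow> cycle_leads_to G C (W l) \<Longrightarrow> (j, l) \<in> s) \<Longrightarrow> cycle_rel \<subseteq> s"
proof -
  let ?r = "{(i, j). i \<in> {1..k} \<and> j \<in> {1..k} \<and>
        (\<exists>C. cycle C \<and> cycle_leads_to G C (W i) \<and> cycle_leads_to G C (W j))}"
  have r: "?r \<subseteq> {1..k} \<times> {1..k}" by auto
  show "equiv {1..k} cycle_rel" unfolding cycle_equiv_def by (rule equiv_generated_equiv(1)[OF r])
  show "(j, l) \<in> cycle_rel"
    if "j \<in> {1..k}" "l \<in> {1..k}" "cycle C" "cycle_leads_to G C (W j)" "cycle_leads_to G C (W l)" for j l C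
    unfolding cycle_equiv_def using that by (intro subsetD[OF equiv_generated_equiv(2)[OF r]]) blast
  show "cycle_rel \<subseteq> s" if "equiv {1..k} s"
    "\<And>j l C. j \<in> {1..k} \<Longrightarrow> l \<in> {1..k} \<Longrightarrow> cycle C \<Longrightarrow> cycle_leads_to G C (W j) \<Longrightarrow> cycle_leads_to G C (W l) \<Longrightarrow> (j, l) \<in> s" for s
    unfolding cycle_equiv_def using that by (intro equiv_generated_equiv(3)[OF r]) blast+
qed

lemma W_minimal: "j \<in> {1..k} \<Longrightarrow> minimal_hereditary G (W j)"
  using W by (auto simp: bij_betw_def)

lemma W_hereditary: "j \<in> {1..k} \<Longrightarrow> hereditary G (W j)" "j \<in> {1..k} \<Longrightarrow> W j \<noteq> {}"
  using W_minimal by (auto simp: minimal_hereditary_def)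

lemma W_disjoint:
  assumes "j \<in> {1..k}" "l \<in> {1..k}" "x \<in> W j" "x \<in> W l"
  shows "j = l"
proof -
  have "W j = W l" using minimal_hereditary_disjoint[OF W_minimal W_minimal] assms by blast
  then show ?thesis using W assms by (auto simp: bij_betw_def dest: inj_onD)
qed

lemma I_class: "i \<in> {1..m} \<Longrightarrow> I i \<in> {1..k} // cycle_rel" using I by (auto simp: bij_betw_def)
lemma I_subset: "i \<in> {1..m} \<Longrightarrow> j \<in> I i \<Longrightarrow> j \<in> {1..k}"
  using I_class in_quotient_imp_subset[OF cycle_rel_equiv] by blast
lemma I_nonempty: "i \<in> {1..m} \<Longrightarrow> I i \<noteq> {}"
  using I_class in_quotient_imp_non_empty[OF cycle_rel_equiv] by blast
lemma I_related: "i \<in> {1..m} \<Longrightarrow> j \<in> I i \<Longrightarrow> l \<in> I i \<Longrightarrow> (j, l) \<in> cycle_rel"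
  using I_class in_quotient_imp_in_rel[OF cycle_rel_equiv] by blast
lemma I_closed: "i \<in> {1..m} \<Longrightarrow> j \<in> I i \<Longrightarrow> (j, l) \<in> cycle_rel \<Longrightarrow> l \<in> I i"
  using I_class in_quotient_imp_closed[OF cycle_rel_equiv] by blast
lemma I_disjoint: "i \<in> {1..m} \<Longrightarrow> i' \<in> {1..m} \<Longrightarrow> j \<in> I i \<Longrightarrow> j \<in> I i' \<Longrightarrow> i = i'"
  using quotient_disj[OF cycle_rel_equiv I_class I_class, of i i'] I
    by (auto simp: bij_betw_def dest: inj_onD)
lemma I_cover: "j \<in> {1..k} \<Longrightarrow> \<exists>i\<in>{1..m}. j \<in> I i"
proof -
  assume j: "j \<in> {1..k}"
  then have "cycle_rel `` {j} \<in> I ` {1..m}" using I quotientI[OF j, of cycle_rel]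
    by (simp add: bij_betw_def)
  then show ?thesis using equiv_class_self[OF cycle_rel_equiv j] by auto
qed

lemma U_hereditary: "i \<in> {1..m} \<Longrightarrow> hereditary G (U i)" using U_eq hereditary_perp by simp

lemma U_iff: "i \<in> {1..m} \<Longrightarrow> u \<in> U i \<longleftrightarrow> u \<in> verts G \<and> (\<forall>p y. awalk u p y \<longrightarrow> (\<exists>q. \<exists>j\<in>I i. \<exists>w\<in>W j. awalk y q w))"
  unfolding U_eq in_perp_perp by blast

lemma U_reaches: "i \<in> {1..m} \<Longrightarrow> u \<in> U i \<Longrightarrow> \<exists>q. \<exists>j\<in>I i. \<exists>w\<in>W j. awalk u q w"
  using U_iff[of i u] awalk_Nil_iff[of u u] by blast

lemma W_U: "i \<in> {1..m} \<Longrightarrow> j \<in> I i \<Longrightarrow> W j \<subseteq> U i"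
proof
  fix w assume i: "i \<in> {1..m}" "j \<in> I i" "w \<in> W j"
  note h = W_hereditary(1)[OF I_subset[OF i(1,2)]]
  have "\<exists>q. \<exists>j\<in>I i. \<exists>w\<in>W j. awalk y q w" if "awalk w p y" for p y
  proof -
    have "y \<in> W j" by (rule hereditaryD[OF h i(3) that])
    moreover have "awalk y [] y" using awalk_last_in_verts[OF that] by (simp add: awalk_Nil_iff)
    ultimately show ?thesis using i(2) by blast
  qed
  then show "w \<in> U i" using U_iff[OF i(1)] hereditary_verts[OF h] i(3) by blast
qed

lemma U_nonempty: "i \<in> {1..m} \<Longrightarrow> U i \<noteq> {}"
  using I_nonempty W_U W_hereditary(2) I_subset by blast

text \<open>
  From a common descendant of \<open>U i\<close> and \<open>U l\<close> one would reach some \<open>W j\<close> of the first class, and from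
  there a \<open>W j'\<close> of the second, which then meets \<open>W j\<close>.
\<close>

lemma U_separated:
  assumes "i \<in> {1..m}" "l \<in> {1..m}" "i \<noteq> l" "u \<in> U i" "x \<in> U l"
  shows "\<not> awalk u p x"
proof
  assume "awalk u p x"
  then have "x \<in> U i" by (rule hereditaryD[OF U_hereditary[OF assms(1)] assms(4)])
  then obtain q j w where j: "j \<in> I i" "w \<in> W j" "awalk x q w" using U_reaches[OF assms(1)] by blast
  then have "w \<in> U l" using hereditaryD[OF U_hereditary[OF assms(2)] assms(5)] by blast
  then obtain q' j' w' where j': "j' \<in> I l" "w' \<in> W j'" "awalk w q' w'" using U_reaches[OF assms(2)]
    by blast
  then have "w' \<in> W j" using hereditaryD[OF W_hereditary(1)[OF I_subset[OF assms(1) j(1)]] j(2)] by blast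
  then have "j = j'" using W_disjoint I_subset assms(1,2) j(1) j'(1,2) by blast
  then show False using I_disjoint[OF assms(1,2)] j(1) j'(1) assms(3) by blast
qed

lemma reaches_W: "v \<in> verts G \<Longrightarrow> \<exists>j\<in>{1..k}. \<exists>p. \<exists>w\<in>W j. awalk v p w"
proof -
  assume "v \<in> verts G"
  then obtain X w p where X: "minimal_hereditary G X" "w \<in> X" "awalk v p w" using reaches_minimal_hereditary
    by blast
  then obtain j where "j \<in> {1..k}" "W j = X" using W
    by (metis (mono_tags, lifting) bij_betw_def imageE mem_Collect_eq)
  then show ?thesis using X by blast
qed

lemma reaches_U: "v \<in> verts G \<Longrightarrow> \<exists>i\<in>{1..m}. \<exists>p. \<exists>x\<in>U i. awalk v p x"
  using reaches_W I_cover W_U by (meson subsetD)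

text \<open>
  Otherwise a cycle outside \<open>U i\<close> leads to \<open>U i\<close>.  It reaches some \<open>W j\<close> with \<open>j\<close> in the class, and,
  not lying in \<open>U i\<close>, also some \<open>W l\<close> with \<open>l\<close> outside the class.  It is disjoint from both, so that
  it relates \<open>j\<close> and \<open>l\<close>.
\<close>

lemma U_finitary: assumes i: "i \<in> {1..m}" shows "finitary G (U i)"
proof (rule ccontr)
  assume "\<not> finitary G (U i)"
  then obtain C where C: "cycle C" "cycle_leads_to G C (U i)"
    using not_finitary_cycle[OF U_hereditary[OF i]] by blast
  obtain v where v: "v \<in> cycle_verts G C" using C(1) by (cases C) (auto simp: cycle_iff cycle_verts_def)
  then obtain p x where x: "x \<in> U i" "awalk v p x" using C(2) by (auto simp: cycle_leads_to_def)
  then obtain q j w where j: "j \<in> I i" "w \<in> W j" "awalk x q w" using U_reaches[OF i] by blast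
  have vw: "awalk v (p @ q) w" using x j by auto
  have "v \<in> verts G" using x(2) by (rule awalk_hd_in_verts)
  moreover have "v \<notin> U i" using C(2) v by (auto simp: cycle_leads_to_def)
  ultimately obtain p' y where y: "awalk v p' y" "\<And>q j w. j \<in> I i \<Longrightarrow> w \<in> W j \<Longrightarrow> \<not> awalk y q w"
    using U_iff[OF i] by blast
  obtain l q' w' where l: "l \<in> {1..k}" "w' \<in> W l" "awalk y q' w'"
    using reaches_W awalk_last_in_verts[OF y(1)] by blast
  have vw': "awalk v (p' @ q') w'" using y(1) l(3) by auto
  have jk: "j \<in> {1..k}" by (rule I_subset[OF i j(1)])
  have lI: "l \<notin> I i" using y(2) l by blast
  then have "j \<noteq> l" using j(1) by blast
  have conn: "\<exists>r. awalk u r v" if "u \<in> cycle_verts G C" for u using cycle_connected[OF C(1) that v] .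
  have out: "cycle_verts G C \<inter> W n = {}" if n: "n \<in> {1..k}" for n
  proof (rule ccontr)
    assume "cycle_verts G C \<inter> W n \<noteq> {}"
    then obtain u r where "u \<in> W n" "awalk u r v" using conn by blast
    then have "v \<in> W n" by (rule hereditaryD[OF W_hereditary(1)[OF n]])
    then have "w \<in> W n" "w' \<in> W n" using hereditaryD[OF W_hereditary(1)[OF n]] vw vw' by blast+
    then show False using W_disjoint n jk l(1,2) j(2) \<open>j \<noteq> l\<close> by metis
  qed
  have "cycle_leads_to G C (W j)" "cycle_leads_to G C (W l)"
    unfolding cycle_leads_to_def using out jk l conn vw vw' j(2) by (meson awalk_appendI)+
  then have "(j, l) \<in> cycle_rel" using cycle_relI[OF jk l(1) C(1)] by blast
  then show False using I_closed[OF i j(1)] lI by blast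
qed

sublocale separating_family G base_field "{1..m}" U
  by unfold_locales (use U_hereditary U_finitary U_separated reaches_U in auto)

text \<open>
  As scalars are unique, sharing a scalar is transitive; with equality added it becomes an equivalence
  relation, and it contains the pairs by which the relation is generated.
\<close>

lemma cycle_rel_scalar:
  assumes z: "z \<in> Z" and "(j, l) \<in> cycle_rel" "j \<noteq> l"
  shows "\<exists>c. scalar_on z (W j) c \<and> scalar_on z (W l) c"
proof -
  let ?s = "{(j, l). j \<in> {1..k} \<and> l \<in> {1..k} \<and> (j = l \<or> (\<exists>c. scalar_on z (W j) c \<and> scalar_on z (W l) c))}"
  have unique: "c = d" if n: "n \<in> {1..k}" and cd: "scalar_on z (W n) c" "scalar_on z (W n) d" for n c d
  proof -
    obtain w where "w \<in> W n" using W_hereditary(2)[OF n] by blast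
    then show ?thesis using scalar_on_unique[OF cd] hereditary_verts[OF W_hereditary(1)[OF n]] by blast
  qed
  have "equiv {1..k} ?s"
  proof (rule equivI)
    show "?s \<subseteq> {1..k} \<times> {1..k}" by auto
    show "refl_on {1..k} ?s" by (auto simp: refl_on_def)
    show "sym ?s" unfolding sym_def by blast
    show "trans ?s"
    proof (rule transI)
      fix a b c assume ab: "(a, b) \<in> ?s" and bc: "(b, c) \<in> ?s"
      show "(a, c) \<in> ?s"
      proof (cases "a = b \<or> b = c")
        case True then show ?thesis using ab bc by auto
      next
        case False
        then obtain x y where x: "scalar_on z (W a) x" "scalar_on z (W b) x" "scalar_on z (W b) y" "scalar_on z (W c) y"
          using ab bc by blast
        have "x = y" using unique x(2,3) ab by blast
        then show ?thesis using x ab bc by blast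
      qed
    qed
  qed
  then have "cycle_rel \<subseteq> ?s"
    by (rule cycle_rel_least) (use scalar_of_leads_to[OF z _ _ _ W_minimal W_minimal] in blast)
  then show ?thesis using assms(2,3) by blast
qed

lemma scalar_on_class:
  assumes i: "i \<in> {1..m}"
    and n: "\<not> (\<exists>j\<in>{1..k}. \<exists>C. finitary_ne_cycle G C \<and> W j = cycle_verts G C \<and> U i = perp G (perp G (W j)))"
    and z: "z \<in> Z"
  shows "\<exists>c. \<forall>j\<in>I i. scalar_on z (W j) c"
proof -
  obtain j where j: "j \<in> I i" using I_nonempty[OF i] by blast
  show ?thesis
  proof (cases "I i = {j}")
    case True
    then have "U i = perp G (perp G (W j))" using U_eq[OF i] True by simp
    then have "\<not> (\<exists>C. finitary_ne_cycle G C \<and> W j = cycle_verts G C)" using n I_subset[OF i j] by blast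
    then show ?thesis using scalar_on_minimal_hereditary[OF z W_minimal[OF I_subset[OF i j]]] True by auto
  next
    case False
    then obtain l where l: "l \<in> I i" "l \<noteq> j" using j by blast
    obtain c where c: "scalar_on z (W j) c" using cycle_rel_scalar[OF z I_related[OF i j l(1)]] l(2)
      by blast
    obtain w where w: "w \<in> W j" "w \<in> verts G"
      using W_hereditary[OF I_subset[OF i j]] hereditary_verts by blast
    have "scalar_on z (W n) c" if n: "n \<in> I i" for n
    proof (cases "n = j")
      case False
      then obtain d where d: "scalar_on z (W j) d" "scalar_on z (W n) d"
        using cycle_rel_scalar[OF z I_related[OF i j n]] by blast
      then show ?thesis using scalar_on_unique[OF c d(1) w] by simp
    qed (simp add: c)
    then show ?thesis by blast
  qed
qed

text \<open>
  The difference of the two sides vanishes on the minimal hereditary subsets of the class, which can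
  be reached from everywhere in \<open>U i\<close>.
\<close>

lemma central_ops_scalar:
  assumes i: "i \<in> {1..m}" and T: "T \<in> central_ops (U i)" and c: "\<forall>j\<in>I i. scalar_on (phi (U i) T) (W j) c"
  shows "T = scal c * one_at i"
proof -
  let ?d = "T - scal c * one_at i"
  note Ui = U_hereditary[OF i] U_finitary[OF i]
  have fin: "finite (U i)" by (rule hereditary_finite[OF Ui(1)])
  have d: "?d \<in> central_ops (U i)" using T unit_central[OF fin] by (intro central_ops_closed)
  let ?z = "phi (U i) ?d"
  have z: "?z \<in> Z" "phi (U i) T \<in> Z" using phi_central[OF Ui] d T by blast+
  have zero: "?z * vertex_op w = 0" if j: "j \<in> I i" and w: "w \<in> W j" for j w
  proof -
    have wU: "w \<in> U i" using W_U[OF i j] w by blast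
    have "?z * vertex_op w = vertex_op w * T - vertex_op w * (scal c * one_at i)"
      using phi_inside[OF Ui wU d] Z_vertex[OF z(1), of w] by (simp add: right_diff_distrib)
    also have "vertex_op w * T = scal c * vertex_op w"
      using phi_inside[OF Ui wU T] Z_vertex[OF z(2), of w] c j w by (simp add: scalar_on_def)
    also have "vertex_op w * (scal c * one_at i) = scal c * vertex_op w"
      using unit_of_vertex(2)[OF fin, of w] wU by (simp add: scal_commL)
    finally show ?thesis by simp
  qed
  have "?z * vertex_op u = 0" if u: "u \<in> U i" for u
  proof (rule central_vanishes_at[OF z(1)])
    show "u \<in> verts G" using u hereditary_verts[OF Ui(1)] by blast
    show "\<exists>p w. awalk y p w \<and> ?z * vertex_op w = 0" if "awalk u q y" for q y
      using U_reaches[OF i hereditaryD[OF Ui(1) u that]] zero by blast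
  qed
  then have "one_at i * ?z = 0" using vanishes_on_unit[of "U i" ?z] unit_comm[OF z(1), of "U i"] by simp
  then show ?thesis using unit_phi[OF Ui d] by simp
qed

lemma iso_laurent:
  assumes i: "i \<in> {1..m}" and C: "finitary_ne_cycle G C" and eq: "U i = perp G (perp G (cycle_verts G C))"
  shows "isomorphic_algebras (center (leavitt_sub G (U i)) :: ('f, ('a, 'b, 'f) leavitt_poly set) module) (laurent_algebra :: ('f, int \<Rightarrow>\<^sub>0 'f) module)"
proof -
  have ne: "ne_cycle G C" and fin: "finitary G (cycle_verts G C)" using C
    by (auto simp: finitary_ne_cycle_def)
  have "cycle C" using ne by (simp add: ne_cycle_def)
  then obtain v where v: "v \<in> cycle_verts G C" by (cases C) (auto simp: cycle_iff cycle_verts_def)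
  have her: "hereditary G (cycle_verts G C)" using fin by (simp add: finitary_def)
  have "u \<in> U i" if u: "u \<in> cycle_verts G C" for u
    unfolding eq in_perp_perp
  proof (intro conjI allI impI)
    show "u \<in> verts G" using u hereditary_verts[OF her] by blast
    fix p y assume p: "awalk u p y"
    then have "y \<in> cycle_verts G C" "awalk y [] y"
      using hereditaryD[OF her u p] awalk_last_in_verts[OF p] by (simp_all add: awalk_Nil_iff)
    then show "\<exists>q. \<exists>w\<in>cycle_verts G C. awalk y q w" by blast
  qed
  moreover have "\<exists>p. \<exists>w\<in>cycle_verts G C. awalk u p w" if "u \<in> U i" for u
    using that awalk_Nil_iff[of u u] unfolding eq in_perp_perp by blast
  ultimately interpret ne_cycle_closure G base_field C "U i" v
    using ne fin U_hereditary[OF i] U_finitary[OF i] v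
    by unfold_locales auto
  show ?thesis
  proof (rule isomorphic_center[OF hereditary_verts[OF U_hereditary[OF i]] _ laurent_value_bij])
    show "laurent_value (x \<otimes>\<^bsub>laurent_algebra\<^esub> y) = laurent_value x * laurent_value y" for x y
      by (simp add: laurent_algebra_def laurent_value_mult)
    show "laurent_value (x \<oplus>\<^bsub>laurent_algebra\<^esub> y) = laurent_value x + laurent_value y" for x y
      by (simp add: laurent_algebra_def laurent_value_def lin_ext_add)
    have single: "laurent_value (Poly_Mapping.single 0 c) = scal c * unit_of (U i)" for c
      by (simp add: laurent_value_def lin_ext_single tau_power_0)
    show "laurent_value \<one>\<^bsub>laurent_algebra\<^esub> = unit_of (U i)"
      using single[of 1] by (simp add: laurent_algebra_def)
    show "laurent_value (c \<odot>\<^bsub>laurent_algebra\<^esub> x) = scal c * laurent_value x" for c x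
      by (simp add: laurent_algebra_def mult_map_scale_conv_mult laurent_value_mult single mult.assoc
          unit_absorb laurent_value_central)
  qed (simp add: laurent_algebra_def)
qed

lemma iso_base:
  assumes i: "i \<in> {1..m}"
    and n: "\<not> (\<exists>j\<in>{1..k}. \<exists>C. finitary_ne_cycle G C \<and> W j = cycle_verts G C \<and> U i = perp G (perp G (W j)))"
  shows "isomorphic_algebras (center (leavitt_sub G (U i)) :: ('f, ('a, 'b, 'f) leavitt_poly set) module) (base_algebra :: ('f, 'f) module)"
proof -
  let ?o = "one_at i"
  note Ui = U_hereditary[OF i] U_finitary[OF i]
  have fin: "finite (U i)" by (rule hereditary_finite[OF Ui(1)])
  note o = unit_central[OF fin]
  obtain v where v: "v \<in> U i" "v \<in> verts G" using U_nonempty[OF i] hereditary_verts[OF Ui(1)] by blast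
  have bij: "bij_betw (\<lambda>c. scal c * ?o) UNIV (central_ops (U i))"
    unfolding bij_betw_def
  proof
    show "inj (\<lambda>c. scal c * ?o)"
    proof (rule injI)
      fix c d assume "scal c * ?o = scal d * ?o"
      from arg_cong[OF this, of "\<lambda>T. T * vertex_op v"]
      have "scal c * (?o * vertex_op v) = scal d * (?o * vertex_op v)" by (simp only: mult.assoc)
      then have "scal c * vertex_op v = scal d * vertex_op v" using unit_of_vertex(1)[OF fin, of v] v(1)
        by simp
      then have "coef v [] (scal c * path_op v []) = coef v [] (scal d * path_op v [])" by simp
      then show "c = d" using coef_path_op[of v "[]" v v "[]" v] v(2) by (simp add: awalk_Nil_iff)
    qed
    show "(\<lambda>c. scal c * ?o) ` UNIV = central_ops (U i)"
    proof (intro equalityI subsetI)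
      fix T assume T: "T \<in> central_ops (U i)"
      obtain c where "\<forall>j\<in>I i. scalar_on (phi (U i) T) (W j) c"
        using scalar_on_class[OF i n phi_central[OF Ui T]] by blast
      from central_ops_scalar[OF i T this] show "T \<in> (\<lambda>c. scal c * ?o) ` UNIV" by blast
    qed (use o in \<open>auto intro: central_ops_closed\<close>)
  qed
  have oo: "?o * ?o = ?o" using sub_ops_unit[OF fin central_opsD(1)[OF o]] by simp
  show ?thesis
  proof (rule isomorphic_center[OF hereditary_verts[OF Ui(1)] _ bij])
    have "scal x * ?o * (scal y * ?o) = scal (x * y) * ?o" for x y
    proof -
      have "scal x * ?o * (scal y * ?o) = scal x * (scal y * (?o * ?o))"
        using scal_commL[of ?o y ?o] by (simp only: mult.assoc)
      then show ?thesis by (simp only: oo scal_mult mult.assoc)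
    qed
    then show "scal (x \<otimes>\<^bsub>base_algebra\<^esub> y) * ?o = scal x * ?o * (scal y * ?o)" for x y
      by (simp add: base_algebra_def)
  qed (simp_all add: base_algebra_def scal_add scal_mult distrib_right mult.assoc)
qed

end

theorem theorem2:
  fixes G :: "('v, 'e) pre_digraph"
    and W U :: "nat \<Rightarrow> 'v set"
    and I :: "nat \<Rightarrow> nat set"
    and k m :: nat
  assumes "fin_digraph G"
    and "bij_betw W {1..k} {X. minimal_hereditary G X}"
    and "bij_betw I {1..m} ({1..k} // cycle_equiv G k W)"
    and "\<And>i. i \<in> {1..m} \<Longrightarrow> U i = perp G (perp G (\<Union>j \<in> I i. W j))"
  shows "(\<forall>i \<in> {1..m}. U i \<noteq> {} \<and> finitary G (U i)) \<and>
    internal_direct_sum (leavitt G :: ('f::field, ('v, 'e, 'f) leavitt_poly set) module) {1..m}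
      (\<lambda>i. diagonal_embedding G (U i) ` carrier (center (leavitt_sub G (U i))))
      (carrier (center (leavitt G))) \<and>
    (\<forall>i \<in> {1..m}.
      if \<exists>j \<in> {1..k}. \<exists>C. finitary_ne_cycle G C \<and> W j = cycle_verts G C \<and> U i = perp G (perp G (W j))
      then isomorphic_algebras
        (center (leavitt_sub G (U i) :: ('f, ('v, 'e, 'f) leavitt_poly set) module))
        (laurent_algebra :: ('f, int \<Rightarrow>\<^sub>0 'f) module)
      else isomorphic_algebras
        (center (leavitt_sub G (U i) :: ('f, ('v, 'e, 'f) leavitt_poly set) module))
        (base_algebra :: ('f, 'f) module))"
proof -
  interpret fin_digraph G by (rule assms(1))
  interpret center_decomposition G "TYPE('f)" W U I k m
    by unfold_locales (rule assms)+
  show ?thesis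
  proof (intro conjI ballI)
    fix i assume i: "i \<in> {1..m}"
    show "U i \<noteq> {}" "finitary G (U i)" using U_nonempty[OF i] U_finitary[OF i] by blast+
    show "if \<exists>j \<in> {1..k}. \<exists>C. finitary_ne_cycle G C \<and> W j = cycle_verts G C \<and> U i = perp G (perp G (W j))
      then isomorphic_algebras
        (center (leavitt_sub G (U i) :: ('f, ('v, 'e, 'f) leavitt_poly set) module))
        (laurent_algebra :: ('f, int \<Rightarrow>\<^sub>0 'f) module)
      else isomorphic_algebras
        (center (leavitt_sub G (U i) :: ('f, ('v, 'e, 'f) leavitt_poly set) module))
        (base_algebra :: ('f, 'f) module)"
      using iso_laurent[OF i] iso_base[OF i] by auto
  qed (rule center_direct_sum)
qed

end
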